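(* Let $\Omega$ be the space of right-continuous with left limits paths $[0,1]\to\mathbb{R}$ with canonical process $X$, let $\gamma=\mathcal{N}(0,1)$, and let $\mathsf{R}\in\mathscr{P}(\Omega)$ be the law of the stationary Ornstein--Uhlenbeck process $$dX_t=\sqrt2\,dW_t-X_t\,dt,\qquad X_0\sim\gamma,$$ where $W$ is a standard Brownian motion independent of $X_0$. For $|c|\le1$ let $\gamma_c$ be the centred Gaussian law on $\mathbb{R}^2$ with covariance matrix $\begin{pmatrix}1&c\\c&1\end{pmatrix}$. Let $\pi=\gamma_c$ with $4e^{-1}-3e^{-1/3}\le c<1$. Then the minimisation problem $$\inf\{\mathcal{H}(\mathsf{P}\,|\,\mathsf{R}) : \mathsf{P}\in\mathscr{P}(\Omega),\ \mathsf{P}_t=\gamma\ \ \forall t\in[0,1],\ \mathsf{P}_{01}=\pi\}$$ admits a unique solution.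
   Context: $\mathsf{P}_t$ denotes the law of $X_t$ under $\mathsf{P}$ and $\mathsf{P}_{01}$ the law of $(X_0,X_1)$ under $\mathsf{P}$. The relative entropy is $\mathcal{H}(\mathsf{P}|\mathsf{R})=\mathbf{E}_{\mathsf{P}}[\log\frac{d\mathsf{P}}{d\mathsf{R}}]$ if $\mathsf{P}\ll\mathsf{R}$, and $+\infty$ otherwise. A solution is a $\mathsf{P}$ satisfying the constraints, with finite entropy, that attains the infimum. *)

theory Defs
  imports "HOL-Probability.Probability"
begin

text \<open>A path on \<open>[0,1]\<close> is a function on \<open>real\<close> that equals \<^const>\<open>undefined\<close> off \<open>{0..1}\<close>,
  so that equality of paths is equality on \<open>[0,1]\<close>.\<close>

definition cadlag_paths :: "(real \<Rightarrow> real) set" where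
  "cadlag_paths = {\<omega> \<in> extensional {0..1}.
     (\<forall>t\<in>{0..<1}. (\<omega> \<longlongrightarrow> \<omega> t) (at_right t)) \<and>
     (\<forall>t\<in>{0<..1}. \<exists>l. (\<omega> \<longlongrightarrow> l) (at_left t))}"

text \<open>The \<open>\<sigma>\<close>-algebra on \<open>\<Omega>\<close> is the one generated by the canonical process
  (it coincides with the Borel \<open>\<sigma>\<close>-algebra of the Skorokhod topology). Only the measurable
  structure of this measure is used.\<close>

definition path_space :: "(real \<Rightarrow> real) measure" where
  "path_space = restrict_space (PiM {0..1} (\<lambda>_. borel)) cadlag_paths"

definition std_gaussian :: "real measure" where
  "std_gaussian = density lborel std_normal_density"

text \<open>For \<open>\<bar>c\<bar> \<le> 1\<close>, the linear image of the standard Gaussian law on the plane under the Cholesky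
  factor of \<open>((1, c), (c, 1))\<close>; this includes the degenerate cases \<open>c = 1\<close> and \<open>c = -1\<close>. For
  \<open>\<bar>c\<bar> > 1\<close> the value is meaningless.\<close>

definition gaussian_corr :: "real \<Rightarrow> (real \<times> real) measure" where
  "gaussian_corr c = distr (std_gaussian \<Otimes>\<^sub>M std_gaussian) borel
     (\<lambda>(x, y). (x, c * x + sqrt (1 - c\<^sup>2) * y))"

lemma prob_space_std_gaussian: "prob_space std_gaussian"
  unfolding std_gaussian_def by (rule prob_space_normal_density) simp

lemma has_bochner_integral_std_gaussian:
  "has_bochner_integral std_gaussian (\<lambda>x. 1) (1 :: real)"
  "has_bochner_integral std_gaussian (\<lambda>x. x) 0"
  "has_bochner_integral std_gaussian (\<lambda>x. x\<^sup>2) 1"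
proof -
  have D: "has_bochner_integral std_gaussian f v"
    if "has_bochner_integral lborel (\<lambda>x. std_normal_density x * f x) v" "f \<in> borel_measurable borel"
    for f :: "real \<Rightarrow> real" and v
    unfolding std_gaussian_def using that by (intro has_bochner_integral_density) auto
  show "has_bochner_integral std_gaussian (\<lambda>x. 1) (1 :: real)"
    using std_normal_moment_even[of 0] by (intro D) auto
  show "has_bochner_integral std_gaussian (\<lambda>x. x) 0"
    using std_normal_moment_odd[of 0] by (intro D) auto
  show "has_bochner_integral std_gaussian (\<lambda>x. x\<^sup>2) 1"
    using std_normal_moment_even[of 1] by (intro D) (auto simp: fact_numeral)
qed

lemma has_bochner_integral_std_gaussian_pair:
  fixes f g :: "real \<Rightarrow> real"
  assumes f: "has_bochner_integral std_gaussian f a"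
    and g: "has_bochner_integral std_gaussian g b"
  shows "has_bochner_integral (std_gaussian \<Otimes>\<^sub>M std_gaussian) (\<lambda>p. f (fst p) * g (snd p)) (a * b)"
proof -
  interpret prob_space std_gaussian by (rule prob_space_std_gaussian)
  interpret pair_sigma_finite std_gaussian std_gaussian ..
  have [measurable]: "f \<in> borel_measurable std_gaussian" "g \<in> borel_measurable std_gaussian"
    using f g by (auto dest: borel_measurable_has_bochner_integral)
  have fi: "integrable std_gaussian f" "integral\<^sup>L std_gaussian f = a"
    and gi: "integrable std_gaussian g" "integral\<^sup>L std_gaussian g = b"
    using f g by (auto simp: has_bochner_integral_iff)
  have i: "integrable (std_gaussian \<Otimes>\<^sub>M std_gaussian) (\<lambda>p. f (fst p) * g (snd p))"
    using fi gi by (intro Fubini_integrable) (auto simp: abs_mult)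
  have "integral\<^sup>L (std_gaussian \<Otimes>\<^sub>M std_gaussian) (\<lambda>p. f (fst p) * g (snd p)) = a * b"
    using fi gi i by (subst integral_fst'[symmetric]) auto
  with i show ?thesis by (simp add: has_bochner_integral_iff)
qed

lemma gaussian_corr_moments:
  assumes "\<bar>c\<bar> \<le> 1"
  shows "has_bochner_integral (gaussian_corr c) fst 0"
    and "has_bochner_integral (gaussian_corr c) snd 0"
    and "has_bochner_integral (gaussian_corr c) (\<lambda>p. (fst p)\<^sup>2) 1"
    and "has_bochner_integral (gaussian_corr c) (\<lambda>p. fst p * snd p) c"
    and "has_bochner_integral (gaussian_corr c) (\<lambda>p. (snd p)\<^sup>2) 1"
proof -
  define s where "s = sqrt (1 - c\<^sup>2)"
  have s: "c\<^sup>2 + s\<^sup>2 = 1"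
    using assms by (simp add: s_def abs_square_le_1)
  have [measurable_cong]: "sets std_gaussian = sets borel"
    by (simp add: std_gaussian_def)
  let ?N = "std_gaussian \<Otimes>\<^sub>M std_gaussian"
  note G = has_bochner_integral_std_gaussian
  have x: "has_bochner_integral ?N (\<lambda>p. fst p) 0"
    using has_bochner_integral_std_gaussian_pair[OF G(2) G(1)] by simp
  have y: "has_bochner_integral ?N (\<lambda>p. snd p) 0"
    using has_bochner_integral_std_gaussian_pair[OF G(1) G(2)] by simp
  have xx: "has_bochner_integral ?N (\<lambda>p. (fst p)\<^sup>2) 1"
    using has_bochner_integral_std_gaussian_pair[OF G(3) G(1)] by simp
  have yy: "has_bochner_integral ?N (\<lambda>p. (snd p)\<^sup>2) 1"
    using has_bochner_integral_std_gaussian_pair[OF G(1) G(3)] by simp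
  have xy: "has_bochner_integral ?N (\<lambda>p. fst p * snd p) 0"
    using has_bochner_integral_std_gaussian_pair[OF G(2) G(2)] by simp
  have D: "has_bochner_integral (gaussian_corr c) h v"
    if "has_bochner_integral ?N (\<lambda>p. h (fst p, c * fst p + s * snd p)) v" "h \<in> borel_measurable borel"
    for h :: "real \<times> real \<Rightarrow> real" and v
  proof -
    have "(\<lambda>(x, y). (x, c * x + sqrt (1 - c\<^sup>2) * y)) \<in> measurable ?N (borel :: (real \<times> real) measure)"
      unfolding borel_prod[symmetric] by measurable
    with that show ?thesis
      by (auto simp: has_bochner_integral_iff gaussian_corr_def integral_distr integrable_distr_eq
          s_def split_beta')
  qed
  have [measurable]: "fst \<in> borel_measurable (borel :: (real \<times> real) measure)"
    "snd \<in> borel_measurable (borel :: (real \<times> real) measure)"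
    by (auto intro!: borel_measurable_continuous_onI continuous_intros)
  show "has_bochner_integral (gaussian_corr c) fst 0"
    using x by (intro D) auto
  show "has_bochner_integral (gaussian_corr c) snd 0"
    using has_bochner_integral_add[OF has_bochner_integral_mult_right[of c, OF x]
        has_bochner_integral_mult_right[of s, OF y]] by (intro D) auto
  show "has_bochner_integral (gaussian_corr c) (\<lambda>p. (fst p)\<^sup>2) 1"
    using xx by (intro D) auto
  show "has_bochner_integral (gaussian_corr c) (\<lambda>p. fst p * snd p) c"
    using has_bochner_integral_add[OF has_bochner_integral_mult_right[of c, OF xx]
        has_bochner_integral_mult_right[of s, OF xy]]
    by (intro D) (auto simp: power2_eq_square algebra_simps)
  have "has_bochner_integral ?N
     (\<lambda>p. c\<^sup>2 * (fst p)\<^sup>2 + 2 * c * s * (fst p * snd p) + s\<^sup>2 * (snd p)\<^sup>2) (c\<^sup>2 * 1 + 2 * c * s * 0 + s\<^sup>2 * 1)"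
    using xx xy yy by (intro has_bochner_integral_add has_bochner_integral_mult_right) auto
  then show "has_bochner_integral (gaussian_corr c) (\<lambda>p. (snd p)\<^sup>2) 1"
    using s by (intro D) (auto simp: power2_eq_square algebra_simps)
qed

text \<open>Brownian motion is needed on the time interval \<open>[0,1]\<close> only; values of \<open>W\<close> at other times are
  unconstrained.\<close>

definition brownian_motion :: "'a measure \<Rightarrow> (real \<Rightarrow> 'a \<Rightarrow> real) \<Rightarrow> bool" where
  "brownian_motion M W \<longleftrightarrow> prob_space M \<and>
     (\<forall>t\<in>{0..1}. W t \<in> borel_measurable M) \<and>
     (AE \<xi> in M. W 0 \<xi> = 0) \<and>
     (\<forall>s t. 0 \<le> s \<and> s < t \<and> t \<le> 1 \<longrightarrow>
        distr M borel (\<lambda>\<xi>. W t \<xi> - W s \<xi>) = density lborel (normal_density 0 (sqrt (t - s)))) \<and>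
     (\<forall>(n::nat) (\<tau>::nat \<Rightarrow> real). 0 \<le> \<tau> 0 \<and> (\<forall>i<n. \<tau> i < \<tau> (Suc i)) \<and> \<tau> n \<le> 1 \<longrightarrow>
        prob_space.indep_vars M (\<lambda>_. borel) (\<lambda>i \<xi>. W (\<tau> (Suc i)) \<xi> - W (\<tau> i) \<xi>) {..<n}) \<and>
     (AE \<xi> in M. continuous_on {0..1} (\<lambda>t. W t \<xi>))"

text \<open>\<open>X\<close> is a path-valued random variable on \<open>M\<close> solving
  \<open>dX = sqrt 2 dW - X dt\<close>, \<open>X\<^sub>0\<close> standard Gaussian and independent of \<open>W\<close>. As the noise is additive,
  the equation in integrated form involves no stochastic integral. Independence is stated for the
  generated \<open>\<sigma>\<close>-algebras, since \<^const>\<open>prob_space.indep_var\<close> requires both variables to take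
  values in the same type.\<close>

definition stationary_OU ::
    "'a measure \<Rightarrow> (real \<Rightarrow> 'a \<Rightarrow> real) \<Rightarrow> ('a \<Rightarrow> real \<Rightarrow> real) \<Rightarrow> bool" where
  "stationary_OU M W X \<longleftrightarrow>
     brownian_motion M W \<and>
     X \<in> measurable M path_space \<and>
     distr M borel (\<lambda>\<xi>. X \<xi> 0) = std_gaussian \<and>
     prob_space.indep_set M
       (sets (vimage_algebra (space M) (\<lambda>\<xi>. X \<xi> 0) borel))
       (sets (vimage_algebra (space M) (\<lambda>\<xi>. \<lambda>t\<in>{0..1}. W t \<xi>) (PiM {0..1} (\<lambda>_. borel)))) \<and>
     (AE \<xi> in M. \<forall>t\<in>{0..1}.
        X \<xi> t = X \<xi> 0 + sqrt 2 * W t \<xi> - set_lebesgue_integral lborel {0..t} (X \<xi>))"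

text \<open>When \<open>P\<close> is absolutely continuous with respect to \<open>R\<close>, the negative part of \<open>log (dP/dR)\<close> is
  \<open>P\<close>-integrable, so non-integrability means that the expectation is \<open>\<infinity>\<close>. The Bochner integral
  behind \<^const>\<open>KL_divergence\<close> would return \<open>0\<close> there.\<close>

definition relative_entropy :: "'a measure \<Rightarrow> 'a measure \<Rightarrow> ereal" where
  "relative_entropy P R =
     (if absolutely_continuous R P \<and> integrable P (entropy_density (exp 1) R P)
      then ereal (KL_divergence (exp 1) R P) else \<infinity>)"

definition admissible :: "(real \<times> real) measure \<Rightarrow> (real \<Rightarrow> real) measure set" where
  "admissible \<pi> = {P. prob_space P \<and> sets P = sets path_space \<and>
     (\<forall>t\<in>{0..1}. distr P borel (\<lambda>\<omega>. \<omega> t) = std_gaussian) \<and>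
     distr P borel (\<lambda>\<omega>. (\<omega> 0, \<omega> 1)) = \<pi>}"

definition is_solution ::
    "(real \<Rightarrow> real) measure \<Rightarrow> (real \<times> real) measure \<Rightarrow> (real \<Rightarrow> real) measure \<Rightarrow> bool" where
  "is_solution R \<pi> P \<longleftrightarrow> P \<in> admissible \<pi> \<and> relative_entropy P R < \<infinity> \<and>
     relative_entropy P R = (INF Q\<in>admissible \<pi>. relative_entropy Q R)"

end

(* The constraints define a convex set of laws closed in total variation, and
     a log a + b log b - 2 m log m \<ge> (sqrt a - sqrt b)^2 / 2   for m = (a + b) / 2
   makes every minimising sequence of densities Cauchy in L^1, so the infimum is attained by a
   unique law as soon as some admissible law has finite entropy.

   Such a law is obtained by tilting R along the times 1/4, 1/2, 3/4, 1. Suppose that a law G R with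
   one-time marginals \<gamma> on [0,s] makes (X_0, X_s) Gaussian with correlation \<rho>. The part \<zeta> of X_0 that is
   orthogonal to X_s and the noise \<xi> that drives X from s to s' are then independent standard
   Gaussians. Multiplying G by the density of the Gaussian law with correlation k at (\<zeta>, \<xi>)
   correlates them without changing the law of (X_s, \<xi>), hence keeps all one-time marginals, and gives
   corr(X_0, X_s') = r \<rho> + k sqrt ((1 - r^2) (1 - \<rho>^2)) with r = exp (s - s'). Choosing k at each step
   steers the correlation to c; as log G is bounded by a quadratic in finitely many X_t,
   the entropy is finite. *)

theory Submission
  imports Defs
begin

subsection \<open>Minimisers of relative entropy\<close>

text \<open>The bound on \<open>c\<close> is cos (3 a) with cos a = exp (-1/3), because cos (3 a) =
  4 (cos a)^3 - 3 cos a. In angles, with \<rho> = cos \<phi> and r = cos a, a tilting step reaches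
  the correlations strictly between cos (\<phi> + a) and cos (\<phi> - a), since |k| < 1; a tilt
  with |k| = 1 would be singular. Three steps of length 1/3 therefore approach the bound without
  attaining it. Steps of length 1/4 go strictly beyond it, which also leaves room for rational
  estimates.

  On the side of R the obstacle is that X is given by an equation driven by an abstract Brownian
  motion. Besides the law of X_0, one fact about it is used: for s < t the normalised innovation of
  X over [s,t] is a standard Gaussian independent of the whole path up to s. As the noise is
  additive, the innovation is an integral of exp u dW_u that makes sense path by path after
  integration by parts. It is an almost sure limit of Riemann sums of Brownian increments, and both
  Gaussianity and independence survive that limit.\<close>

text \<open>The right side is the Bregman divergence a ln (a / m) - a + m of x ln x. It dominates
  the squared Hellinger distance by ln y <= y - 1 at y = sqrt (m / a).\<close>

lemma bregman_xlnx_ge: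
  fixes a m :: real
  assumes "0 \<le> a" "0 < m"
  shows "(sqrt a - sqrt m)\<^sup>2 \<le> a * ln a - a * ln m - a + m"
proof (cases "a = 0")
  case False
  with assms have a: "a > 0" by simp
  have "ln (sqrt (m / a)) \<le> sqrt (m / a) - 1"
    using a assms by (intro ln_le_minus_one) auto
  then have "a * ln (m / a) \<le> a * (2 * (sqrt (m / a) - 1))"
    using a assms by (intro mult_left_mono) (auto simp: ln_sqrt)
  also have "a * (2 * (sqrt (m / a) - 1)) = 2 * sqrt a * sqrt m - 2 * a"
    using a assms by (simp add: real_sqrt_divide field_simps)
  finally have "a * ln (m / a) \<le> 2 * sqrt a * sqrt m - 2 * a" .
  moreover have "ln (m / a) = ln m - ln a" using a assms by (simp add: ln_div)
  ultimately show ?thesis using a assms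
    by (simp add: power2_diff algebra_simps)
qed (use assms in auto)

text \<open>The quantitative strict convexity behind both existence and uniqueness. Hellinger
  control becomes control of |a - b| through |a - b| = |sqrt a - sqrt b| (sqrt a + sqrt b) and
  Young's inequality. The weight \<open>d\<close> stays free so that it can be chosen after
  integration, which takes the place of Cauchy-Schwarz.\<close>

lemma xlnx_midpoint_gap:
  fixes a b d :: real
  assumes "0 \<le> a" "0 \<le> b" "0 < d"
  shows "d * \<bar>a - b\<bar> \<le> a * ln a + b * ln b - 2 * ((a + b) / 2 * ln ((a + b) / 2)) + d\<^sup>2 * (a + b)"
proof (cases "a = 0 \<and> b = 0")
  case False
  define m where "m = (a + b) / 2"
  have m: "0 < m" using False assms by (auto simp: m_def)
  define x y z where "x = sqrt a" "y = sqrt b" "z = sqrt m"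
  have sq: "a = x\<^sup>2" "b = y\<^sup>2" "x \<ge> 0" "y \<ge> 0" using assms by (auto simp: x_y_z_def)
  \<comment> \<open>The linear parts of the two Bregman bounds cancel because \<open>m\<close> is
    the mean of \<open>a\<close> and \<open>b\<close>.\<close>
  have 1: "(x - z)\<^sup>2 + (y - z)\<^sup>2 \<le> a * ln a + b * ln b - 2 * (m * ln m)"
  proof -
    have "2 * (m * ln m) = a * ln m + b * ln m" "2 * m = a + b"
      by (auto simp: m_def algebra_simps)
    then show ?thesis
      using bregman_xlnx_ge[OF assms(1) m] bregman_xlnx_ge[OF assms(2) m]
      unfolding x_y_z_def by linarith
  qed
  have 2: "(x - y)\<^sup>2 \<le> 2 * ((x - z)\<^sup>2 + (y - z)\<^sup>2)"
    using zero_le_power2[of "x + y - 2 * z"] by (simp add: power2_eq_square algebra_simps)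
  have "\<bar>a - b\<bar> = \<bar>x - y\<bar> * (x + y)"
  proof -
    have "a - b = (x - y) * (x + y)" by (simp add: sq power2_eq_square algebra_simps)
    then show ?thesis using sq by (simp add: abs_mult)
  qed
  then have "2 * (d * \<bar>a - b\<bar>) = 2 * \<bar>x - y\<bar> * (d * (x + y))" by simp
  also have "\<dots> \<le> (x - y)\<^sup>2 + (d * (x + y))\<^sup>2"
    using sum_squares_bound[of "\<bar>x - y\<bar>" "d * (x + y)"] by simp
  also have "(d * (x + y))\<^sup>2 \<le> d\<^sup>2 * (2 * (a + b))"
    using zero_le_power2[of "x - y"] unfolding power_mult_distrib sq
    by (intro mult_left_mono) (auto simp: power2_eq_square algebra_simps)
  finally show ?thesis using 1 2 unfolding m_def[symmetric] by (simp add: algebra_simps)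
qed (use assms in auto)

lemma xlnx_ge: "x * ln x \<ge> x - 1" if "x \<ge> 0" for x :: real
  using order_trans[OF zero_le_power2 bregman_xlnx_ge[of x 1]] that by simp

text \<open>Moves the integrability test inside \<open>relative_entropy\<close> from the tilted
  measure to \<open>R\<close>, where it concerns an explicit function. \<open>RN_deriv\<close>
  equals \<open>f\<close> only almost everywhere, so the integrands are compared almost
  everywhere.\<close>

lemma integrable_entropy_density_iff:
  fixes f :: "'a \<Rightarrow> real"
  assumes "prob_space R" and [measurable]: "f \<in> borel_measurable R" and f0: "\<And>x. 0 \<le> f x"
  shows "integrable (density R f) (entropy_density (exp 1) R (density R f)) \<longleftrightarrow>
    integrable R (\<lambda>x. f x * ln (f x))"
proof -
  interpret prob_space R by fact
  have "AE x in R. f x = RN_deriv R (density R f) x"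
    by (rule RN_deriv_unique) auto
  then have "AE x in R. f x *\<^sub>R entropy_density (exp 1) R (density R f) x = f x * ln (f x)"
    by eventually_elim (use f0 in \<open>auto simp: entropy_density_def log_def dest!: sym[of "ennreal _"]\<close>)
  then have "integrable R (\<lambda>x. f x *\<^sub>R entropy_density (exp 1) R (density R f) x) \<longleftrightarrow>
     integrable R (\<lambda>x. f x * ln (f x))"
    by (intro integrable_cong_AE) auto
  then show ?thesis
    by (subst integrable_density) (use f0 in auto)
qed

lemma relative_entropy_density:
  fixes f :: "'a \<Rightarrow> real"
  assumes "prob_space R" and [measurable]: "f \<in> borel_measurable R" and f0: "\<And>x. 0 \<le> f x"
  shows "relative_entropy (density R f) R =
    (if integrable R (\<lambda>x. f x * ln (f x)) then ereal (\<integral>x. f x * ln (f x) \<partial>R) else \<infinity>)"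
proof -
  interpret prob_space R by fact
  have "absolutely_continuous R (density R f)"
    by (auto intro: absolutely_continuousI_density)
  moreover have "KL_divergence (exp 1) R (density R f) = (\<integral>x. f x * ln (f x) \<partial>R)"
    by (subst KL_density) (use f0 in \<open>auto simp: log_def\<close>)
  ultimately show ?thesis
    unfolding relative_entropy_def integrable_entropy_density_iff[OF assms] by simp
qed

text \<open>Finite entropy forces absolute continuity, and the Radon-Nikodym derivative then has a
  real-valued version because both measures are finite.\<close>

lemma finite_relative_entropy_density:
  assumes R: "prob_space R" and P: "prob_space P" and "sets P = sets R" and "relative_entropy P R < \<infinity>"
  obtains f :: "'a \<Rightarrow> real" where "f \<in> borel_measurable R" "\<And>x. 0 \<le> f x" "P = density R f"
proof -
  interpret prob_space R by fact
  interpret P: prob_space P by fact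
  have "absolutely_continuous R P"
    using assms by (auto simp: relative_entropy_def split: if_splits)
  from real_RN_deriv[OF P.finite_measure_axioms this \<open>sets P = sets R\<close>] obtain D
    where D: "D \<in> borel_measurable R" "AE x in R. RN_deriv R P x = ennreal (D x)" "\<And>x. 0 \<le> D x" by metis
  have "P = density R (RN_deriv R P)"
    using density_RN_deriv \<open>absolutely_continuous R P\<close> \<open>sets P = sets R\<close> by simp
  also have "\<dots> = density R D"
    using D by (intro density_cong) auto
  finally show ?thesis using that D by blast
qed

text \<open>At the limit 0 the logarithm itself has no limit. The product is squeezed between - 2
  sqrt x, which comes from ln y <= y - 1 at y = 1 / sqrt x, and x^2.\<close>

lemma tendsto_xlnx:
  fixes f :: "nat \<Rightarrow> real"
  assumes f: "f \<longlonglongrightarrow> a" and f0: "\<And>n. 0 \<le> f n"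
  shows "(\<lambda>n. f n * ln (f n)) \<longlonglongrightarrow> a * ln a"
proof (cases "a = 0")
  case True
  have lower: "- (2 * sqrt x) \<le> x * ln x" if "0 \<le> x" for x :: real
  proof (cases "x = 0")
    case False
    then have x: "x > 0" using that by simp
    have "ln (1 / sqrt x) \<le> 1 / sqrt x - 1"
      using x by (intro ln_le_minus_one) auto
    then have "- ln x \<le> 2 * (1 / sqrt x)"
      using x by (simp add: ln_div ln_sqrt)
    then have "x * (- ln x) \<le> x * (2 * (1 / sqrt x))"
      using x by (intro mult_left_mono) auto
    also have "\<dots> = 2 * sqrt x"
      using x by (simp add: field_simps)
    finally show ?thesis by simp
  qed simp
  have upper: "x * ln x \<le> x * x" if "0 \<le> x" for x :: real
    using that ln_le_minus_one[of x] by (cases "x = 0") (auto intro!: mult_left_mono)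
  have "(\<lambda>n. f n * ln (f n)) \<longlonglongrightarrow> 0"
  proof (rule tendsto_sandwich)
    show "(\<lambda>n. - (2 * sqrt (f n))) \<longlonglongrightarrow> 0"
      using f True by (auto intro!: tendsto_eq_intros)
    show "(\<lambda>n. f n * f n) \<longlonglongrightarrow> 0"
      using f True by (auto intro!: tendsto_eq_intros)
  qed (use lower upper f0 in auto)
  with True show ?thesis by simp
next
  case False
  have "0 \<le> a" using f f0 by (intro LIMSEQ_le_const) auto
  with False show ?thesis
    using f by (intro tendsto_intros) auto
qed

text \<open>The marginal constraints enter as prescribed probabilities of events. These are linear
  in the density, so they survive midpoints and L^1 limits, and the argument is about an arbitrary
  probability space. Lower semicontinuity of the entropy is Fatou's lemma.\<close>

lemma ex1_entropy_minimiser: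
  fixes R :: "'a measure" and C :: "('a set \<times> real) set"
  defines "K \<equiv> {P. prob_space P \<and> sets P = sets R \<and> (\<forall>(A, p)\<in>C. measure P A = p)}"
  assumes R: "prob_space R" and C: "\<And>A p. (A, p) \<in> C \<Longrightarrow> A \<in> sets R"
    and ex: "\<exists>P\<in>K. relative_entropy P R < \<infinity>"
  shows "\<exists>!P. P \<in> K \<and> relative_entropy P R < \<infinity> \<and> relative_entropy P R = (INF Q\<in>K. relative_entropy Q R)"
proof -
  interpret prob_space R by fact
  define J :: "('a \<Rightarrow> real) \<Rightarrow> real" where "J f = (\<integral>x. f x * ln (f x) \<partial>R)" for f
  \<comment> \<open>Densities of the members of \<open>K\<close> with finite entropy;
    \<open>DK\<close> and \<open>KD\<close> translate between the two. Nonnegativity is imposed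
    everywhere, not just almost everywhere.\<close>
  define D :: "('a \<Rightarrow> real) set" where
    "D = {f. f \<in> borel_measurable R \<and> (\<forall>x. 0 \<le> f x) \<and> integrable R f \<and> integral\<^sup>L R f = 1 \<and>
       (\<forall>(A, p)\<in>C. (\<integral>x. f x * indicator A x \<partial>R) = p) \<and> integrable R (\<lambda>x. f x * ln (f x))}"
  have meas: "measure (density R f) A = (\<integral>x. f x * indicator A x \<partial>R)"
    if "f \<in> borel_measurable R" "\<And>x. 0 \<le> f x" "A \<in> sets R" for f :: "'a \<Rightarrow> real" and A
  proof -
    have "measure (density R f) A = enn2real (\<integral>\<^sup>+x. ennreal (f x * indicator A x) \<partial>R)"
      unfolding measure_def using that
      by (subst emeasure_density) (auto intro!: arg_cong[where f=enn2real] nn_integral_cong split: split_indicator)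
    also have "\<dots> = (\<integral>x. f x * indicator A x \<partial>R)"
      using that by (subst integral_eq_nn_integral) auto
    finally show ?thesis .
  qed
  have DK: "density R f \<in> K" "relative_entropy (density R f) R = ereal (J f)" if "f \<in> D" for f
  proof -
    have "emeasure (density R f) (space R) = ennreal (integral\<^sup>L R f)"
      using that nn_integral_eq_integral[of R f]
      by (subst emeasure_density) (auto simp: D_def cong: nn_integral_cong)
    then have "prob_space (density R f)"
      using that by (auto intro!: prob_spaceI simp: D_def)
    then show "density R f \<in> K"
      using that C by (auto simp: K_def D_def meas)
    show "relative_entropy (density R f) R = ereal (J f)"
      using that relative_entropy_density[OF R, of f] by (auto simp: D_def J_def)
  qed
  have KD: "\<exists>f\<in>D. P = density R f" if P: "P \<in> K" "relative_entropy P R < \<infinity>" for P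
  proof -
    interpret P: prob_space P using P by (simp add: K_def)
    from finite_relative_entropy_density[OF R P.prob_space_axioms] P obtain f :: "'a \<Rightarrow> real"
      where f: "f \<in> borel_measurable R" "\<And>x. 0 \<le> f x" "P = density R f" by (auto simp: K_def)
    have 1: "(\<integral>\<^sup>+x. ennreal (f x) \<partial>R) = 1"
      using P.emeasure_space_1 f by (auto simp: emeasure_density cong: nn_integral_cong)
    have int: "integrable R f"
      using f 1 by (intro integrableI_nonneg) auto
    have "integral\<^sup>L R f = 1"
      using f 1 by (subst integral_eq_nn_integral) auto
    moreover have "integrable R (\<lambda>x. f x * ln (f x))"
      using P relative_entropy_density[OF R, of f] f by (auto split: if_splits)
    moreover have "(\<integral>x. f x * indicator A x \<partial>R) = p" if "(A, p) \<in> C" for A p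
      using P that meas[OF f(1,2) C[OF that]] by (auto simp: K_def f(3))
    ultimately have "f \<in> D" using f int by (auto simp: D_def)
    with f show ?thesis by blast
  qed
  have Jnn: "0 \<le> J f" if "f \<in> D" for f
  proof -
    have "(\<integral>x. f x - 1 \<partial>R) \<le> J f"
      unfolding J_def using that by (intro integral_mono) (auto simp: D_def intro: xlnx_ge)
    then show ?thesis using that by (simp add: D_def prob_space)
  qed
  define m where "m = Inf (J ` D)"
  have bdd: "bdd_below (J ` D)" using Jnn by (auto intro!: bdd_belowI[of _ 0])
  have mle: "m \<le> J f" if "f \<in> D" for f
    unfolding m_def using that bdd by (auto intro: cInf_lower)
  have Dne: "D \<noteq> {}" using ex KD by blast
  \<comment> \<open>The midpoint \<open>h\<close> lies in \<open>D\<close>, so J h >= m. Integrating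
    \<open>xlnx_midpoint_gap\<close> then bounds the L^1 distance by the excess of \<open>f\<close>
    and \<open>g\<close> over the infimum.\<close>
  have gap: "d * (\<integral>x. \<bar>f x - g x\<bar> \<partial>R) \<le> J f + J g - 2 * m + 2 * d\<^sup>2"
    if fg: "f \<in> D" "g \<in> D" and d: "0 < d" for f g d
  proof -
    define h where "h x = (f x + g x) / 2" for x
    have [measurable]: "f \<in> borel_measurable R" "g \<in> borel_measurable R"
      "h \<in> borel_measurable R" using fg by (auto simp: D_def h_def[abs_def])
    have nn: "0 \<le> f x" "0 \<le> g x" "0 \<le> h x" for x using fg by (auto simp: D_def h_def)
    have int: "integrable R f" "integrable R g" "integrable R h"
      "integrable R (\<lambda>x. f x * ln (f x))" "integrable R (\<lambda>x. g x * ln (g x))"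
      using fg by (auto simp: D_def h_def[abs_def])
    have pt: "d * \<bar>f x - g x\<bar> \<le> f x * ln (f x) + g x * ln (g x) - 2 * (h x * ln (h x)) + d\<^sup>2 * (f x + g x)"
      if "0 < d" for d x
      unfolding h_def by (rule xlnx_midpoint_gap[OF nn(1,2) that])
    \<comment> \<open>From above, h ln h is controlled by the gap inequality with d = 1; from below,
      by x ln x >= x - 1.\<close>
    have inth: "integrable R (\<lambda>x. h x * ln (h x))"
    proof (rule Bochner_Integration.integrable_bound)
      show "integrable R (\<lambda>x. \<bar>f x * ln (f x)\<bar> + \<bar>g x * ln (g x)\<bar> + f x + g x + 1)"
        using int by auto
      have "\<bar>h x * ln (h x)\<bar> \<le> \<bar>f x * ln (f x)\<bar> + \<bar>g x * ln (g x)\<bar> + f x + g x + 1" for x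
      proof -
        have "0 \<le> f x * ln (f x) + g x * ln (g x) - 2 * (h x * ln (h x)) + (f x + g x)"
          using order_trans[OF abs_ge_zero, of "f x - g x"] pt[of 1 x] by simp
        then show ?thesis
          using xlnx_ge[OF nn(3)[of x]] nn[of x] by linarith
      qed
      then show "AE x in R. norm (h x * ln (h x)) \<le>
          norm (\<bar>f x * ln (f x)\<bar> + \<bar>g x * ln (g x)\<bar> + f x + g x + 1)"
        using nn by (auto intro!: AE_I2 order_trans[OF _ abs_ge_self])
    qed auto
    have hp: "(\<integral>x. h x * indicator A x \<partial>R) = p" if "(A, p) \<in> C" for A p
    proof -
      have "(\<integral>x. h x * indicator A x \<partial>R) =
          (\<integral>x. (f x * indicator A x + g x * indicator A x) / 2 \<partial>R)"
        by (intro Bochner_Integration.integral_cong) (auto simp: h_def split: split_indicator)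
      also have "\<dots> = ((\<integral>x. f x * indicator A x \<partial>R) + (\<integral>x. g x * indicator A x \<partial>R)) / 2"
        using int C[OF that] by (subst integral_divide_zero, subst Bochner_Integration.integral_add)
          (auto intro!: integrable_real_mult_indicator)
      also have "(\<integral>x. f x * indicator A x \<partial>R) = p"
        using fg that by (auto simp: D_def)
      also have "(\<integral>x. g x * indicator A x \<partial>R) = p"
        using fg that by (auto simp: D_def)
      finally show ?thesis by simp
    qed
    have "integral\<^sup>L R h = 1"
      using fg int by (simp add: h_def[abs_def] D_def)
    then have "h \<in> D"
      using inth int nn hp by (auto simp: D_def)
    then have "m \<le> J h" by (rule mle)
    have "d * (\<integral>x. \<bar>f x - g x\<bar> \<partial>R) = (\<integral>x. d * \<bar>f x - g x\<bar> \<partial>R)" by simp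
    also have "\<dots> \<le> (\<integral>x. f x * ln (f x) + g x * ln (g x) - 2 * (h x * ln (h x)) + d\<^sup>2 * (f x + g x) \<partial>R)"
      using int inth pt[OF d] by (intro integral_mono) auto
    also have "\<dots> = J f + J g - 2 * J h + 2 * d\<^sup>2"
      using int inth fg by (simp add: J_def D_def)
    finally show ?thesis using \<open>m \<le> J h\<close> by linarith
  qed

  \<comment> \<open>With excess below (1/4)^n / 2 and d = (1/2)^n in \<open>gap\<close>, consecutive
    densities are within 3 (1/2)^n in L^1. Summability of these distances makes the telescoping
    series converge almost everywhere.\<close>
  have "\<exists>f\<in>D. J f < m + (1/4)^n / 2" for n :: nat
    using cInf_lessD[of "J ` D" "m + (1/4)^n / 2"] Dne by (auto simp: m_def)
  then obtain f where fD: "\<And>n. f n \<in> D" and fJ: "\<And>n. J (f n) < m + (1/4)^n / 2" for n :: nat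
    by metis
  have [measurable]: "f n \<in> borel_measurable R" for n using fD[of n] by (simp add: D_def)
  have f0: "0 \<le> f n x" for n x using fD[of n] by (simp add: D_def)
  have fint: "integrable R (f n)" for n using fD[of n] by (simp add: D_def)
  define h where "h n x = f (Suc n) x - f n x" for n x
  have [measurable]: "h n \<in> borel_measurable R" for n by (simp add: h_def[abs_def])
  have hint: "integrable R (h n)" for n using fint by (simp add: h_def[abs_def])
  have quarter: "((1/2)^n)\<^sup>2 = ((1/4)^n :: real)" for n
    by (simp add: power2_eq_square power_mult_distrib[symmetric])
  have hb: "(\<integral>x. norm (h n x) \<partial>R) \<le> 3 * (1/2)^n" for n
  proof -
    have "(1/2)^n * (\<integral>x. \<bar>f (Suc n) x - f n x\<bar> \<partial>R) \<le> J (f (Suc n)) + J (f n) - 2 * m + 2 * ((1/2)^n)\<^sup>2"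
      using fD by (intro gap) auto
    also have "\<dots> \<le> (1/4)^n + 2 * (1/4)^n"
    proof -
      have "J (f (Suc n)) < m + (1/4)^n / 2"
      proof -
        have "(1/4)^Suc n \<le> ((1/4)^n :: real)" by (rule power_decreasing) auto
        then show ?thesis using fJ[of "Suc n"] by linarith
      qed
      with fJ[of n] show ?thesis unfolding quarter by linarith
    qed
    also have "\<dots> = (1/2)^n * (3 * (1/2)^n)"
      by (simp add: power_mult_distrib[symmetric])
    finally show ?thesis by (simp add: h_def)
  qed
  have hsum: "summable (\<lambda>n. \<integral>x. norm (h n x) \<partial>R)"
    by (rule summable_comparison_test'[where g="\<lambda>n. 3 * (1/2)^n" and N=0]) (use hb in auto)
  have hAE: "AE x in R. summable (\<lambda>n. norm (h n x))"
  proof -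
    have "(\<integral>\<^sup>+x. (\<Sum>n. ennreal (norm (h n x))) \<partial>R) = (\<Sum>n. \<integral>\<^sup>+x. ennreal (norm (h n x)) \<partial>R)"
      by (intro nn_integral_suminf) auto
    also have "\<dots> = (\<Sum>n. ennreal (\<integral>x. norm (h n x) \<partial>R))"
      using hint by (intro suminf_cong nn_integral_eq_integral) auto
    also have "\<dots> < \<infinity>"
      using hsum by (subst suminf_ennreal2) auto
    finally have "AE x in R. (\<Sum>n. ennreal (norm (h n x))) \<noteq> \<infinity>"
      by (intro nn_integral_noteq_infinite) auto
    then show ?thesis
      by eventually_elim (auto intro!: summable_suminf_not_top)
  qed
  \<comment> \<open>The truncation at 0 keeps \<open>F\<close> nonnegative even on the null set
    where the series may diverge, as membership in \<open>D\<close> requires.\<close>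
  define F where "F x = max 0 (f 0 x + (\<Sum>n. h n x))" for x
  have [measurable]: "F \<in> borel_measurable R" by (simp add: F_def[abs_def])
  have lim: "AE x in R. (\<lambda>n. f n x) \<longlonglongrightarrow> F x \<and> F x = f 0 x + (\<Sum>n. h n x)"
    using hAE
  proof eventually_elim
    case (elim x)
    then have "(\<lambda>n. f 0 x + (\<Sum>i<n. h i x)) \<longlonglongrightarrow> f 0 x + (\<Sum>n. h n x)"
      by (intro tendsto_add tendsto_const summable_LIMSEQ) (rule summable_norm_cancel)
    moreover have "f 0 x + (\<Sum>i<n. h i x) = f n x" for n
      by (simp add: h_def sum_lessThan_telescope[of "\<lambda>i. f i x"])
    ultimately have *: "(\<lambda>n. f n x) \<longlonglongrightarrow> f 0 x + (\<Sum>n. h n x)" by simp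
    then have "0 \<le> f 0 x + (\<Sum>n. h n x)"
      using f0 by (intro LIMSEQ_le_const) auto
    with * show ?case by (simp add: F_def)
  qed
  \<comment> \<open>Each increment integrates to 0 over \<open>A\<close>, since all
    \<open>f n\<close> give it the same mass; integrating the series term by term leaves the mass of
    \<open>f 0\<close>.\<close>
  have Flin: "integrable R (\<lambda>x. F x * indicator A x) \<and> (\<integral>x. F x * indicator A x \<partial>R) = p"
    if A: "A \<in> sets R" and p: "\<And>n. (\<integral>x. f n x * indicator A x \<partial>R) = p" for A p
  proof -
    let ?h = "\<lambda>n x. h n x * indicator A x"
    have i: "integrable R (?h n)" "integrable R (\<lambda>x. f n x * indicator A x)" for n
      using hint fint A by (auto intro: integrable_real_mult_indicator)
    have ae: "AE x in R. summable (\<lambda>n. norm (?h n x))"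
      using hAE by eventually_elim (auto split: split_indicator)
    have "norm (norm (LINT x|R. norm (?h n x))) \<le> (\<integral>x. norm (h n x) \<partial>R)" for n
      using i hint by (auto intro!: integral_mono split: split_indicator)
    then have sm: "summable (\<lambda>n. \<integral>x. norm (?h n x) \<partial>R)"
      by (intro summable_comparison_test'[OF hsum, where N=0]) auto
    have z: "(\<integral>x. ?h n x \<partial>R) = 0" for n
      using i[of n] i(2)[of "Suc n"] p by (simp add: h_def left_diff_distrib)
    have "(\<integral>x. (\<Sum>n. ?h n x) \<partial>R) = 0"
      using sums_integral[OF i(1) ae sm] by (simp add: z sums_iff)
    moreover have "integrable R (\<lambda>x. \<Sum>n. ?h n x)"
      using i ae sm by (intro integrable_suminf) auto
    moreover have "AE x in R. F x * indicator A x = f 0 x * indicator A x + (\<Sum>n. ?h n x)"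
      using lim by eventually_elim (auto split: split_indicator)
    ultimately show ?thesis
      using i(2)[of 0] p[of 0] A
      by (subst integrable_cong_AE[where g="\<lambda>x. f 0 x * indicator A x + (\<Sum>n. ?h n x)"],
          simp, simp, simp, subst integral_cong_AE[where g="\<lambda>x. f 0 x * indicator A x + (\<Sum>n. ?h n x)"]) auto
  qed
  \<comment> \<open>The total mass is the case of the event \<open>space R\<close>.\<close>
  have Ftot: "integrable R F \<and> integral\<^sup>L R F = 1"
    using Flin[of "space R" 1] fD
    by (auto simp: D_def cong: Bochner_Integration.integral_cong Bochner_Integration.integrable_cong)
  \<comment> \<open>Adding 1 makes the integrand nonnegative, by x ln x >= x - 1 and x >= 0, so that
    Fatou's lemma applies.\<close>
  have Fatou: "(\<integral>\<^sup>+x. ennreal (F x * ln (F x) + 1) \<partial>R) \<le> ennreal (m + 1)"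
  proof -
    have "(\<integral>\<^sup>+x. ennreal (F x * ln (F x) + 1) \<partial>R) =
        (\<integral>\<^sup>+x. liminf (\<lambda>n. ennreal (f n x * ln (f n x) + 1)) \<partial>R)"
    proof (rule nn_integral_cong_AE)
      show "AE x in R. ennreal (F x * ln (F x) + 1) = liminf (\<lambda>n. ennreal (f n x * ln (f n x) + 1))"
        using lim
      proof eventually_elim
        case (elim x)
        then have "(\<lambda>n. ennreal (f n x * ln (f n x) + 1)) \<longlonglongrightarrow> ennreal (F x * ln (F x) + 1)"
          using f0 by (intro tendsto_ennrealI tendsto_intros tendsto_xlnx) auto
        then show ?case by (simp add: lim_imp_Liminf)
      qed
    qed
    also have "\<dots> \<le> liminf (\<lambda>n. \<integral>\<^sup>+x. ennreal (f n x * ln (f n x) + 1) \<partial>R)"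
      by (intro nn_integral_liminf) auto
    also have "\<dots> = liminf (\<lambda>n. ennreal (J (f n) + 1))"
    proof -
      have "(\<integral>\<^sup>+x. ennreal (f n x * ln (f n x) + 1) \<partial>R) = ennreal (\<integral>x. f n x * ln (f n x) + 1 \<partial>R)" for n
      proof (intro nn_integral_eq_integral AE_I2)
        show "integrable R (\<lambda>x. f n x * ln (f n x) + 1)" using fD[of n] by (simp add: D_def)
        show "0 \<le> f n x * ln (f n x) + 1" for x
          using xlnx_ge[OF f0[of n x]] f0[of n x] by linarith
      qed
      moreover have "(\<integral>x. f n x * ln (f n x) + 1 \<partial>R) = J (f n) + 1" for n
        using fD[of n] by (simp add: D_def J_def prob_space)
      ultimately show ?thesis by simp
    qed
    also have "\<dots> \<le> liminf (\<lambda>n. ennreal (m + (1/4)^n / 2 + 1))"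
      using fJ by (intro Liminf_mono always_eventually allI ennreal_leI) (auto intro: less_imp_le)
    also have "\<dots> = ennreal (m + 0 / 2 + 1)"
      by (intro lim_imp_Liminf tendsto_ennrealI tendsto_intros LIMSEQ_power_zero) auto
    finally show ?thesis by simp
  qed
  have F0: "0 \<le> F x" "0 \<le> F x * ln (F x) + 1" for x
    using xlnx_ge[of "F x"] by (auto simp: F_def)
  have FL: "integrable R (\<lambda>x. F x * ln (F x) + 1)"
    using Fatou F0 by (intro integrableI_nonneg) (auto simp: le_less_trans)
  then have "integrable R (\<lambda>x. (F x * ln (F x) + 1) - 1)"
    by (intro Bochner_Integration.integrable_diff) auto
  then have FL': "integrable R (\<lambda>x. F x * ln (F x))" by simp
  have FD: "F \<in> D"
  proof -
    have "(\<integral>x. F x * indicator A x \<partial>R) = p" if "(A, p) \<in> C" for A p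
    proof -
      have "(\<integral>x. f n x * indicator A x \<partial>R) = p" for n
        using fD[of n] that by (auto simp: D_def)
      then show ?thesis using Flin[OF C[OF that]] by blast
    qed
    then show ?thesis
      using FL' Ftot F0 by (auto simp: D_def)
  qed
  have "0 \<le> m" unfolding m_def using Dne Jnn by (intro cInf_greatest) auto
  have "ennreal (J F + 1) \<le> ennreal (m + 1)"
    using Fatou FL' F0 by (subst (asm) nn_integral_eq_integral[OF FL]) (auto simp: J_def prob_space)
  then have JF: "J F = m"
    using mle[OF FD] \<open>0 \<le> m\<close> by (subst (asm) ennreal_le_iff) auto
  have INF: "(INF Q\<in>K. relative_entropy Q R) = ereal m"
  proof (rule antisym)
    show "(INF Q\<in>K. relative_entropy Q R) \<le> ereal m"
      using DK[OF FD] JF by (metis INF_lower)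
    show "ereal m \<le> (INF Q\<in>K. relative_entropy Q R)"
    proof (rule INF_greatest)
      fix Q assume "Q \<in> K"
      show "ereal m \<le> relative_entropy Q R"
      proof (cases "relative_entropy Q R < \<infinity>")
        case True
        with KD[OF \<open>Q \<in> K\<close>] obtain g where "g \<in> D" "Q = density R g" by blast
        then show ?thesis using DK mle by simp
      qed simp
    qed
  qed
  show ?thesis
  proof (rule ex1I[of _ "density R F"])
    show "density R F \<in> K \<and> relative_entropy (density R F) R < \<infinity> \<and>
        relative_entropy (density R F) R = (INF Q\<in>K. relative_entropy Q R)"
      using DK[OF FD] JF INF by simp
  next
    fix P assume P: "P \<in> K \<and> relative_entropy P R < \<infinity> \<and>
        relative_entropy P R = (INF Q\<in>K. relative_entropy Q R)"
    with KD obtain g where g: "g \<in> D" "P = density R g" by blast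
    have Jg: "J g = m" using P g DK INF by simp
    define I where "I = (\<integral>x. \<bar>g x - F x\<bar> \<partial>R)"
    \<comment> \<open>Both excesses vanish, so \<open>gap\<close> leaves d I <= 2 d^2. At d = I / 4
      this reads I^2 / 4 <= I^2 / 8.\<close>
    have "d * I \<le> 2 * d\<^sup>2" if "0 < d" for d
      using gap[OF g(1) FD that] Jg JF by (simp add: I_def)
    note small = this
    have "I \<le> 0"
    proof (rule ccontr)
      assume "\<not> I \<le> 0"
      then have "0 < I * I" by simp
      with small[of "I / 4"] \<open>\<not> I \<le> 0\<close> show False by (simp add: power2_eq_square)
    qed
    moreover have "0 \<le> I" by (simp add: I_def)
    ultimately have "I = 0" by simp
    moreover have "integrable R (\<lambda>x. \<bar>g x - F x\<bar>)"
      using g(1) FD by (auto simp: D_def)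
    ultimately have "AE x in R. \<bar>g x - F x\<bar> = 0"
      unfolding I_def by (subst (asm) integral_nonneg_eq_0_iff_AE) auto
    then show "P = density R F"
      using g by (auto intro!: density_cong simp: D_def)
  qed
qed

subsection \<open>Paths of the Ornstein-Uhlenbeck equation\<close>

text \<open>One-sided limits bound the path near every point, and bisection makes the local bounds
  global.\<close>

lemma cadlag_paths_bounded:
  assumes x: "x \<in> cadlag_paths"
  shows "\<exists>B. \<forall>t\<in>{0..1}. \<bar>x t\<bar> \<le> B"
proof -
  \<comment> \<open>The intersection with \<open>{0..1}\<close> is there because
    \<open>Bolzano\<close> also tests small intervals that stick out of [0,1].\<close>
  let ?P = "\<lambda>a b. \<exists>B. \<forall>t\<in>{a..b} \<inter> {0..1}. \<bar>x t\<bar> \<le> B"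
  have bdd: "\<exists>B. eventually (\<lambda>u. \<bar>x u\<bar> \<le> B) F" if "(x \<longlongrightarrow> l) F" for F and l :: real
  proof -
    have "eventually (\<lambda>u. dist (x u) l < 1) F" using that by (rule tendstoD) simp
    then have "eventually (\<lambda>u. \<bar>x u\<bar> \<le> \<bar>l\<bar> + 1) F"
      by eventually_elim (auto simp: dist_real_def)
    then show ?thesis by blast
  qed
  have "?P 0 1"
  proof (rule Bolzano[of 0 1 ?P])
    fix a b c :: real
    assume "?P a b" "?P b c" "a \<le> b" "b \<le> c"
    then obtain B C where B: "\<forall>t\<in>{a..b} \<inter> {0..1}. \<bar>x t\<bar> \<le> B" and C: "\<forall>t\<in>{b..c} \<inter> {0..1}. \<bar>x t\<bar> \<le> C"
      by blast
    have "\<bar>x t\<bar> \<le> max B C" if "t \<in> {a..c} \<inter> {0..1}" for t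
    proof (cases "t \<le> b")
      case True
      then have "\<bar>x t\<bar> \<le> B" using B that by auto
      then show ?thesis by simp
    next
      case False
      then have "\<bar>x t\<bar> \<le> C" using C that by auto
      then show ?thesis by simp
    qed
    then show "?P a c" by blast
  next
    fix t :: real
    assume local: "0 \<le> t" "t \<le> 1"
    have R: "\<exists>b>t. \<exists>B. \<forall>u\<in>{t<..<b} \<inter> {0..1}. \<bar>x u\<bar> \<le> B"
    proof (cases "t < 1")
      case True
      then have "(x \<longlongrightarrow> x t) (at_right t)" using x local by (auto simp: cadlag_paths_def)
      from bdd[OF this] obtain B where "eventually (\<lambda>u. \<bar>x u\<bar> \<le> B) (at_right t)" by blast
      then obtain b where "t < b" "\<forall>u\<in>{t<..<b}. \<bar>x u\<bar> \<le> B" by (auto simp: eventually_at_right_field)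
      then show ?thesis by blast
    next
      case False
      then show ?thesis by (intro exI[of _ "t + 1"]) auto
    qed
    have L: "\<exists>a<t. \<exists>B. \<forall>u\<in>{a<..<t} \<inter> {0..1}. \<bar>x u\<bar> \<le> B"
    proof (cases "0 < t")
      case True
      then have "\<exists>l. (x \<longlongrightarrow> l) (at_left t)" using x local by (auto simp: cadlag_paths_def)
      then obtain l where "(x \<longlongrightarrow> l) (at_left t)" by blast
      from bdd[OF this] obtain B where "eventually (\<lambda>u. \<bar>x u\<bar> \<le> B) (at_left t)" by blast
      then obtain a where "a < t" "\<forall>u\<in>{a<..<t}. \<bar>x u\<bar> \<le> B" by (auto simp: eventually_at_left_field)
      then show ?thesis by blast
    next
      case False
      then show ?thesis by (intro exI[of _ "t - 1"]) auto
    qed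
    from R L obtain a b B C where ab: "a < t" "t < b"
      and B: "\<forall>u\<in>{t<..<b} \<inter> {0..1}. \<bar>x u\<bar> \<le> B" and C: "\<forall>u\<in>{a<..<t} \<inter> {0..1}. \<bar>x u\<bar> \<le> C"
      by blast
    have "?P a' b'" if *: "a' \<le> t \<and> t \<le> b' \<and> b' - a' < min (b - t) (t - a)" for a' b'
    proof (intro exI[of _ "max \<bar>x t\<bar> (max B C)"] ballI)
      fix u assume u: "u \<in> {a'..b'} \<inter> {0..1}"
      consider "u = t" | "u < t" | "t < u" by linarith
      then show "\<bar>x u\<bar> \<le> max \<bar>x t\<bar> (max B C)"
      proof cases
        case 2 with * u have "u \<in> {a<..<t} \<inter> {0..1}" by auto
        with C show ?thesis by (auto simp: le_max_iff_disj)
      next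
        case 3 with * u have "u \<in> {t<..<b} \<inter> {0..1}" by auto
        with B show ?thesis by (auto simp: le_max_iff_disj)
      qed simp
    qed
    moreover have "0 < min (b - t) (t - a)" using ab by simp
    ultimately show "\<exists>d>0. \<forall>a b. a \<le> t \<and> t \<le> b \<and> b - a < d \<longrightarrow> ?P a b" by blast
  qed simp
  then show ?thesis by simp
qed

text \<open>Measurability is the point: right continuity makes the path a pointwise limit of step
  functions. Boundedness then gives integrability.\<close>

lemma cadlag_paths_set_integrable:
  assumes x: "x \<in> cadlag_paths"
  shows "set_integrable lborel {0..1} x"
proof -
  \<comment> \<open>\<open>g n t\<close> is the first point strictly to the right of
    \<open>t\<close> on the grid of mesh 1 / (n + 1), capped at 1. Strictness, hence floor plus one
    and not a ceiling, is what \<open>at_right\<close> needs.\<close>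
  define g where "g n t = min 1 ((of_int \<lfloor>real (Suc n) * t\<rfloor> + 1) / real (Suc n))" for n and t :: real
  have meas: "(\<lambda>t. indicator {0..1} t * x (g n t)) \<in> borel_measurable borel" for n
  proof -
    have "(\<lambda>t. x (min 1 ((of_int \<lfloor>real (Suc n) * t\<rfloor> + 1) / real (Suc n)))) \<in> borel_measurable borel"
      by (rule measurable_compose[where N="count_space UNIV" and f="\<lambda>t. \<lfloor>real (Suc n) * t\<rfloor>"
            and g="\<lambda>k. x (min 1 ((of_int k + 1) / real (Suc n)))"]) measurable
    then show ?thesis unfolding g_def by measurable
  qed
  have g: "t < (of_int \<lfloor>real (Suc n) * t\<rfloor> + 1) / real (Suc n)"
      "(of_int \<lfloor>real (Suc n) * t\<rfloor> + 1) / real (Suc n) \<le> t + 1 / real (Suc n)" for n t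
  proof -
    have "real (Suc n) * t < of_int \<lfloor>real (Suc n) * t\<rfloor> + 1" by linarith
    then show "t < (of_int \<lfloor>real (Suc n) * t\<rfloor> + 1) / real (Suc n)" by (simp add: field_simps)
    have "of_int \<lfloor>real (Suc n) * t\<rfloor> \<le> real (Suc n) * t" by linarith
    then have "of_int \<lfloor>real (Suc n) * t\<rfloor> / real (Suc n) \<le> t" by (simp add: divide_le_eq mult.commute)
    then show "(of_int \<lfloor>real (Suc n) * t\<rfloor> + 1) / real (Suc n) \<le> t + 1 / real (Suc n)"
      by (simp only: add_divide_distrib)
  qed
  have lim: "(\<lambda>n. indicator {0..1} t * x (g n t)) \<longlonglongrightarrow> indicator {0..1} t * x t" for t
  proof (cases "t \<in> {0..<1}")
    case True
    have "(\<lambda>n. g n t) \<longlonglongrightarrow> t"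
    proof (rule tendsto_sandwich)
      show "eventually (\<lambda>n. t \<le> g n t) sequentially"
        using g(1) True by (simp add: g_def less_imp_le)
      show "eventually (\<lambda>n. g n t \<le> t + 1 / real (Suc n)) sequentially"
        using g(2) by (simp add: g_def min.coboundedI2)
      show "(\<lambda>n. t + 1 / real (Suc n)) \<longlonglongrightarrow> t"
        using tendsto_add[OF tendsto_const LIMSEQ_inverse_real_of_nat, of t] by (simp add: inverse_eq_divide)
    qed auto
    moreover have "g n t > t" "g n t \<noteq> t" for n using g(1)[of t n] True by (auto simp: g_def min_def)
    ultimately have "filterlim (\<lambda>n. g n t) (at_right t) sequentially"
      by (simp add: filterlim_at)
    moreover have "(x \<longlongrightarrow> x t) (at_right t)" using x True by (auto simp: cadlag_paths_def)
    ultimately have "(\<lambda>n. x (g n t)) \<longlonglongrightarrow> x t" by (rule filterlim_compose[rotated])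
    then show ?thesis by (intro tendsto_intros)
  next
    case False
    show ?thesis
    proof (cases "t = 1")
      case True
      then have "g n t = 1" for n using g(1)[of 1 n] by (simp add: g_def)
      with True show ?thesis by simp
    qed (use False in \<open>auto simp: indicator_def\<close>)
  qed
  have [measurable]: "(\<lambda>t. indicator {0..1} t * x t) \<in> borel_measurable borel"
    by (rule borel_measurable_LIMSEQ_real[OF lim meas])
  obtain B where B: "\<And>t. t \<in> {0..1} \<Longrightarrow> \<bar>x t\<bar> \<le> B"
    using cadlag_paths_bounded[OF x] by blast
  have "integrable lborel (\<lambda>t. indicator {0..1::real} t * x t)"
  proof (rule integrableI_bounded_set[where A="{0..1}" and B=B])
    show "AE t in lborel. t \<in> {0..1} \<longrightarrow> norm (indicator {0..1} t * x t) \<le> B"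
      using B by (auto simp: abs_mult)
  qed auto
  then show ?thesis by (simp add: set_integrable_def)
qed

text \<open>Multiplication by the integrating factor exp and integration by parts give the pathwise
  form of sqrt 2 times the integral of exp u dW_u, which makes sense for every continuous
  \<open>w\<close>.\<close>

lemma OU_path_identity:
  fixes x w :: "real \<Rightarrow> real"
  assumes int: "set_integrable lborel {0..1} x" and w: "continuous_on {0..1} w"
    and eq: "\<And>t. t \<in> {0..1} \<Longrightarrow> x t = x 0 + sqrt 2 * w t - set_lebesgue_integral lborel {0..t} x"
    and st: "0 \<le> s" "s \<le> t" "t \<le> 1"
  shows "exp t * x t - exp s * x s =
    sqrt 2 * (exp t * w t - exp s * w s - integral {s..t} (\<lambda>u. exp u * w u))"
proof -
  have int01: "x integrable_on {0..1}"
    using int by (rule set_borel_integral_eq_integral)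
  define A where "A t = integral {0..t} x" for t
  have eqA: "x t = x 0 + sqrt 2 * w t - A t" if "t \<in> {0..1}" for t
  proof -
    have "set_integrable lborel {0..t} x" using int that by (rule_tac set_integrable_subset) auto
    then show ?thesis using eq[OF that] by (simp add: A_def set_borel_integral_eq_integral)
  qed
  have contA: "continuous_on {0..1} A"
    unfolding A_def by (rule indefinite_integral_continuous_1[OF int01])
  \<comment> \<open>The path is assumed to be integrable only; the equation itself shows that it is
    continuous, so that its primitive \<open>A\<close> is differentiable.\<close>
  have "continuous_on {0..1} (\<lambda>t. x 0 + sqrt 2 * w t - A t)"
    by (intro continuous_intros w contA)
  then have contx: "continuous_on {0..1} x"
    by (rule continuous_on_eq) (erule eqA[symmetric])
  \<comment> \<open>The derivative of exp u A u is exp u (A u + x u), and the equation replaces A u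
    + x u by x 0 + sqrt 2 w u, which no longer contains the path.\<close>
  have "((\<lambda>u. exp u * (x 0 + sqrt 2 * w u)) has_integral exp t * A t - exp s * A s) {s..t}"
  proof (rule fundamental_theorem_of_calculus)
    fix u assume u: "u \<in> {s..t}"
    then have "(A has_vector_derivative x u) (at u within {0..1})"
      unfolding A_def using st contx by (intro integral_has_vector_derivative) auto
    then have "(A has_vector_derivative x u) (at u within {s..t})"
      by (rule has_vector_derivative_within_subset) (use st in auto)
    then have "((\<lambda>u. exp u * A u) has_vector_derivative exp u * A u + exp u * x u) (at u within {s..t})"
      unfolding has_real_derivative_iff_has_vector_derivative[symmetric]
      by (auto intro!: derivative_eq_intros)
    moreover have "x u = x 0 + sqrt 2 * w u - A u" using u st by (intro eqA) auto
    ultimately show "((\<lambda>u. exp u * A u) has_vector_derivative exp u * (x 0 + sqrt 2 * w u)) (at u within {s..t})"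
      by (simp add: algebra_simps)
  qed (use st in auto)
  moreover have "((\<lambda>u. exp u * x 0) has_integral exp t * x 0 - exp s * x 0) {s..t}"
    using st by (intro fundamental_theorem_of_calculus)
      (auto intro!: derivative_eq_intros simp: has_real_derivative_iff_has_vector_derivative[symmetric])
  ultimately have "((\<lambda>u. exp u * (x 0 + sqrt 2 * w u) - exp u * x 0) has_integral
     (exp t * A t - exp s * A s) - (exp t * x 0 - exp s * x 0)) {s..t}"
    by (rule has_integral_diff)
  then have "integral {s..t} (\<lambda>u. sqrt 2 * (exp u * w u)) =
     (exp t * A t - exp s * A s) - (exp t * x 0 - exp s * x 0)"
    by (intro integral_unique) (simp add: algebra_simps)
  then have "sqrt 2 * integral {s..t} (\<lambda>u. exp u * w u) =
     (exp t * A t - exp s * A s) - (exp t * x 0 - exp s * x 0)" by simp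
  moreover have xt: "x t = x 0 + sqrt 2 * w t - A t" and xs: "x s = x 0 + sqrt 2 * w s - A s"
    using st by (auto intro!: eqA)
  ultimately show ?thesis unfolding xt xs by (simp add: algebra_simps)
qed

text \<open>As \<open>w\<close> is merely continuous, the increments are moved onto the C^1 function
  \<open>f\<close> by summation by parts, and uniform continuity of \<open>w\<close> does the rest.
  With w a Brownian path this replaces the stochastic integral; with w the identity it gives the
  limit of the variances.\<close>

lemma equidistant_Riemann_Stieltjes:
  fixes f f' w :: "real \<Rightarrow> real"
  assumes st: "s < t" and w: "continuous_on {s..t} w"
    and f: "\<And>u. (f has_real_derivative f' u) (at u)" and f': "continuous_on UNIV f'"
  defines "u \<equiv> \<lambda>n j. s + (t - s) * real j / real (Suc n)"
  shows "(\<lambda>n. \<Sum>j<Suc n. f (u n j) * (w (u n (Suc j)) - w (u n j)))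
    \<longlonglongrightarrow> f t * w t - f s * w s - integral {s..t} (\<lambda>u. f' u * w u)"
proof -
  have u0: "u n 0 = s" and u1: "u n (Suc n) = t" for n by (auto simp: u_def field_simps)
  have step: "u n (Suc j) = u n j + (t - s) / real (Suc n)" for n j
    unfolding u_def of_nat_Suc[of j] by (simp add: distrib_left add_divide_distrib del: of_nat_Suc)
  have mono: "u n j \<le> u n (Suc j)" for n j using st by (simp add: step)
  have ule: "u n j \<le> t" if "j \<le> Suc n" for n j
  proof -
    have "(t - s) * (real j / real (Suc n)) \<le> (t - s) * 1"
      using st that by (intro mult_left_mono) (auto simp: divide_le_eq_1)
    then show ?thesis by (simp add: u_def)
  qed
  have uge: "s \<le> u n j" for n j using st by (simp add: u_def)
  \<comment> \<open>Summation by parts, which trades left endpoints for \<open>f\<close> against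
    right endpoints for \<open>w\<close>.\<close>
  have abel: "(\<Sum>j<k. f (u n j) * (w (u n (Suc j)) - w (u n j))) =
      f (u n k) * w (u n k) - f s * w s - (\<Sum>j<k. (f (u n (Suc j)) - f (u n j)) * w (u n (Suc j)))" for n k
    by (induction k) (auto simp: u0 algebra_simps)
  have fi: "(f' has_integral f b - f a) {a..b}" if "a \<le> b" for a b
    using that f by (intro fundamental_theorem_of_calculus)
      (auto simp: has_real_derivative_iff_has_vector_derivative[symmetric] intro: DERIV_subset)
  have intg: "(\<lambda>v. f' v * w v) integrable_on {a..b}" if "s \<le> a" "b \<le> t" for a b
    using that by (intro integrable_continuous_real continuous_intros continuous_on_subset[OF w]
      continuous_on_subset[OF f']) auto
  have split: "integral {s..u n k} (\<lambda>v. f' v * w v) = (\<Sum>j<k. integral {u n j..u n (Suc j)} (\<lambda>v. f' v * w v))"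
    if "k \<le> Suc n" for n k
    using that
  proof (induction k)
    case (Suc k)
    have "integral {s..u n (Suc k)} (\<lambda>v. f' v * w v) =
      integral {s..u n k} (\<lambda>v. f' v * w v) + integral {u n k..u n (Suc k)} (\<lambda>v. f' v * w v)"
      using Suc.prems uge mono ule by (intro Henstock_Kurzweil_Integration.integral_combine[symmetric] intg) auto
    with Suc show ?case by simp
  qed (simp add: u0)
  obtain C where C: "\<And>v. v \<in> {s..t} \<Longrightarrow> \<bar>f' v\<bar> \<le> C" "0 \<le> C"
  proof -
    have "bounded (f' ` {s..t})"
      by (intro compact_imp_bounded compact_continuous_image continuous_on_subset[OF f']) auto
    then obtain C where "\<forall>v\<in>{s..t}. \<bar>f' v\<bar> \<le> C" by (auto simp: bounded_iff)
    then show ?thesis by (intro that[of "max C 0"]) (auto intro: max.coboundedI1)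
  qed
  have uc: "uniformly_continuous_on {s..t} w"
    by (rule compact_uniformly_continuous[OF w]) auto
  have "(\<lambda>n. (\<Sum>j<Suc n. (f (u n (Suc j)) - f (u n j)) * w (u n (Suc j)))) \<longlonglongrightarrow> integral {s..t} (\<lambda>u. f' u * w u)"
  proof (rule LIMSEQ_I)
    fix e :: real assume e: "0 < e"
    \<comment> \<open>The total error is at most e' C (t - s); with C + 1 the denominator stays
      positive for C = 0 and exceeds C (t - s) strictly.\<close>
    define e' where "e' = e / (2 * ((C + 1) * (t - s)))"
    have e': "0 < e'" using e st C by (simp add: e'_def)
    obtain d where d: "0 < d" "\<And>v v'. v \<in> {s..t} \<Longrightarrow> v' \<in> {s..t} \<Longrightarrow> dist v' v < d \<Longrightarrow> dist (w v') (w v) < e'"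
      using uc e' unfolding uniformly_continuous_on_def by metis
    obtain N where N: "(t - s) / d < real N" using reals_Archimedean2 by blast
    show "\<exists>no. \<forall>n\<ge>no. norm ((\<Sum>j<Suc n. (f (u n (Suc j)) - f (u n j)) * w (u n (Suc j))) -
        integral {s..t} (\<lambda>u. f' u * w u)) < e"
    proof (intro exI[of _ N] allI impI)
      fix n assume n: "N \<le> n"
      have hd: "(t - s) / real (Suc n) < d"
      proof -
        have "(t - s) / d < real (Suc n)" using N n by linarith
        then show ?thesis using d(1) by (simp add: field_simps)
      qed
      have piece: "\<bar>(f (u n (Suc j)) - f (u n j)) * w (u n (Suc j)) - integral {u n j..u n (Suc j)} (\<lambda>v. f' v * w v)\<bar>
         \<le> C * e' * ((t - s) / real (Suc n))" if j: "j < Suc n" for j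
      proof -
        let ?I = "{u n j..u n (Suc j)}"
        have sub: "?I \<subseteq> {s..t}" using uge ule[of "Suc j" n] j by (auto intro: order_trans)
        have 1: "((\<lambda>v. f' v * w (u n (Suc j))) has_integral (f (u n (Suc j)) - f (u n j)) * w (u n (Suc j))) ?I"
          by (rule has_integral_mult_left[OF fi[OF mono]])
        have 2: "((\<lambda>v. f' v * w v) has_integral integral ?I (\<lambda>v. f' v * w v)) ?I"
          using sub mono[of n j] by (intro integrable_integral intg) auto
        have "norm ((f (u n (Suc j)) - f (u n j)) * w (u n (Suc j)) - integral ?I (\<lambda>v. f' v * w v))
          \<le> C * e' * measure lborel ?I"
        proof (rule has_integral_bound_real[where S="{}", OF _ _ has_integral_diff[OF 1 2]])
          show "norm (f' v * w (u n (Suc j)) - f' v * w v) \<le> C * e'" if "v \<in> ?I - {}" for v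
          proof -
            have "dist (u n (Suc j)) v < d" using that hd step[of n j] by (auto simp: dist_real_def)
            then have "dist (w (u n (Suc j))) (w v) < e'"
              using that sub mono[of n j] by (intro d(2)) auto
            then have "\<bar>f' v\<bar> * \<bar>w (u n (Suc j)) - w v\<bar> \<le> C * e'"
              using that sub C by (intro mult_mono) (auto simp: dist_real_def)
            then show ?thesis by (simp add: right_diff_distrib[symmetric] abs_mult)
          qed
        qed (use C e' in auto)
        then show ?thesis using mono[of n j] by (simp add: step)
      qed
      have "\<bar>(\<Sum>j<Suc n. (f (u n (Suc j)) - f (u n j)) * w (u n (Suc j)) - integral {u n j..u n (Suc j)} (\<lambda>v. f' v * w v))\<bar>
         \<le> (\<Sum>j<Suc n. C * e' * ((t - s) / real (Suc n)))"
        using piece by (intro order_trans[OF sum_abs] sum_mono) auto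
      also have "\<dots> = e' * (C * (t - s))" by simp
      also have "\<dots> < e' * (2 * ((C + 1) * (t - s)))"
      proof -
        have "C * (t - s) < 2 * ((C + 1) * (t - s))"
          using mult_nonneg_nonneg[of C "t - s"] C st by (simp add: algebra_simps)
        then show ?thesis using e' by simp
      qed
      also have "\<dots> = e" using C st by (simp add: e'_def)
      finally show "norm ((\<Sum>j<Suc n. (f (u n (Suc j)) - f (u n j)) * w (u n (Suc j))) -
        integral {s..t} (\<lambda>u. f' u * w u)) < e"
        using split[of "Suc n" n] unfolding sum_subtractf u1 real_norm_def by simp
    qed
  qed
  then have "(\<lambda>n. f t * w t - f s * w s - (\<Sum>j<Suc n. (f (u n (Suc j)) - f (u n j)) * w (u n (Suc j))))
      \<longlonglongrightarrow> f t * w t - f s * w s - integral {s..t} (\<lambda>u. f' u * w u)"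
    by (intro tendsto_diff tendsto_const)
  then show ?thesis unfolding abel u1 .
qed

subsection \<open>Gaussian limits of Brownian Riemann sums\<close>

lemma sets_std_gaussian [measurable_cong]: "sets std_gaussian = sets borel"
  by (simp add: std_gaussian_def)

lemma real_distribution_std_gaussian: "real_distribution std_gaussian"
  using prob_space_std_gaussian by (auto simp: real_distribution_def real_distribution_axioms_def std_gaussian_def)

lemma AE_std_gaussian_neq: "AE x in std_gaussian. x \<noteq> a"
  unfolding std_gaussian_def using AE_lborel_singleton[of a] by (subst AE_density) auto

lemma (in prob_space) distr_std_gaussian_iff:
  "distr M borel X = std_gaussian \<and> X \<in> borel_measurable M \<longleftrightarrow>
   distributed M lborel X std_normal_density"
proof -
  have "distr M borel X = distr M lborel X" by (intro distr_cong) auto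
  then show ?thesis by (auto simp: distributed_def std_gaussian_def)
qed

text \<open>All approximants have the same characteristic function, and dominated convergence passes
  it on to the limit.\<close>

lemma (in prob_space) std_gaussian_limit:
  assumes [measurable]: "\<And>n. Y n \<in> borel_measurable M" "Z \<in> borel_measurable M"
    and Y: "\<And>n::nat. distr M borel (Y n) = std_gaussian"
    and lim: "AE x in M. (\<lambda>n. Y n x) \<longlonglongrightarrow> Z x"
  shows "distr M borel Z = std_gaussian"
proof (rule Levy_uniqueness)
  show "real_distribution (distr M borel Z)"
    by (auto intro!: real_distribution_distr)
  show "real_distribution std_gaussian" by (rule real_distribution_std_gaussian)
  show "char (distr M borel Z) = char std_gaussian"
  proof
    fix t
    have "(\<lambda>n. (CLINT x|M. iexp (t * Y n x))) \<longlonglongrightarrow> (CLINT x|M. iexp (t * Z x))"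
    proof (rule integral_dominated_convergence[where w="\<lambda>_. 1"])
      show "AE x in M. (\<lambda>n. iexp (t * Y n x)) \<longlonglongrightarrow> iexp (t * Z x)"
        using lim by eventually_elim (intro tendsto_intros)
    qed auto
    moreover have "(CLINT x|M. iexp (t * Y n x)) = char std_gaussian t" for n
      unfolding Y[symmetric, of n] char_def by (subst integral_distr) auto
    ultimately show "char (distr M borel Z) t = char std_gaussian t"
      unfolding char_def by (subst integral_distr) (auto dest: LIMSEQ_unique[OF tendsto_const])
  qed
qed

text \<open>Independence is tested on half-lines. Their indicators converge almost surely along
  \<open>Y\<close> because the limit, being Gaussian, has no atom at the end point.\<close>

lemma (in prob_space) indep_vars_std_gaussian_limit:
  assumes I: "finite I" "I \<noteq> {}"
    and indep: "\<And>n::nat. indep_vars (\<lambda>_. borel) (Y n) I"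
    and Y: "\<And>n i. i \<in> I \<Longrightarrow> distr M borel (Y n i) = std_gaussian"
    and Z: "\<And>i. i \<in> I \<Longrightarrow> Z i \<in> borel_measurable M"
    and lim: "\<And>i. i \<in> I \<Longrightarrow> AE x in M. (\<lambda>n. Y n i x) \<longlonglongrightarrow> Z i x"
  shows "indep_vars (\<lambda>_. borel :: real measure) Z I"
    and "\<And>i. i \<in> I \<Longrightarrow> distr M borel (Z i) = std_gaussian"
proof -
  have Ym: "Y n i \<in> borel_measurable M" if "i \<in> I" for n i
    using indep[of n] that by (auto simp: indep_vars_def)
  show Zd: "distr M borel (Z i) = std_gaussian" if "i \<in> I" for i
    using std_gaussian_limit[of "\<lambda>n. Y n i" "Z i"] that Ym Z Y lim by blast
  \<comment> \<open>Closed half-lines generate the Borel sets; the whole line is added because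
    \<open>indep_vars_finite\<close> asks for a generator that contains the space.\<close>
  define E where "E = insert UNIV (range (\<lambda>a::real. {..a}))"
  have sE: "sets (borel :: real measure) = sigma_sets UNIV E"
  proof (rule antisym)
    have "sets (borel :: real measure) = sigma_sets UNIV (range (\<lambda>a. {..a}))"
      by (subst borel_eq_atMost) (simp add: sets_measure_of)
    also have "\<dots> \<subseteq> sigma_sets UNIV E"
      by (rule sigma_sets_mono') (auto simp: E_def)
    finally show "sets (borel :: real measure) \<subseteq> sigma_sets UNIV E" .
    have "E \<subseteq> sets (borel :: real measure)" by (auto simp: E_def)
    from sets.sigma_sets_subset[OF this] show "sigma_sets UNIV E \<subseteq> sets (borel :: real measure)" by simp
  qed
  have Int: "Int_stable E"
    by (auto simp: Int_stable_def E_def Int_atMost)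
  have conv: "(\<lambda>n. prob (\<Inter>j\<in>J. Y n j -` A j \<inter> space M)) \<longlonglongrightarrow> prob (\<Inter>j\<in>J. Z j -` A j \<inter> space M)"
    if J: "J \<subseteq> I" "J \<noteq> {}" and A: "\<And>j. j \<in> J \<Longrightarrow> A j \<in> E" for J A
  proof -
    have fJ: "finite J" using J I finite_subset by auto
    have Ab: "A j \<in> sets borel" if "j \<in> J" for j using A[OF that] by (auto simp: E_def)
    have eq: "prob (\<Inter>j\<in>J. X j -` A j \<inter> space M) = (\<integral>x. (\<Prod>j\<in>J. indicator (A j) (X j x)) \<partial>M)"
      if X: "\<And>j. j \<in> J \<Longrightarrow> X j \<in> borel_measurable M" for X
    proof -
      have "(\<Prod>j\<in>J. indicator (A j) (X j x)) = (indicator (\<Inter>j\<in>J. X j -` A j \<inter> space M) x :: real)"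
        if x: "x \<in> space M" for x
      proof (cases "\<forall>j\<in>J. X j x \<in> A j")
        case True
        then have "(\<Prod>j\<in>J. indicator (A j) (X j x) :: real) = 1" by (intro prod.neutral) simp
        with True x J show ?thesis by simp
      next
        case False
        then obtain j where j: "j \<in> J" "X j x \<notin> A j" by blast
        then have "(\<Prod>j\<in>J. indicator (A j) (X j x) :: real) = 0" by (intro prod_zero[OF fJ] bexI[of _ j]) auto
        moreover have "x \<notin> (\<Inter>j\<in>J. X j -` A j \<inter> space M)" using j by blast
        ultimately show ?thesis by simp
      qed
      then have "(\<integral>x. (\<Prod>j\<in>J. indicator (A j) (X j x) :: real) \<partial>M) =
          (\<integral>x. indicator (\<Inter>j\<in>J. X j -` A j \<inter> space M) x \<partial>M)"
        by (intro Bochner_Integration.integral_cong refl)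
      also have "\<dots> = prob (\<Inter>j\<in>J. X j -` A j \<inter> space M)"
        using J fJ X Ab by (subst Bochner_Integration.integral_indicator) (auto intro!: sets.finite_INT measurable_sets simp: Int_absorb1)
      finally show ?thesis by simp
    qed
    have ae: "AE x in M. (\<lambda>n. indicator (A j) (Y n j x) :: real) \<longlonglongrightarrow> indicator (A j) (Z j x)" if j: "j \<in> J" for j
    proof -
      consider "A j = UNIV" | a where "A j = {..a}" using A[OF j] by (auto simp: E_def)
      then show ?thesis
      proof cases
        case (2 a)
        have [measurable]: "Z j \<in> borel_measurable M" using Z j J by auto
        have "j \<in> I" using j J by auto
        have "AE x in distr M borel (Z j). x \<noteq> a"
          unfolding Zd[OF \<open>j \<in> I\<close>] by (rule AE_std_gaussian_neq)
        then have "AE x in M. Z j x \<noteq> a" by (subst (asm) AE_distr_iff) auto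
        moreover have "AE x in M. (\<lambda>n. Y n j x) \<longlonglongrightarrow> Z j x" using lim j J by auto
        ultimately show ?thesis
        proof eventually_elim
          case (elim x)
          consider "Z j x < a" | "a < Z j x" using elim by linarith
          then show ?case
          proof cases
            case 1
            from order_tendstoD(2)[OF elim(2) 1] have "eventually (\<lambda>n. indicator (A j) (Y n j x) = (indicator (A j) (Z j x) :: real)) sequentially"
              by eventually_elim (use 1 2 in auto)
            then show ?thesis by (rule tendsto_eventually)
          next
            case *: 2
            from order_tendstoD(1)[OF elim(2) *] have "eventually (\<lambda>n. indicator (A j) (Y n j x) = (indicator (A j) (Z j x) :: real)) sequentially"
              by eventually_elim (use * 2 in auto)
            then show ?thesis by (rule tendsto_eventually)
          qed
        qed
      qed simp
    qed
    have m: "(\<lambda>x. \<Prod>j\<in>J. indicator (A j) (X j x) :: real) \<in> borel_measurable M"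
      if X: "\<And>j. j \<in> J \<Longrightarrow> X j \<in> borel_measurable M" for X
      using X Ab by (intro borel_measurable_prod) (auto intro!: measurable_compose[OF _ borel_measurable_indicator])
    have "(\<lambda>n. \<integral>x. (\<Prod>j\<in>J. indicator (A j) (Y n j x)) \<partial>M) \<longlonglongrightarrow> (\<integral>x. (\<Prod>j\<in>J. indicator (A j) (Z j x) :: real) \<partial>M)"
    proof (rule integral_dominated_convergence[where w="\<lambda>_. 1"])
      have "AE x in M. \<forall>j\<in>J. (\<lambda>n. indicator (A j) (Y n j x) :: real) \<longlonglongrightarrow> indicator (A j) (Z j x)"
        using fJ ae by (intro AE_finite_allI)
      then show "AE x in M. (\<lambda>n. \<Prod>j\<in>J. indicator (A j) (Y n j x) :: real) \<longlonglongrightarrow> (\<Prod>j\<in>J. indicator (A j) (Z j x))"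
        by eventually_elim (intro tendsto_prod, blast)
    next
      show "(\<lambda>x. \<Prod>j\<in>J. indicator (A j) (Z j x) :: real) \<in> borel_measurable M"
        using Z J by (intro m) auto
      show "(\<lambda>x. \<Prod>j\<in>J. indicator (A j) (Y n j x) :: real) \<in> borel_measurable M" for n
        using Ym J by (intro m) auto
      have "\<bar>\<Prod>j\<in>J. indicator (A j) (Y n j x) :: real\<bar> \<le> 1" for n x
        unfolding abs_prod by (intro prod_le_1) auto
      then show "AE x in M. norm (\<Prod>j\<in>J. indicator (A j) (Y n j x) :: real) \<le> 1" for n by simp
    qed simp
    then show ?thesis
      using eq[of Z] eq[of "Y _"] Z Ym J by (simp add: subset_iff)
  qed
  have fin: "indep_vars (\<lambda>_. borel) X I \<longleftrightarrow>
      (\<forall>A\<in>I \<rightarrow> E. prob (\<Inter>j\<in>I. X j -` A j \<inter> space M) = (\<Prod>j\<in>I. prob (X j -` A j \<inter> space M)))"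
    if "\<And>i. i \<in> I \<Longrightarrow> X i \<in> borel_measurable M" for X
    by (rule indep_vars_finite) (use I that sE Int in \<open>auto simp: E_def\<close>)
  show "indep_vars (\<lambda>_. borel) Z I"
  proof (subst fin[OF Z], assumption, intro ballI)
    fix A assume A: "A \<in> I \<rightarrow> E"
    have eq: "prob (\<Inter>j\<in>I. Y n j -` A j \<inter> space M) = (\<Prod>j\<in>I. prob (Y n j -` A j \<inter> space M))" for n
      using indep[of n] fin[of "Y n", OF Ym] A by blast
    have "(\<lambda>n. prob (\<Inter>j\<in>I. Y n j -` A j \<inter> space M)) \<longlonglongrightarrow> prob (\<Inter>j\<in>I. Z j -` A j \<inter> space M)"
      using I A by (intro conv) auto
    moreover have "(\<lambda>n. prob (Y n j -` A j \<inter> space M)) \<longlonglongrightarrow> prob (Z j -` A j \<inter> space M)" if "j \<in> I" for j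
      using conv[of "{j}" A] A that by auto
    then have "(\<lambda>n. \<Prod>j\<in>I. prob (Y n j -` A j \<inter> space M)) \<longlonglongrightarrow> (\<Prod>j\<in>I. prob (Z j -` A j \<inter> space M))"
      by (rule tendsto_prod)
    ultimately show "prob (\<Inter>j\<in>I. Z j -` A j \<inter> space M) = (\<Prod>j\<in>I. prob (Z j -` A j \<inter> space M))"
      unfolding eq by (rule LIMSEQ_unique)
  qed
qed

text \<open>Every one of the \<open>m\<close> cells is cut into n + 1 pieces, and all pieces are
  lined up as one partition, to which the independence of increments applies. Sums over disjoint
  blocks are independent, and \<open>V i\<close> is the variance of block \<open>i\<close>.\<close>

lemma brownian_Riemann_sums:
  fixes \<tau> :: "nat \<Rightarrow> real" and a :: "real \<Rightarrow> real" and n m :: nat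
  assumes BM: "brownian_motion M W"
    and \<tau>: "0 \<le> \<tau> 0" "\<And>i. i < m \<Longrightarrow> \<tau> i < \<tau> (Suc i)" "\<tau> m \<le> 1"
    and a: "\<And>t. 0 < a t"
  defines "u \<equiv> \<lambda>i j. \<tau> i + (\<tau> (Suc i) - \<tau> i) * real j / real (Suc n)"
  defines "V \<equiv> \<lambda>i. \<Sum>j<Suc n. (a (u i j))\<^sup>2 * (u i (Suc j) - u i j)"
  defines "Y \<equiv> \<lambda>i \<xi>. (\<Sum>j<Suc n. a (u i j) * (W (u i (Suc j)) \<xi> - W (u i j) \<xi>)) / sqrt (V i)"
  shows "prob_space.indep_vars M (\<lambda>_. borel) Y {..<m}"
    and "\<And>i. i < m \<Longrightarrow> distr M borel (Y i) = std_gaussian"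
proof -
  interpret prob_space M using BM by (simp add: brownian_motion_def)
  define N where "N = Suc n"
  have N: "N > 0" by (simp add: N_def)
  \<comment> \<open>Piece \<open>j\<close> of cell \<open>i\<close> gets the index i N + j. The end
    j = N of a cell is the start of the next one, so the formula for \<open>v\<close> below includes
    j = N.\<close>
  define v where "v k = u (k div N) (k mod N)" for k
  have v: "v (i * N + j) = u i j" if "j \<le> N" for i j
  proof (cases "j = N")
    case True
    have "(i * N + N) div N = Suc i" "(i * N + N) mod N = 0"
      using N by (auto simp: div_add1_eq)
    then show ?thesis using True N by (simp add: v_def u_def N_def[symmetric])
  next
    case False
    then have "j < N" using that by simp
    then have "(i * N + j) div N = i" "(i * N + j) mod N = j" by auto
    then show ?thesis by (simp add: v_def)
  qed
  have block: "\<exists>i j. k = i * N + j \<and> i < m \<and> j < N" if "k < m * N" for k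
    using that N by (intro exI[of _ "k div N"] exI[of _ "k mod N"]) (auto simp: less_mult_imp_div_less)
  have step: "v (Suc k) = v k + (\<tau> (Suc i) - \<tau> i) / real N" if "k = i * N + j" "j < N" for k i j
  proof -
    have "v (Suc k) = u i (Suc j)" using v[of "Suc j" i] that by simp
    moreover have "v k = u i j" using v[of j i] that by simp
    moreover have "u i (Suc j) = u i j + (\<tau> (Suc i) - \<tau> i) / real N"
      unfolding u_def N_def of_nat_Suc[of j] by (simp add: distrib_left add_divide_distrib del: of_nat_Suc)
    ultimately show ?thesis by simp
  qed
  have vless: "v k < v (Suc k)" if k: "k < m * N" for k
  proof -
    obtain i j where ij: "k = i * N + j" "i < m" "j < N" using block[OF k] by blast
    show ?thesis using step[OF ij(1,3)] \<tau>(2)[OF ij(2)] N by simp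
  qed
  have v0: "v 0 = \<tau> 0" using v[of 0 0] by (simp add: u_def)
  have vm: "v (m * N) = \<tau> m" using v[of 0 m] by (simp add: u_def)
  have vle: "v k \<le> v l" if "k \<le> l" "l \<le> m * N" for k l
    using that
  proof (induction l rule: nat_induct_at_least)
    case (Suc l) then show ?case using vless[of l] by auto
  qed simp
  have v01: "0 \<le> v k" "v k \<le> 1" if "k \<le> m * N" for k
    using vle[of 0 k] vle[of k "m * N"] that \<tau> v0 vm by auto
  define D where "D k \<xi> = W (v (Suc k)) \<xi> - W (v k) \<xi>" for k \<xi>
  have "indep_vars (\<lambda>_. borel) D {..<m * N}"
    using BM vless v0 vm \<tau> unfolding D_def brownian_motion_def by auto
  then have "indep_vars (\<lambda>_. borel) (\<lambda>k \<xi>. a (v k) * D k \<xi>) {..<m * N}"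
    by (rule indep_vars_compose2) auto
  define X where "X k \<xi> = a (v k) * D k \<xi>" for k \<xi>
  have X: "indep_vars (\<lambda>_. borel) X {..<m * N}"
    unfolding X_def by fact
  have nX: "distributed M lborel (X k) (normal_density 0 (a (v k) * sqrt (v (Suc k) - v k)))" if k: "k < m * N" for k
  proof -
    have vk: "0 \<le> v k" "v k < v (Suc k)" "v (Suc k) \<le> 1" using v01[of k] v01[of "Suc k"] vless[OF k] k by auto
    have "distr M borel (D k) = density lborel (normal_density 0 (sqrt (v (Suc k) - v k)))"
      using BM vk unfolding D_def brownian_motion_def by blast
    moreover have "distr M borel (D k) = distr M lborel (D k)" by (intro distr_cong) auto
    moreover have "D k \<in> borel_measurable M"
      using BM vk unfolding D_def brownian_motion_def by (intro borel_measurable_diff) auto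
    ultimately have "distributed M lborel (D k) (normal_density 0 (sqrt (v (Suc k) - v k)))"
      by (auto simp: distributed_def)
    from normal_density_affine[OF this, of "a (v k)" 0] show ?thesis
      using a[of "v k"] vk by (simp add: X_def[abs_def])
  qed
  \<comment> \<open>The indices of cell \<open>i\<close>; the bounds are written as shifts by i N to
    match \<open>sum.shift_bounds_nat_ivl\<close>.\<close>
  define K where "K i = {0 + i * N..<N + i * N}" for i
  have Ksub: "K i \<subseteq> {..<m * N}" if "i < m" for i
  proof -
    have "Suc i * N \<le> m * N" using that by (intro mult_le_mono1) simp
    then show ?thesis by (auto simp: K_def)
  qed
  have disj: "disjoint_family_on K {..<m}"
  proof -
    have "k div N = i" if "k \<in> K i" for k i
      using that N by (auto simp: K_def div_nat_eqI mult.commute)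
    then show ?thesis unfolding disjoint_family_on_def by (metis disjoint_iff)
  qed
  have sumK: "(\<Sum>k\<in>K i. g k) = (\<Sum>j<Suc n. g (j + i * N))" for i and g :: "nat \<Rightarrow> real"
    unfolding K_def by (subst sum.shift_bounds_nat_ivl) (simp add: N_def atLeast0LessThan)
  have vj: "v (j + i * N) = u i j" "v (Suc (j + i * N)) = u i (Suc j)" if "j < Suc n" for i j
    using v[of j i] v[of "Suc j" i] that by (auto simp: N_def add.commute)
  have VK: "V i = (\<Sum>k\<in>K i. (a (v k))\<^sup>2 * (v (Suc k) - v k))" for i
    unfolding sumK V_def by (intro sum.cong) (auto simp: vj)
  have YK: "Y i = (\<lambda>\<xi>. (\<Sum>k\<in>K i. X k \<xi>) / sqrt (V i))" for i
    unfolding sumK Y_def X_def D_def by (intro ext arg_cong2[where f="(/)"] sum.cong) (auto simp: vj)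
  have Vpos: "0 < V i" if "i < m" for i
    unfolding VK
  proof (intro sum_pos mult_pos_pos)
    show "0 < (a (v k))\<^sup>2" for k using a[of "v k"] by simp
    show "0 < v (Suc k) - v k" if "k \<in> K i" for k
      using vless[of k] Ksub[OF \<open>i < m\<close>] that by auto
  qed (use N in \<open>auto simp: K_def\<close>)
  show "indep_vars (\<lambda>_. borel) Y {..<m}"
  proof -
    have "indep_vars (\<lambda>i. PiM (K i) (\<lambda>_. borel)) (\<lambda>i \<xi>. restrict (\<lambda>k. X k \<xi>) (K i)) {..<m}"
      using Ksub disj by (intro indep_vars_restrict[OF X]) auto
    then have "indep_vars (\<lambda>_. borel) (\<lambda>i \<xi>. (\<Sum>k\<in>K i. restrict (\<lambda>k. X k \<xi>) (K i) k) / sqrt (V i)) {..<m}"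
      by (rule indep_vars_compose2[where Y="\<lambda>i f. (\<Sum>k\<in>K i. f k) / sqrt (V i)"])
        (intro borel_measurable_divide borel_measurable_sum borel_measurable_const measurable_component_singleton)
    then show ?thesis
      unfolding YK by simp
  qed
  fix i assume i: "i < m"
  have KN: "finite (K i)" "K i \<noteq> {}" using N by (auto simp: K_def)
  have "distributed M lborel (\<lambda>\<xi>. \<Sum>k\<in>K i. X k \<xi>)
     (normal_density (\<Sum>k\<in>K i. 0) (sqrt (\<Sum>k\<in>K i. (a (v k) * sqrt (v (Suc k) - v k))\<^sup>2)))"
    using KN Ksub[OF i] vless a nX
    by (intro sum_indep_normal indep_vars_subset[OF X]) (auto simp: subset_iff)
  also have "(\<Sum>k\<in>K i. (a (v k) * sqrt (v (Suc k) - v k))\<^sup>2) = V i"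
    unfolding VK using Ksub[OF i] vless
    by (intro sum.cong) (auto simp: power_mult_distrib subset_iff less_imp_le)
  finally have "distributed M lborel (\<lambda>\<xi>. ((\<Sum>k\<in>K i. X k \<xi>) - 0) / sqrt (V i)) std_normal_density"
    using Vpos[OF i] by (subst (asm) normal_standard_normal_convert) auto
  then have "distributed M lborel (Y i) std_normal_density" by (simp add: YK)
  then show "distr M borel (Y i) = std_gaussian"
    using distr_std_gaussian_iff by blast
qed

section \<open>Innovations of the process along a time grid\<close>

text \<open>The innovation: what X_t contains beyond its conditional mean exp (s - t) X_s given the
  past, scaled by the conditional standard deviation.\<close>

definition OU_noise :: "real \<Rightarrow> real \<Rightarrow> (real \<Rightarrow> real) \<Rightarrow> real" where
  "OU_noise s t x = (x t - exp (s - t) * x s) / sqrt (1 - exp (2 * (s - t)))"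

lemma OU_noise_eq:
  assumes "s < t"
  shows "x t = exp (s - t) * x s + sqrt (1 - exp (2 * (s - t))) * OU_noise s t x"
  using assms by (simp add: OU_noise_def)

text \<open>The innovation is the integral of exp u dW_u over [s,t] divided by its standard
  deviation. Normalising the sums by their own variance \<open>V n\<close>, and not by its limit,
  makes every approximant exactly standard Gaussian.\<close>

lemma stationary_OU_AE_Riemann_sums:
  fixes u :: "nat \<Rightarrow> nat \<Rightarrow> real"
  assumes OU: "stationary_OU M W X" and st: "0 \<le> s" "s < t" "t \<le> 1"
  defines "u \<equiv> \<lambda>n j. s + (t - s) * real j / real (Suc n)"
  defines "V \<equiv> \<lambda>n. \<Sum>j<Suc n. (exp (u n j))\<^sup>2 * (u n (Suc j) - u n j)"
  shows "AE \<xi> in M. (\<lambda>n. (\<Sum>j<Suc n. exp (u n j) * (W (u n (Suc j)) \<xi> - W (u n j) \<xi>)) / sqrt (V n))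
    \<longlonglongrightarrow> OU_noise s t (X \<xi>)"
proof -
  \<comment> \<open>\<open>V\<close> is itself a Riemann-Stieltjes sum, with w the identity and exp
    (2 u) as integrand.\<close>
  have V: "V \<longlonglongrightarrow> (exp (2 * t) - exp (2 * s)) / 2"
  proof -
    have "((\<lambda>u. 2 * exp (2 * u) * u) has_integral (t * exp (2 * t) - exp (2 * t) / 2) - (s * exp (2 * s) - exp (2 * s) / 2)) {s..t}"
      using st by (intro fundamental_theorem_of_calculus)
        (auto intro!: derivative_eq_intros simp: has_real_derivative_iff_has_vector_derivative[symmetric])
    then have I: "integral {s..t} (\<lambda>u. 2 * exp (2 * u) * u) = (t * exp (2 * t) - exp (2 * t) / 2) - (s * exp (2 * s) - exp (2 * s) / 2)"
      by (rule integral_unique)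
    have "(\<lambda>n. \<Sum>j<Suc n. exp (2 * u n j) * (u n (Suc j) - u n j))
       \<longlonglongrightarrow> exp (2 * t) * t - exp (2 * s) * s - integral {s..t} (\<lambda>u. 2 * exp (2 * u) * u)"
      unfolding u_def using st
      by (intro equidistant_Riemann_Stieltjes[where w="\<lambda>x. x" and f="\<lambda>v. exp (2 * v)" and f'="\<lambda>v. 2 * exp (2 * v)"])
        (auto intro!: derivative_eq_intros continuous_intros)
    moreover have "exp (2 * t) * t - exp (2 * s) * s - integral {s..t} (\<lambda>u. 2 * exp (2 * u) * u) =
        (exp (2 * t) - exp (2 * s)) / 2"
      unfolding I by (simp add: field_simps)
    ultimately show ?thesis
      unfolding V_def by (simp only: exp_double)
  qed
  have pos: "0 < exp (2 * t) - exp (2 * s)" using st by simp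
  have cad: "X \<xi> \<in> cadlag_paths" if "\<xi> \<in> space M" for \<xi>
    using OU measurable_space[of X M path_space \<xi>] that
    by (auto simp: stationary_OU_def path_space_def space_restrict_space)
  have "AE \<xi> in M. continuous_on {0..1} (\<lambda>t. W t \<xi>)"
    using OU by (simp add: stationary_OU_def brownian_motion_def)
  moreover have "AE \<xi> in M. \<forall>t\<in>{0..1}. X \<xi> t = X \<xi> 0 + sqrt 2 * W t \<xi> - set_lebesgue_integral lborel {0..t} (X \<xi>)"
    using OU by (simp add: stationary_OU_def)
  ultimately show ?thesis
    using AE_space
  proof eventually_elim
    case (elim \<xi>)
    let ?I = "exp t * W t \<xi> - exp s * W s \<xi> - integral {s..t} (\<lambda>u. exp u * W u \<xi>)"
    have "(\<lambda>n. \<Sum>j<Suc n. exp (u n j) * (W (u n (Suc j)) \<xi> - W (u n j) \<xi>)) \<longlonglongrightarrow> ?I"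
      unfolding u_def using st elim(1)
      by (intro equidistant_Riemann_Stieltjes[where w="\<lambda>t. W t \<xi>" and f=exp and f'=exp])
        (auto intro!: derivative_eq_intros continuous_intros intro: continuous_on_subset)
    then have "(\<lambda>n. (\<Sum>j<Suc n. exp (u n j) * (W (u n (Suc j)) \<xi> - W (u n j) \<xi>)) / sqrt (V n))
      \<longlonglongrightarrow> ?I / sqrt ((exp (2 * t) - exp (2 * s)) / 2)"
      using V pos by (intro tendsto_divide tendsto_real_sqrt) auto
    also have "?I / sqrt ((exp (2 * t) - exp (2 * s)) / 2) = (sqrt 2 * ?I) / sqrt (exp (2 * t) - exp (2 * s))"
      by (simp add: real_sqrt_divide)
    also have "sqrt 2 * ?I = exp t * X \<xi> t - exp s * X \<xi> s"
      using OU_path_identity[OF cadlag_paths_set_integrable[OF cad[OF elim(3)]] elim(1) elim(2)[THEN bspec],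
          of s t, symmetric] st by (simp only: less_imp_le)
    also have "\<dots> = exp t * (X \<xi> t - exp (s - t) * X \<xi> s)"
      by (simp add: exp_diff field_simps)
    also have "exp (2 * t) - exp (2 * s) = (exp t)\<^sup>2 * (1 - exp (2 * (s - t)))"
      by (simp add: exp_double[symmetric] right_diff_distrib exp_add[symmetric])
    also have "sqrt \<dots> = exp t * sqrt (1 - exp (2 * (s - t)))"
      by (simp add: real_sqrt_mult)
    finally show ?case by (simp add: OU_noise_def)
  qed
qed

text \<open>Position 0 of \<open>Z\<close> is X_0, position i >= 1 the innovation over the i-th
  cell. Among the approximants, the Riemann sums are independent by the Brownian increments, and X_0
  is independent of them because it is independent of W.\<close>

lemma stationary_OU_grid:
  fixes \<tau> :: "nat \<Rightarrow> real"
  assumes OU: "stationary_OU M W X"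
    and \<tau>: "\<tau> 0 = 0" "\<And>i. i < m \<Longrightarrow> \<tau> i < \<tau> (Suc i)" "\<tau> m \<le> 1" and m: "0 < m"
  defines "Z \<equiv> \<lambda>i \<xi>. if i = 0 then X \<xi> 0 else OU_noise (\<tau> (i - 1)) (\<tau> i) (X \<xi>)"
  shows "prob_space.indep_vars M (\<lambda>_. borel) Z {..<Suc m}"
    and "\<And>i. i < Suc m \<Longrightarrow> distr M borel (Z i) = std_gaussian"
proof -
  have BM: "brownian_motion M W" using OU by (simp add: stationary_OU_def)
  interpret prob_space M using BM by (simp add: brownian_motion_def)
  have mono: "\<tau> k \<le> \<tau> l" if "k \<le> l" "l \<le> m" for k l
    using that
  proof (induction l rule: nat_induct_at_least)
    case (Suc l) then show ?case using \<tau>(2)[of l] by auto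
  qed simp
  have \<tau>01: "0 \<le> \<tau> k" "\<tau> k \<le> 1" if "k \<le> m" for k
    using mono[of 0 k] mono[of k m] that \<tau> by auto
  have Xt: "(\<lambda>\<xi>. X \<xi> t) \<in> borel_measurable M" if "t \<in> {0..1}" for t
  proof -
    have "X \<in> measurable M path_space" using OU by (simp add: stationary_OU_def)
    then have "X \<in> measurable M (PiM {0..1} (\<lambda>_. borel))"
      unfolding path_space_def by (rule measurable_restrict_space2_iff[THEN iffD1, THEN conjunct1])
    then show ?thesis using that by (rule measurable_compose[OF _ measurable_component_singleton])
  qed
  have Zm: "Z i \<in> borel_measurable M" if "i < Suc m" for i
    unfolding Z_def OU_noise_def using that \<tau>01[of i] \<tau>01[of "i - 1"]
    by (cases "i = 0") (auto intro!: borel_measurable_divide borel_measurable_diff borel_measurable_times Xt)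
  define u where "u n i j = \<tau> i + (\<tau> (Suc i) - \<tau> i) * real j / real (Suc n)" for n i j
  define V where "V n i = (\<Sum>j<Suc n. (exp (u n i j))\<^sup>2 * (u n i (Suc j) - u n i j))" for n i
  define S where "S n i \<xi> = (\<Sum>j<Suc n. exp (u n i j) * (W (u n i (Suc j)) \<xi> - W (u n i j) \<xi>)) / sqrt (V n i)" for n i \<xi>
  have u01: "u n i j \<in> {0..1}" if "i < m" "j \<le> Suc n" for n i j
  proof -
    have "(\<tau> (Suc i) - \<tau> i) * (real j / real (Suc n)) \<le> (\<tau> (Suc i) - \<tau> i) * 1"
      using \<tau>(2)[of i] that by (intro mult_left_mono) (auto simp: divide_le_eq_1)
    moreover have "0 \<le> (\<tau> (Suc i) - \<tau> i) * (real j / real (Suc n))"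
      using \<tau>(2)[of i] that by simp
    ultimately show ?thesis using \<tau>01[of i] \<tau>01[of "Suc i"] that by (simp add: u_def)
  qed
  have S: "indep_vars (\<lambda>_. borel) (S n) {..<m}" "\<And>i. i < m \<Longrightarrow> distr M borel (S n i) = std_gaussian" for n
    using brownian_Riemann_sums[OF BM _ \<tau>(2,3), where a=exp and n=n] \<tau>(1)
    unfolding S_def[abs_def] V_def u_def by auto
  define Y where "Y n i \<xi> = (if i = 0 then X \<xi> 0 else S n (i - 1) \<xi>)" for n i \<xi>
  \<comment> \<open>The \<sigma>-algebra of the driving path, in the form used by
    \<open>stationary_OU\<close>. The Riemann sums are measurable for it, which makes them jointly
    independent of X_0.\<close>
  define G where "G = vimage_algebra (space M) (\<lambda>\<xi>. \<lambda>t\<in>{0..1}. W t \<xi>) (PiM {0..1} (\<lambda>_. borel :: real measure))"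
  have WG: "W t \<in> borel_measurable G" if "t \<in> {0..1}" for t
  proof -
    have "(\<lambda>\<xi>. \<lambda>t\<in>{0..1}. W t \<xi>) \<in> measurable G (PiM {0..1} (\<lambda>_. borel))"
      unfolding G_def by (rule measurable_vimage_algebra1) (auto simp: space_PiM)
    then have "(\<lambda>\<xi>. (\<lambda>t\<in>{0..1}. W t \<xi>) t) \<in> measurable G borel"
      using that by (rule measurable_compose[OF _ measurable_component_singleton])
    then show ?thesis using that by simp
  qed
  have SG: "S n i \<in> borel_measurable G" if "i < m" for n i
    unfolding S_def[abs_def] using u01[OF that]
    by (intro borel_measurable_divide borel_measurable_sum borel_measurable_times borel_measurable_diff WG) auto
  have Yind: "indep_vars (\<lambda>_. borel) (Y n) {..<Suc m}" for n
  proof -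
    have Sm: "S n i \<in> borel_measurable M" if "i < m" for i
      using S(1)[of n] that by (auto simp: indep_vars_def)
    have "indep_vars (\<lambda>_. borel) (Y n) {..<Suc m} \<longleftrightarrow> (\<forall>A\<in>{..<Suc m} \<rightarrow> sets borel.
        prob (\<Inter>j\<in>{..<Suc m}. Y n j -` A j \<inter> space M) = (\<Prod>j\<in>{..<Suc m}. prob (Y n j -` A j \<inter> space M)))"
    proof (rule indep_vars_finite)
      show "Y n i \<in> borel_measurable M" if "i \<in> {..<Suc m}" for i
        unfolding Y_def[abs_def] using that Sm[of "i - 1"] Xt[of 0] by (cases "i = 0") auto
      show "sets (borel :: real measure) = sigma_sets (space borel) (sets borel)"
        by (rule sets.sigma_sets_eq[symmetric])
    qed (auto intro: sets.Int_stable)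
    also have "\<dots>"
    proof
      fix A :: "nat \<Rightarrow> real set" assume A: "A \<in> {..<Suc m} \<rightarrow> sets borel"
      define B where "B = (\<Inter>i\<in>{..<m}. S n i -` A (Suc i) \<inter> space M)"
      have X0: "Y n 0 -` A 0 \<inter> space M \<in> sets (vimage_algebra (space M) (\<lambda>\<xi>. X \<xi> 0) borel)"
        using A by (auto simp: Y_def sets_vimage_algebra2)
      have "S n i -` A (Suc i) \<inter> space M \<in> sets G" if "i < m" for i
      proof -
        have "S n i -` A (Suc i) \<inter> space G \<in> sets G"
          using A that by (intro measurable_sets[OF SG[OF that]]) auto
        then show ?thesis by (simp add: G_def)
      qed
      then have BG: "B \<in> sets G" unfolding B_def using m by (intro sets.finite_INT) auto
      \<comment> \<open>Index 0 is split off: its event belongs to X_0, and the remaining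
        intersection \<open>B\<close> to the \<sigma>-algebra of W.\<close>
      have "{..<Suc m} = insert 0 (Suc ` {..<m})" by (rule lessThan_Suc_eq_insert_0)
      then have "(\<Inter>j\<in>{..<Suc m}. Y n j -` A j \<inter> space M) = (Y n 0 -` A 0 \<inter> space M) \<inter> B"
        by (auto simp: B_def Y_def)
      also have "prob \<dots> = prob (Y n 0 -` A 0 \<inter> space M) * prob B"
        using OU X0 BG unfolding stationary_OU_def G_def indep_sets2_eq by blast
      also have "prob B = (\<Prod>i\<in>{..<m}. prob (S n i -` A (Suc i) \<inter> space M))"
        unfolding B_def using S(1)[of n] A m by (intro indep_varsD) auto
      also have "prob (Y n 0 -` A 0 \<inter> space M) * \<dots> = (\<Prod>j\<in>{..<Suc m}. prob (Y n j -` A j \<inter> space M))"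
        by (simp only: prod.lessThan_Suc_shift) (simp add: Y_def[abs_def])
      finally show "prob (\<Inter>j\<in>{..<Suc m}. Y n j -` A j \<inter> space M) = (\<Prod>j\<in>{..<Suc m}. prob (Y n j -` A j \<inter> space M))" .
    qed
    finally show ?thesis .
  qed
  have Yd: "distr M borel (Y n i) = std_gaussian" if "i < Suc m" for n i
    using OU S(2)[of "i - 1" n] that by (cases "i = 0") (auto simp: Y_def[abs_def] stationary_OU_def)
  have lim: "AE \<xi> in M. (\<lambda>n. Y n i \<xi>) \<longlonglongrightarrow> Z i \<xi>" if "i < Suc m" for i
  proof (cases i)
    case (Suc k)
    then have "k < m" using that by simp
    have "AE \<xi> in M. (\<lambda>n. S n k \<xi>) \<longlonglongrightarrow> OU_noise (\<tau> k) (\<tau> (Suc k)) (X \<xi>)"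
      unfolding S_def V_def u_def
      using \<open>k < m\<close> \<tau>(2)[of k] \<tau>01[of k] \<tau>01[of "Suc k"] by (intro stationary_OU_AE_Riemann_sums[OF OU]) auto
    then show ?thesis using Suc by (simp add: Y_def Z_def)
  qed (simp add: Y_def Z_def)
  show "indep_vars (\<lambda>_. borel) Z {..<Suc m}"
    by (rule indep_vars_std_gaussian_limit(1)[OF _ _ Yind]) (use Yd Zm lim in auto)
  show "distr M borel (Z i) = std_gaussian" if "i < Suc m" for i
    by (rule indep_vars_std_gaussian_limit(2)[OF _ _ Yind]) (use that Yd Zm lim in auto)
qed

subsection \<open>The Markov property\<close>

text \<open>\<^const>\<open>prob_space.indep_var\<close> wants both variables in one type, so the noise is packed into a
  function on \<open>{0}\<close>.\<close>

lemma stationary_OU_Markov: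
  assumes OU: "stationary_OU M W X" and st: "0 \<le> s" "s < t" "t \<le> 1"
  shows "prob_space.indep_var M (PiM {0..s} (\<lambda>_. borel)) (\<lambda>\<xi>. restrict (X \<xi>) {0..s})
      (PiM {0::real} (\<lambda>_. borel)) (\<lambda>\<xi>. \<lambda>_\<in>{0}. OU_noise s t (X \<xi>))"
    and "distr M borel (\<lambda>\<xi>. OU_noise s t (X \<xi>)) = std_gaussian"
proof -
  interpret prob_space M using OU by (simp add: stationary_OU_def brownian_motion_def)
  let ?R = "\<lambda>\<xi>. restrict (X \<xi>) {0..s}" and ?N = "\<lambda>\<xi>. \<lambda>u\<in>{0::real}. OU_noise s t (X \<xi>)"
  let ?Q = "PiM {0::real} (\<lambda>_. borel :: real measure)"
  have Xt: "(\<lambda>\<xi>. X \<xi> t) \<in> borel_measurable M" if "t \<in> {0..1}" for t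
  proof -
    have "X \<in> measurable M path_space" using OU by (simp add: stationary_OU_def)
    then have "X \<in> measurable M (PiM {0..1} (\<lambda>_. borel))"
      unfolding path_space_def by (rule measurable_restrict_space2_iff[THEN iffD1, THEN conjunct1])
    then show ?thesis using that by (rule measurable_compose[OF _ measurable_component_singleton])
  qed
  have Rm: "?R \<in> measurable M (PiM {0..s} (\<lambda>_. borel))"
    using st by (intro measurable_restrict Xt) auto
  have Nm: "?N \<in> measurable M ?Q"
    unfolding OU_noise_def using st
    by (intro measurable_restrict borel_measurable_divide borel_measurable_diff borel_measurable_times Xt) auto
  \<comment> \<open>Independence on cylinders over finitely many times suffices, since they form an
    intersection-stable generator. The law of the noise is carried along as a second conjunct
    because it comes from the same grid.\<close>
  have grid: "prob ((?R -` prod_emb {0..s} (\<lambda>_. borel) J (Pi\<^sub>E J A) \<inter> space M) \<inter> (?N -` B \<inter> space M)) =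
      prob (?R -` prod_emb {0..s} (\<lambda>_. borel) J (Pi\<^sub>E J A) \<inter> space M) * prob (?N -` B \<inter> space M)
      \<and> distr M borel (\<lambda>\<xi>. OU_noise s t (X \<xi>)) = std_gaussian"
    if J: "finite J" "J \<subseteq> {0..s}" and A: "\<And>u. u \<in> J \<Longrightarrow> A u \<in> sets borel" and B: "B \<in> sets ?Q"
    for J :: "real set" and A and B :: "(real \<Rightarrow> real) set"
  proof -
    \<comment> \<open>Adding 0 and \<open>s\<close> makes the grid start at 0 and its last step run
      from \<open>s\<close> to \<open>t\<close>: the entries of \<open>xs\<close> have the indices 0
      to m - 1, and index \<open>m\<close> stands for \<open>t\<close>.\<close>
    define xs where "xs = sorted_list_of_set (J \<union> {0, s})"
    define m where "m = length xs"
    define \<tau> where "\<tau> i = (if i < m then xs ! i else t)" for i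
    have fin: "finite (J \<union> {0, s})" using J by simp
    have set_xs: "set xs = J \<union> {0, s}" unfolding xs_def by (rule set_sorted_list_of_set[OF fin])
    have srt: "sorted_wrt (<) xs" unfolding xs_def by simp
    have m0: "0 < m" using set_xs unfolding m_def by (metis Un_insert_right insert_not_empty length_greater_0_conv list.set(1))
    have rng: "xs ! i \<in> {0..s}" if "i < m" for i
    proof -
      have "xs ! i \<in> set xs" using that by (simp add: m_def)
      then show ?thesis using set_xs J st by auto
    qed
    have inc: "\<tau> i < \<tau> (Suc i)" if "i < m" for i
      using sorted_wrt_nth_less[OF srt, of i "Suc i"] rng[of i] that st by (auto simp: \<tau>_def m_def)
    have idx: "\<exists>i<m. xs ! i = u" if "u \<in> J \<union> {0, s}" for u
      using that unfolding set_xs[symmetric] in_set_conv_nth m_def by blast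
    have \<tau>0: "\<tau> 0 = 0"
    proof -
      obtain i where i: "i < m" "xs ! i = 0" using idx[of 0] by auto
      then have "i = 0 \<or> xs ! 0 < xs ! i" using sorted_wrt_nth_less[OF srt, of 0 i] by (auto simp: m_def)
      then show ?thesis using i rng[of 0] m0 by (auto simp: \<tau>_def)
    qed
    have \<tau>s: "\<tau> (m - 1) = s"
    proof -
      obtain i where i: "i < m" "xs ! i = s" using idx[of s] by auto
      have "i = m - 1 \<or> i < m - 1" using i(1) by linarith
      then have "i = m - 1 \<or> xs ! i < xs ! (m - 1)"
        using sorted_wrt_nth_less[OF srt, of i "m - 1"] m0 by (auto simp: m_def)
      then show ?thesis using i rng[of "m - 1"] m0 by (auto simp: \<tau>_def)
    qed
    have \<tau>m: "\<tau> m = t" by (simp add: \<tau>_def)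
    define Z where "Z i \<xi> = (if i = 0 then X \<xi> 0 else OU_noise (\<tau> (i - 1)) (\<tau> i) (X \<xi>))" for i \<xi>
    have Z: "indep_vars (\<lambda>_. borel) Z {..<Suc m}" "\<And>i. i < Suc m \<Longrightarrow> distr M borel (Z i) = std_gaussian"
      using stationary_OU_grid[OF OU \<tau>0 inc _ m0] \<tau>m st unfolding Z_def[abs_def] by auto
    have ZN: "Z m = (\<lambda>\<xi>. OU_noise s t (X \<xi>))" using m0 \<tau>s \<tau>m by (auto simp: Z_def)
    \<comment> \<open>Recovers the path at the i-th grid time from X_0 and the first
      \<open>i\<close> innovations. The cylinder event thus becomes an event \<open>E\<close> of the
      variables with index below \<open>m\<close>, which are independent of the last
      innovation.\<close>
    define h :: "nat \<Rightarrow> (nat \<Rightarrow> real) \<Rightarrow> real" where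
      "h = rec_nat (\<lambda>f. f 0) (\<lambda>i hi f. exp (\<tau> i - \<tau> (Suc i)) * hi f + sqrt (1 - exp (2 * (\<tau> i - \<tau> (Suc i)))) * f (Suc i))"
    have h0: "h 0 f = f 0" and hS: "h (Suc i) f = exp (\<tau> i - \<tau> (Suc i)) * h i f + sqrt (1 - exp (2 * (\<tau> i - \<tau> (Suc i)))) * f (Suc i)" for i f
      by (simp_all add: h_def)
    have hX: "h i (restrict (\<lambda>i. Z i \<xi>) {..<m}) = X \<xi> (\<tau> i)" if "i < m" for i \<xi>
      using that
    proof (induction i)
      case 0 then show ?case using m0 by (simp add: h0 Z_def \<tau>0)
    next
      case (Suc i)
      have "h i (restrict (\<lambda>i. Z i \<xi>) {..<m}) = X \<xi> (\<tau> i)"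
        by (rule Suc.IH) (use Suc.prems in simp)
      moreover have "restrict (\<lambda>i. Z i \<xi>) {..<m} (Suc i) = OU_noise (\<tau> i) (\<tau> (Suc i)) (X \<xi>)"
        using Suc.prems by (simp add: Z_def)
      moreover have "i < m" using Suc.prems by simp
      ultimately show ?case unfolding hS using OU_noise_eq[OF inc[of i], of "X \<xi>"] by simp
    qed
    have hm: "h i \<in> borel_measurable (PiM {..<m} (\<lambda>_. borel))" if "i < m" for i
      using that
    proof (induction i)
      case (Suc i)
      have "(\<lambda>f. f (Suc i)) \<in> borel_measurable (PiM {..<m} (\<lambda>_. borel :: real measure))"
        using Suc.prems by (intro measurable_component_singleton) simp
      moreover have "h i \<in> borel_measurable (PiM {..<m} (\<lambda>_. borel))"
        by (rule Suc.IH) (use Suc.prems in simp)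
      ultimately show ?case unfolding hS[abs_def]
        by (intro borel_measurable_add borel_measurable_times borel_measurable_const)
    qed (simp add: h0[abs_def])
    define E where "E = {f \<in> space (PiM {..<m} (\<lambda>_. borel :: real measure)). \<forall>i\<in>{i. i < m \<and> \<tau> i \<in> J}. h i f \<in> A (\<tau> i)}"
    have E: "E \<in> sets (PiM {..<m} (\<lambda>_. borel))"
      unfolding E_def
    proof (rule sets.sets_Collect_finite_All)
      fix i assume i: "i \<in> {i. i < m \<and> \<tau> i \<in> J}"
      have "h i -` A (\<tau> i) \<inter> space (PiM {..<m} (\<lambda>_. borel)) \<in> sets (PiM {..<m} (\<lambda>_. borel))"
        using i A by (intro measurable_sets[OF hm]) auto
      then show "{f \<in> space (PiM {..<m} (\<lambda>_. borel)). h i f \<in> A (\<tau> i)} \<in> sets (PiM {..<m} (\<lambda>_. borel))"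
        by (simp add: vimage_def Int_def conj_commute)
    qed simp
    let ?Zr = "\<lambda>\<xi>. restrict (\<lambda>i. Z i \<xi>) {..<m}"
    have ev: "?Zr -` E \<inter> space M = ?R -` prod_emb {0..s} (\<lambda>_. borel) J (Pi\<^sub>E J A) \<inter> space M"
    proof -
      have "?Zr \<xi> \<in> E \<longleftrightarrow> (\<forall>u\<in>J. X \<xi> u \<in> A u)" for \<xi>
      proof -
        have "?Zr \<xi> \<in> E \<longleftrightarrow> (\<forall>i. i < m \<and> \<tau> i \<in> J \<longrightarrow> X \<xi> (\<tau> i) \<in> A (\<tau> i))"
          by (auto simp: E_def hX space_PiM)
        also have "\<dots> \<longleftrightarrow> (\<forall>u\<in>J. X \<xi> u \<in> A u)"
        proof safe
          fix u assume *: "\<forall>i. i < m \<and> \<tau> i \<in> J \<longrightarrow> X \<xi> (\<tau> i) \<in> A (\<tau> i)" and u: "u \<in> J"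
          obtain i where "i < m" "xs ! i = u" using idx[of u] u by auto
          with * u show "X \<xi> u \<in> A u" by (auto simp: \<tau>_def)
        qed auto
        finally show ?thesis .
      qed
      moreover have "?R \<xi> \<in> prod_emb {0..s} (\<lambda>_. borel) J (Pi\<^sub>E J A) \<longleftrightarrow> (\<forall>u\<in>J. X \<xi> u \<in> A u)" for \<xi>
        using J by (auto simp: prod_emb_def PiE_iff subset_iff Int_absorb1)
      ultimately show ?thesis by blast
    qed
    have "indep_var (PiM {..<m} (\<lambda>_. borel)) ?Zr (PiM {m} (\<lambda>_. borel)) (\<lambda>\<xi>. restrict (\<lambda>i. Z i \<xi>) {m})"
      using indep_var_restrict[OF Z(1), of "{..<m}" "{m}"] by auto
    note ind = this
    let ?c = "\<lambda>f :: nat \<Rightarrow> real. \<lambda>u\<in>{0::real}. f m"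
    have "?c \<in> measurable (PiM {m} (\<lambda>_. borel)) ?Q"
      by (intro measurable_restrict measurable_component_singleton) simp
    then have B': "?c -` B \<inter> space (PiM {m} (\<lambda>_. borel)) \<in> sets (PiM {m} (\<lambda>_. borel))"
      using B by (rule measurable_sets)
    let ?B = "?c -` B \<inter> space (PiM {m} (\<lambda>_. borel))" and ?Zm = "\<lambda>\<xi>. restrict (\<lambda>i. Z i \<xi>) {m}"
    have "?Zm \<xi> \<in> ?B \<longleftrightarrow> ?N \<xi> \<in> B" for \<xi>
      by (auto simp: space_PiM ZN)
    then have eqB: "?Zm -` ?B \<inter> space M = ?N -` B \<inter> space M"
      "(\<lambda>\<xi>. (?Zr \<xi>, ?Zm \<xi>)) -` (E \<times> ?B) \<inter> space M = (?Zr -` E \<inter> space M) \<inter> (?N -` B \<inter> space M)"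
      by blast+
    have "prob ((?Zr -` E \<inter> space M) \<inter> (?N -` B \<inter> space M)) = prob (?Zr -` E \<inter> space M) * prob (?N -` B \<inter> space M)"
      using indep_varD[OF ind E B'] unfolding eqB .
    moreover have "distr M borel (\<lambda>\<xi>. OU_noise s t (X \<xi>)) = std_gaussian" using Z(2)[of m] ZN by simp
    ultimately show ?thesis unfolding ev by simp
  qed
  \<comment> \<open>Any instance of \<open>grid\<close> yields this conjunct; the trivial one has no
    times and the empty event.\<close>
  show "distr M borel (\<lambda>\<xi>. OU_noise s t (X \<xi>)) = std_gaussian"
    using grid[of "{}" "\<lambda>_. UNIV" "{}"] by simp
  let ?PA = "prod_algebra {0..s} (\<lambda>_. borel :: real measure)"
  have eq1: "sigma_sets (space M) {?R -` A \<inter> space M |A. A \<in> sets (PiM {0..s} (\<lambda>_. borel))} =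
      sigma_sets (space M) {?R -` A \<inter> space M |A. A \<in> ?PA}"
  proof -
    have "{?R -` A \<inter> space M |A. A \<in> sets (PiM {0..s} (\<lambda>_. borel))} = sigma_sets (space M) {?R -` A \<inter> space M |A. A \<in> ?PA}"
      unfolding sets_PiM by (rule sigma_sets_vimage_commute) auto
    then show ?thesis by (simp only:) (rule sigma_sets_sigma_sets_eq, auto)
  qed
  have stable: "Int_stable {f -` A \<inter> space M |A. A \<in> \<A>}" if "Int_stable \<A>" for f :: "'a \<Rightarrow> 'c" and \<A>
  proof (rule Int_stableI)
    fix a b assume "a \<in> {f -` A \<inter> space M |A. A \<in> \<A>}" "b \<in> {f -` A \<inter> space M |A. A \<in> \<A>}"
    then obtain A B where "A \<in> \<A>" "B \<in> \<A>" "a = f -` A \<inter> space M" "b = f -` B \<inter> space M" by blast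
    moreover from this have "A \<inter> B \<in> \<A>" "a \<inter> b = f -` (A \<inter> B) \<inter> space M"
      using that by (auto simp: Int_stable_def)
    ultimately show "a \<inter> b \<in> {f -` A \<inter> space M |A. A \<in> \<A>}" by blast
  qed
  show "indep_var (PiM {0..s} (\<lambda>_. borel)) ?R ?Q ?N"
    unfolding indep_var_eq eq1
  proof (intro conjI Rm Nm indep_set_sigma_sets stable Int_stable_prod_algebra sets.Int_stable)
    show "indep_set {?R -` A \<inter> space M |A. A \<in> ?PA} {?N -` A \<inter> space M |A. A \<in> sets ?Q}"
    proof (rule indep_setI)
      have "?PA \<subseteq> sets (PiM {0..s} (\<lambda>_. borel))" unfolding sets_PiM by (auto intro: sigma_sets.Basic)
      then show "{?R -` A \<inter> space M |A. A \<in> ?PA} \<subseteq> events"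
        using measurable_sets[OF Rm] by auto
      show "{?N -` A \<inter> space M |A. A \<in> sets ?Q} \<subseteq> events"
        using measurable_sets[OF Nm] by auto
    next
      fix a b assume "a \<in> {?R -` A \<inter> space M |A. A \<in> ?PA}" and "b \<in> {?N -` A \<inter> space M |A. A \<in> sets ?Q}"
      then obtain A B where A: "A \<in> ?PA" "a = ?R -` A \<inter> space M" and B: "B \<in> sets ?Q" "b = ?N -` B \<inter> space M" by blast
      from A(1) obtain J E where J: "A = prod_emb {0..s} (\<lambda>_. borel) J (Pi\<^sub>E J E)" "finite J" "J \<subseteq> {0..s}"
        "\<And>i. i \<in> J \<Longrightarrow> E i \<in> sets borel" using prod_algebraE by blast
      show "prob (a \<inter> b) = prob a * prob b"
        using grid[OF J(2-4) B(1)] A(2) B(2) J(1) by simp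
    qed
  qed
qed

section \<open>The stationary law on path space\<close>

text \<open>The interface between the equation and the construction. The last assumption is the
  Markov property in integral form: under \<open>R\<close> the innovation may be replaced by a fresh
  standard Gaussian. In this form it also applies to integrands that contain a density depending on
  the past.\<close>

locale OU_law = prob_space R for R :: "(real \<Rightarrow> real) measure" +
  assumes sets_R: "sets R = sets path_space"
    and distr_0: "distr R borel (\<lambda>\<omega>. \<omega> 0) = std_gaussian"
    and nn_integral_noise: "\<And>s t f. 0 \<le> s \<Longrightarrow> s < t \<Longrightarrow> t \<le> 1 \<Longrightarrow>
      f \<in> borel_measurable (PiM {0..s} (\<lambda>_. borel) \<Otimes>\<^sub>M borel) \<Longrightarrow>
      (\<integral>\<^sup>+\<omega>. f (restrict \<omega> {0..s}, OU_noise s t \<omega>) \<partial>R) =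
      (\<integral>\<^sup>+\<omega>. \<integral>\<^sup>+z. f (restrict \<omega> {0..s}, z) \<partial>std_gaussian \<partial>R)"

lemma measurable_restrict_path_space:
  assumes "s \<le> 1"
  shows "(\<lambda>\<omega>. restrict \<omega> {0..s}) \<in> measurable path_space (PiM {0..s} (\<lambda>_. borel))"
  unfolding path_space_def using assms
  by (intro measurable_restrict_space1 measurable_restrict_subset) auto

lemma measurable_path_eval:
  assumes "t \<in> {0..1}"
  shows "(\<lambda>\<omega>. \<omega> t) \<in> borel_measurable path_space"
  unfolding path_space_def using assms
  by (intro measurable_restrict_space1 measurable_component_singleton)

lemma measurable_OU_noise:
  assumes "0 \<le> s" "s < t" "t \<le> 1"
  shows "OU_noise s t \<in> borel_measurable path_space"
  unfolding OU_noise_def[abs_def] using assms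
  by (intro borel_measurable_divide borel_measurable_diff borel_measurable_times measurable_path_eval) auto

text \<open>Independence says that the joint law is a product, and Tonelli's theorem turns the
  product into the iterated integral; evaluation at 0 unpacks the noise.\<close>

lemma OU_law_distr:
  assumes OU: "stationary_OU M W X"
  shows "OU_law (distr M path_space X)"
proof -
  interpret prob_space M using OU by (simp add: stationary_OU_def brownian_motion_def)
  have X[measurable]: "X \<in> measurable M path_space" using OU by (simp add: stationary_OU_def)
  interpret R: prob_space "distr M path_space X" by (rule prob_space_distr[OF X])
  show ?thesis
  proof
    show "distr (distr M path_space X) borel (\<lambda>\<omega>. \<omega> 0) = std_gaussian"
      using OU measurable_path_eval[of 0] by (subst distr_distr) (auto simp: stationary_OU_def comp_def)
  next
    fix s t :: real and f :: "(real \<Rightarrow> real) \<times> real \<Rightarrow> ennreal"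
    assume st: "0 \<le> s" "s < t" "t \<le> 1"
    let ?P = "PiM {0..s} (\<lambda>_. borel :: real measure)"
    assume f[measurable]: "f \<in> borel_measurable (?P \<Otimes>\<^sub>M borel)"
    have [measurable]: "(\<lambda>\<omega>. restrict \<omega> {0..s}) \<in> measurable path_space ?P"
      using st by (intro measurable_restrict_path_space) auto
    have [measurable]: "OU_noise s t \<in> borel_measurable path_space"
      using st by (intro measurable_OU_noise)
    interpret G: prob_space std_gaussian by (rule prob_space_std_gaussian)
    let ?Q = "PiM {0::real} (\<lambda>_. borel :: real measure)"
    let ?N = "\<lambda>\<xi>. \<lambda>_\<in>{0::real}. OU_noise s t (X \<xi>)"
    have Nm[measurable]: "?N \<in> measurable M ?Q" by measurable
    interpret N: prob_space "distr M ?Q ?N" by (rule prob_space_distr[OF Nm])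
    have *: "distr M ?P (\<lambda>\<xi>. restrict (X \<xi>) {0..s}) \<Otimes>\<^sub>M distr M ?Q ?N =
        distr M (?P \<Otimes>\<^sub>M ?Q) (\<lambda>\<xi>. (restrict (X \<xi>) {0..s}, ?N \<xi>))"
      using stationary_OU_Markov(1)[OF OU st] unfolding indep_var_distribution_eq by simp
    have "(\<integral>\<^sup>+\<omega>. f (restrict \<omega> {0..s}, OU_noise s t \<omega>) \<partial>distr M path_space X) =
        (\<integral>\<^sup>+\<xi>. f (restrict (X \<xi>) {0..s}, ?N \<xi> 0) \<partial>M)"
      by (subst nn_integral_distr) auto
    also have "\<dots> = (\<integral>\<^sup>+p. f (fst p, snd p 0) \<partial>(distr M ?P (\<lambda>\<xi>. restrict (X \<xi>) {0..s}) \<Otimes>\<^sub>M distr M ?Q ?N))"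
      unfolding * by (subst nn_integral_distr) auto
    also have "\<dots> = (\<integral>\<^sup>+x. \<integral>\<^sup>+z. f (x, z 0) \<partial>distr M ?Q ?N \<partial>distr M ?P (\<lambda>\<xi>. restrict (X \<xi>) {0..s}))"
      by (subst N.nn_integral_fst[symmetric]) auto
    also have "\<dots> = (\<integral>\<^sup>+x. \<integral>\<^sup>+z. f (x, z) \<partial>std_gaussian \<partial>distr M ?P (\<lambda>\<xi>. restrict (X \<xi>) {0..s}))"
    proof (intro nn_integral_cong)
      fix x assume "x \<in> space (distr M ?P (\<lambda>\<xi>. restrict (X \<xi>) {0..s}))"
      then have [measurable]: "x \<in> space ?P" by simp
      have "(\<integral>\<^sup>+z. f (x, z 0) \<partial>distr M ?Q ?N) = (\<integral>\<^sup>+\<xi>. f (x, OU_noise s t (X \<xi>)) \<partial>M)"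
        by (subst nn_integral_distr) auto
      also have "\<dots> = (\<integral>\<^sup>+z. f (x, z) \<partial>distr M borel (\<lambda>\<xi>. OU_noise s t (X \<xi>)))"
        by (subst nn_integral_distr) auto
      finally show "(\<integral>\<^sup>+z. f (x, z 0) \<partial>distr M ?Q ?N) = (\<integral>\<^sup>+z. f (x, z) \<partial>std_gaussian)"
        unfolding stationary_OU_Markov(2)[OF OU st] .
    qed
    also have "\<dots> = (\<integral>\<^sup>+\<omega>. \<integral>\<^sup>+z. f (restrict \<omega> {0..s}, z) \<partial>std_gaussian \<partial>distr M path_space X)"
      by (subst (1 2) nn_integral_distr) auto
    finally show "(\<integral>\<^sup>+\<omega>. f (restrict \<omega> {0..s}, OU_noise s t \<omega>) \<partial>distr M path_space X) =
      (\<integral>\<^sup>+\<omega>. \<integral>\<^sup>+z. f (restrict \<omega> {0..s}, z) \<partial>std_gaussian \<partial>distr M path_space X)" .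
  qed simp
qed

subsection \<open>Gaussian changes of variables\<close>

lemma nn_integral_std_gaussian:
  assumes [measurable]: "f \<in> borel_measurable borel"
  shows "(\<integral>\<^sup>+x. f x \<partial>std_gaussian) = (\<integral>\<^sup>+x. ennreal (std_normal_density x) * f x \<partial>lborel)"
  unfolding std_gaussian_def by (subst nn_integral_density) auto

text \<open>For u = c x + s y one has (u - c x) / s = y and (x - c u) / s = s x - c y. Both sides
  are then the planar Gaussian density, at a point and at its image under a reflection, which
  preserves the norm.\<close>

lemma std_normal_density_reflection:
  assumes "c\<^sup>2 + s\<^sup>2 = 1" "s \<noteq> 0"
  shows "std_normal_density x * std_normal_density ((u - c * x) / s) =
    std_normal_density u * std_normal_density ((x - c * u) / s)"
proof -
  have "x\<^sup>2 + ((u - c * x) / s)\<^sup>2 = u\<^sup>2 + ((x - c * u) / s)\<^sup>2"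
  proof -
    have "s\<^sup>2 * x\<^sup>2 + (u - c * x)\<^sup>2 = s\<^sup>2 * u\<^sup>2 + (x - c * u)\<^sup>2"
    proof -
      have s2: "s\<^sup>2 = 1 - c\<^sup>2" using assms by linarith
      show ?thesis unfolding s2 by (simp add: power2_eq_square algebra_simps)
    qed
    then show ?thesis using assms by (simp add: power_divide field_simps)
  qed
  then have "- x\<^sup>2 / 2 + - ((u - c * x) / s)\<^sup>2 / 2 = - u\<^sup>2 / 2 + - ((x - c * u) / s)\<^sup>2 / 2" by argo
  then have "exp (- x\<^sup>2 / 2) * exp (- ((u - c * x) / s)\<^sup>2 / 2) = exp (- u\<^sup>2 / 2) * exp (- ((x - c * u) / s)\<^sup>2 / 2)"
    by (simp only: exp_add[symmetric])
  then show ?thesis by (simp add: std_normal_density_def)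
qed

text \<open>A reflection is symmetric in the old and the new first coordinate. Hence the proof
  consists of two affine substitutions in one variable, separated by an exchange of integrals, with
  the same Jacobian |s|, which cancels.\<close>

lemma nn_integral_std_gaussian_reflection:
  fixes F :: "real \<times> real \<Rightarrow> ennreal"
  assumes F[measurable]: "F \<in> borel_measurable (borel \<Otimes>\<^sub>M borel)" and cs: "c\<^sup>2 + s\<^sup>2 = 1" "s \<noteq> 0"
  shows "(\<integral>\<^sup>+x. \<integral>\<^sup>+y. F (c * x + s * y, s * x - c * y) \<partial>std_gaussian \<partial>std_gaussian) =
    (\<integral>\<^sup>+x. \<integral>\<^sup>+y. F (x, y) \<partial>std_gaussian \<partial>std_gaussian)"
proof -
  let ?\<phi> = "\<lambda>x. ennreal (std_normal_density x)"
  have refl_eq: "(x - c * (c * x + s * y)) / s = s * x - c * y" for x y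
  proof -
    have "x - c * (c * x + s * y) = (1 - c\<^sup>2) * x - s * (c * y)" by (simp add: power2_eq_square algebra_simps)
    also have "1 - c\<^sup>2 = s\<^sup>2" using cs by linarith
    finally show ?thesis using cs by (simp add: power2_eq_square diff_divide_distrib)
  qed
  have "ennreal \<bar>s\<bar> * (\<integral>\<^sup>+x. \<integral>\<^sup>+y. F (c * x + s * y, s * x - c * y) \<partial>std_gaussian \<partial>std_gaussian) =
      (\<integral>\<^sup>+x. ?\<phi> x * (ennreal \<bar>s\<bar> * (\<integral>\<^sup>+y. ?\<phi> y * F (c * x + s * y, s * x - c * y) \<partial>lborel)) \<partial>lborel)"
    by (simp add: nn_integral_std_gaussian nn_integral_cmult[symmetric] mult.left_commute)
  also have "\<dots> = (\<integral>\<^sup>+x. ?\<phi> x * (\<integral>\<^sup>+u. ?\<phi> ((u - c * x) / s) * F (u, (x - c * u) / s) \<partial>lborel) \<partial>lborel)"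
  proof (intro nn_integral_cong arg_cong2[where f="(*)"] refl)
    fix x
    show "ennreal \<bar>s\<bar> * (\<integral>\<^sup>+y. ?\<phi> y * F (c * x + s * y, s * x - c * y) \<partial>lborel) =
      (\<integral>\<^sup>+u. ?\<phi> ((u - c * x) / s) * F (u, (x - c * u) / s) \<partial>lborel)"
      using cs by (subst (2) nn_integral_real_affine[where t="c * x" and c=s]) (auto simp: refl_eq)
  qed
  also have "\<dots> = (\<integral>\<^sup>+x. \<integral>\<^sup>+u. ?\<phi> u * (?\<phi> ((x - c * u) / s) * F (u, (x - c * u) / s)) \<partial>lborel \<partial>lborel)"
  proof (intro nn_integral_cong)
    fix x
    have "?\<phi> x * (?\<phi> ((u - c * x) / s) * y) = ?\<phi> u * (?\<phi> ((x - c * u) / s) * y)" for u y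
      using std_normal_density_reflection[OF cs, of x u]
      by (simp add: mult.assoc[symmetric] ennreal_mult'[symmetric])
    then show "?\<phi> x * (\<integral>\<^sup>+u. ?\<phi> ((u - c * x) / s) * F (u, (x - c * u) / s) \<partial>lborel) =
      (\<integral>\<^sup>+u. ?\<phi> u * (?\<phi> ((x - c * u) / s) * F (u, (x - c * u) / s)) \<partial>lborel)"
      by (subst nn_integral_cmult[symmetric]) auto
  qed
  also have "\<dots> = (\<integral>\<^sup>+u. \<integral>\<^sup>+x. ?\<phi> u * (?\<phi> ((x - c * u) / s) * F (u, (x - c * u) / s)) \<partial>lborel \<partial>lborel)"
    by (rule lborel_pair.Fubini') measurable
  also have "\<dots> = (\<integral>\<^sup>+u. ?\<phi> u * (ennreal \<bar>s\<bar> * (\<integral>\<^sup>+v. ?\<phi> v * F (u, v) \<partial>lborel)) \<partial>lborel)"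
  proof (intro nn_integral_cong)
    fix u
    have "(\<integral>\<^sup>+x. ?\<phi> u * (?\<phi> ((x - c * u) / s) * F (u, (x - c * u) / s)) \<partial>lborel) =
        ?\<phi> u * (\<integral>\<^sup>+x. ?\<phi> ((x - c * u) / s) * F (u, (x - c * u) / s) \<partial>lborel)"
      by (rule nn_integral_cmult) measurable
    also have "(\<integral>\<^sup>+x. ?\<phi> ((x - c * u) / s) * F (u, (x - c * u) / s) \<partial>lborel) =
        ennreal \<bar>s\<bar> * (\<integral>\<^sup>+v. ?\<phi> v * F (u, v) \<partial>lborel)"
      using cs by (subst nn_integral_real_affine[where t="c * u" and c=s]) auto
    finally show "(\<integral>\<^sup>+x. ?\<phi> u * (?\<phi> ((x - c * u) / s) * F (u, (x - c * u) / s)) \<partial>lborel) =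
        ?\<phi> u * (ennreal \<bar>s\<bar> * (\<integral>\<^sup>+v. ?\<phi> v * F (u, v) \<partial>lborel))" .
  qed
  also have "\<dots> = ennreal \<bar>s\<bar> * (\<integral>\<^sup>+x. \<integral>\<^sup>+y. F (x, y) \<partial>std_gaussian \<partial>std_gaussian)"
    by (simp add: nn_integral_std_gaussian nn_integral_cmult[symmetric] mult.left_commute)
  finally show ?thesis using cs by (simp add: ennreal_mult_cancel_left)
qed

text \<open>A weighted sum of independent Gaussians is Gaussian: this is the reflection lemma for a
  function of the first coordinate alone.\<close>

lemma nn_integral_std_gaussian_rotation:
  fixes f :: "real \<Rightarrow> ennreal"
  assumes f[measurable]: "f \<in> borel_measurable borel" and ab: "a\<^sup>2 + b\<^sup>2 = d\<^sup>2" "b \<noteq> 0"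
  shows "(\<integral>\<^sup>+x. \<integral>\<^sup>+y. f (a * x + b * y) \<partial>std_gaussian \<partial>std_gaussian) = (\<integral>\<^sup>+x. f (d * x) \<partial>std_gaussian)"
proof -
  interpret prob_space std_gaussian by (rule prob_space_std_gaussian)
  have d: "d \<noteq> 0" using ab sum_power2_gt_zero_iff[of a b] by auto
  have "(a / d)\<^sup>2 + (b / d)\<^sup>2 = 1" using ab(1) d by (simp add: power_divide add_divide_distrib[symmetric])
  from nn_integral_std_gaussian_reflection[of "\<lambda>p. f (d * fst p)", OF _ this]
  have "(\<integral>\<^sup>+x. \<integral>\<^sup>+y. f (d * (a / d * x + b / d * y)) \<partial>std_gaussian \<partial>std_gaussian) =
      (\<integral>\<^sup>+x. \<integral>\<^sup>+y. f (d * x) \<partial>std_gaussian \<partial>std_gaussian)"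
    using d ab by simp
  moreover have "d * (a / d * x + b / d * y) = a * x + b * y" for x y
    using d by (simp add: distrib_left)
  ultimately show ?thesis by (simp add: emeasure_space_1)
qed

text \<open>The Mehler kernel: the density of the centred Gaussian law with unit variances and
  correlation \<open>k\<close> with respect to the product of two standard Gaussian laws.\<close>

definition gaussian_corr_density :: "real \<Rightarrow> real \<Rightarrow> real \<Rightarrow> real" where
  "gaussian_corr_density k x y =
     exp ((2 * k * x * y - k\<^sup>2 * x\<^sup>2 - k\<^sup>2 * y\<^sup>2) / (2 * (1 - k\<^sup>2))) / sqrt (1 - k\<^sup>2)"

lemma gaussian_corr_density_commute: "gaussian_corr_density k x y = gaussian_corr_density k y x"
  by (simp add: gaussian_corr_density_def algebra_simps)

lemma gaussian_corr_density_pos: "\<bar>k\<bar> < 1 \<Longrightarrow> 0 < gaussian_corr_density k x y"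
  by (simp add: gaussian_corr_density_def abs_square_less_1)

lemma measurable_gaussian_corr_density [measurable (raw)]:
  assumes [measurable]: "f \<in> borel_measurable M" "g \<in> borel_measurable M"
  shows "(\<lambda>x. gaussian_corr_density k (f x) (g x)) \<in> borel_measurable M"
  unfolding gaussian_corr_density_def by measurable

text \<open>The logarithm is a quadratic polynomial in \<open>x\<close> and \<open>y\<close>, which
  is what will keep the entropy of the tilts finite.\<close>

lemma abs_ln_gaussian_corr_density_le:
  assumes "\<bar>k\<bar> < 1"
  obtains C where "0 \<le> C" "\<And>x y. \<bar>ln (gaussian_corr_density k x y)\<bar> \<le> C * (1 + x\<^sup>2 + y\<^sup>2)"
proof -
  have k: "0 < 1 - k\<^sup>2" using assms by (simp add: abs_square_less_1)
  define A where "A = 1 / (2 * (1 - k\<^sup>2))"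
  define C where "C = 2 * A + \<bar>ln (sqrt (1 - k\<^sup>2))\<bar>"
  have A: "0 \<le> A" using k by (simp add: A_def)
  have "\<bar>ln (gaussian_corr_density k x y)\<bar> \<le> C * (1 + x\<^sup>2 + y\<^sup>2)" for x y
  proof -
    let ?E = "2 * k * x * y - k\<^sup>2 * x\<^sup>2 - k\<^sup>2 * y\<^sup>2"
    have "ln (gaussian_corr_density k x y) = ?E * A - ln (sqrt (1 - k\<^sup>2))"
      using k by (simp add: gaussian_corr_density_def ln_div A_def)
    then have "\<bar>ln (gaussian_corr_density k x y)\<bar> \<le> \<bar>?E\<bar> * A + \<bar>ln (sqrt (1 - k\<^sup>2))\<bar>"
      using A by (simp add: abs_mult) (metis abs_mult abs_of_nonneg abs_triangle_ineq4)
    also have "\<bar>?E\<bar> \<le> 2 * (1 + x\<^sup>2 + y\<^sup>2)"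
    proof -
      have k2: "k\<^sup>2 * z\<^sup>2 \<le> z\<^sup>2" "0 \<le> k\<^sup>2 * z\<^sup>2" for z using k by (auto simp: mult_left_le_one_le)
      have "2 * k * x * y \<le> (k * x)\<^sup>2 + y\<^sup>2" "- (2 * k * x * y) \<le> (k * x)\<^sup>2 + y\<^sup>2"
        using zero_le_power2[of "k * x - y"] zero_le_power2[of "k * x + y"]
        by (auto simp: power2_eq_square algebra_simps)
      moreover have "\<bar>P - A - B\<bar> \<le> 2 * (1 + X + Y)"
        if "P \<le> A + Y" "- P \<le> A + Y" "A \<le> X" "0 \<le> A" "B \<le> Y" "0 \<le> B" for P A B X Y :: real
        using that by (simp add: abs_le_iff)
      ultimately show ?thesis
        using k2[of x] k2[of y] unfolding power_mult_distrib by blast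
    qed
    finally have "\<bar>ln (gaussian_corr_density k x y)\<bar> \<le> 2 * (1 + x\<^sup>2 + y\<^sup>2) * A + \<bar>ln (sqrt (1 - k\<^sup>2))\<bar>"
      using A by (simp add: mult_right_mono)
    also have "\<dots> \<le> C * (1 + x\<^sup>2 + y\<^sup>2)"
      by (simp add: C_def distrib_left distrib_right)
    finally show ?thesis .
  qed
  moreover have "0 \<le> C" using A by (simp add: C_def)
  ultimately show ?thesis using that by blast
qed

text \<open>Given the first coordinate \<open>a\<close>, the second one is Gaussian with mean k a
  and variance 1 - k^2. The substitution z = k a + s b completes the square.\<close>

lemma nn_integral_gaussian_corr_density:
  fixes f :: "real \<Rightarrow> ennreal"
  assumes [measurable]: "f \<in> borel_measurable borel" and k: "\<bar>k\<bar> < 1"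
  shows "(\<integral>\<^sup>+z. ennreal (gaussian_corr_density k a z) * f z \<partial>std_gaussian) =
    (\<integral>\<^sup>+b. f (k * a + sqrt (1 - k\<^sup>2) * b) \<partial>std_gaussian)"
proof -
  define s where "s = sqrt (1 - k\<^sup>2)"
  have k2: "0 < 1 - k\<^sup>2" using k by (simp add: abs_square_less_1)
  then have s: "0 < s" "s\<^sup>2 = 1 - k\<^sup>2" by (auto simp: s_def)
  have dens: "s * (std_normal_density (k * a + s * b) * gaussian_corr_density k a (k * a + s * b)) = std_normal_density b" for b
  proof -
    let ?z = "k * a + s * b"
    have "- ?z\<^sup>2 / 2 + (2 * k * a * ?z - k\<^sup>2 * a\<^sup>2 - k\<^sup>2 * ?z\<^sup>2) / (2 * (1 - k\<^sup>2)) = - b\<^sup>2 / 2"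
    proof -
      have "(1 - k\<^sup>2) * ?z\<^sup>2 - (2 * k * a * ?z - k\<^sup>2 * a\<^sup>2 - k\<^sup>2 * ?z\<^sup>2) = (?z - k * a)\<^sup>2"
        by (simp add: power2_eq_square algebra_simps)
      also have "\<dots> = (1 - k\<^sup>2) * b\<^sup>2" by (simp add: power_mult_distrib s)
      finally have "2 * k * a * ?z - k\<^sup>2 * a\<^sup>2 - k\<^sup>2 * ?z\<^sup>2 = (1 - k\<^sup>2) * (?z\<^sup>2 - b\<^sup>2)"
        by (simp add: right_diff_distrib)
      moreover have "c * x / (2 * c) = x / 2" if "0 < c" for c x :: real
        using that by simp
      note this[OF k2, of "?z\<^sup>2 - b\<^sup>2"]
      ultimately show ?thesis by (simp only:) argo
    qed
    then have "exp (- ?z\<^sup>2 / 2) * exp ((2 * k * a * ?z - k\<^sup>2 * a\<^sup>2 - k\<^sup>2 * ?z\<^sup>2) / (2 * (1 - k\<^sup>2))) = exp (- b\<^sup>2 / 2)"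
      by (simp only: exp_add[symmetric])
    then show ?thesis using s by (simp add: std_normal_density_def gaussian_corr_density_def s_def[symmetric])
  qed
  have "(\<integral>\<^sup>+z. ennreal (gaussian_corr_density k a z) * f z \<partial>std_gaussian) =
      (\<integral>\<^sup>+z. ennreal (std_normal_density z) * (ennreal (gaussian_corr_density k a z) * f z) \<partial>lborel)"
    by (rule nn_integral_std_gaussian) measurable
  also have "\<dots> = ennreal \<bar>s\<bar> * (\<integral>\<^sup>+b. ennreal (std_normal_density (k * a + s * b)) *
      (ennreal (gaussian_corr_density k a (k * a + s * b)) * f (k * a + s * b)) \<partial>lborel)"
    using s by (subst nn_integral_real_affine[where t="k * a" and c=s]) auto
  also have "\<dots> = (\<integral>\<^sup>+b. ennreal \<bar>s\<bar> * (ennreal (std_normal_density (k * a + s * b)) *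
      (ennreal (gaussian_corr_density k a (k * a + s * b)) * f (k * a + s * b))) \<partial>lborel)"
    by (rule nn_integral_cmult[symmetric]) measurable
  also have "\<dots> = (\<integral>\<^sup>+b. ennreal (std_normal_density b) * f (k * a + s * b) \<partial>lborel)"
  proof (intro nn_integral_cong)
    fix b
    have "ennreal \<bar>s\<bar> * (ennreal (std_normal_density (k * a + s * b)) * ennreal (gaussian_corr_density k a (k * a + s * b))) =
        ennreal (std_normal_density b)"
      using s gaussian_corr_density_pos[OF k, of a "k * a + s * b"] dens[of b]
      by (simp add: ennreal_mult[symmetric] less_imp_le)
    then show "ennreal \<bar>s\<bar> * (ennreal (std_normal_density (k * a + s * b)) *
        (ennreal (gaussian_corr_density k a (k * a + s * b)) * f (k * a + s * b))) =
        ennreal (std_normal_density b) * f (k * a + s * b)"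
      by (simp add: mult.assoc[symmetric])
  qed
  also have "\<dots> = (\<integral>\<^sup>+b. f (k * a + s * b) \<partial>std_gaussian)"
    by (rule nn_integral_std_gaussian[symmetric]) measurable
  finally show ?thesis by (simp add: s_def)
qed

lemma nn_integral_gaussian_corr_density_eq_1:
  assumes "\<bar>k\<bar> < 1"
  shows "(\<integral>\<^sup>+z. ennreal (gaussian_corr_density k a z) \<partial>std_gaussian) = 1"
    and "(\<integral>\<^sup>+z. ennreal (gaussian_corr_density k z a) \<partial>std_gaussian) = 1"
proof -
  interpret prob_space std_gaussian by (rule prob_space_std_gaussian)
  show 1: "(\<integral>\<^sup>+z. ennreal (gaussian_corr_density k a z) \<partial>std_gaussian) = 1"
    using nn_integral_gaussian_corr_density[of "\<lambda>_. 1", OF _ assms, of a] by (simp add: emeasure_space_1)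
  then show "(\<integral>\<^sup>+z. ennreal (gaussian_corr_density k z a) \<partial>std_gaussian) = 1"
    by (subst gaussian_corr_density_commute)
qed

subsection \<open>Tilting the stationary law\<close>

context OU_law
begin

lemma borel_measurable_R: "borel_measurable R = borel_measurable path_space"
  by (rule measurable_cong_sets[OF sets_R refl])

text \<open>The quadratic bound on \<open>ln G\<close> is there to make the entropy of \<open>G \<cdot> R\<close> finite: the marginals of
  \<open>G \<cdot> R\<close> have second moments.\<close>

definition tilt :: "real \<Rightarrow> real \<Rightarrow> ((real \<Rightarrow> real) \<Rightarrow> real) \<Rightarrow> bool" where
  "tilt s \<rho> G \<longleftrightarrow> 0 \<le> s \<and> s \<le> 1 \<and> \<bar>\<rho>\<bar> < 1 \<and>
     G \<in> borel_measurable (PiM {0..s} (\<lambda>_. borel)) \<and> (\<forall>\<omega>. G (restrict \<omega> {0..s}) = G \<omega>) \<and> (\<forall>\<omega>. 0 < G \<omega>) \<and>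
     (\<exists>C T. 0 \<le> C \<and> finite T \<and> T \<subseteq> {0..s} \<and> (\<forall>\<omega>. \<bar>ln (G \<omega>)\<bar> \<le> C * (1 + (\<Sum>t\<in>T. (\<omega> t)\<^sup>2)))) \<and>
     (\<forall>t f. t \<in> {0..s} \<longrightarrow> f \<in> borel_measurable borel \<longrightarrow>
        (\<integral>\<^sup>+\<omega>. ennreal (G \<omega>) * f (\<omega> t) \<partial>R) = (\<integral>\<^sup>+x. f x \<partial>std_gaussian)) \<and>
     (\<forall>F. F \<in> borel_measurable (borel \<Otimes>\<^sub>M borel) \<longrightarrow>
        (\<integral>\<^sup>+\<omega>. ennreal (G \<omega>) * F (\<omega> 0, \<omega> s) \<partial>R) =
        (\<integral>\<^sup>+x. \<integral>\<^sup>+y. F (x, \<rho> * x + sqrt (1 - \<rho>\<^sup>2) * y) \<partial>std_gaussian \<partial>std_gaussian))"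

text \<open>Stationarity: X_t is a combination of X_0 and an independent standard Gaussian
  innovation, with coefficients whose squares add up to 1.\<close>

lemma nn_integral_eval:
  assumes t: "t \<in> {0..1}" and f[measurable]: "f \<in> borel_measurable borel"
  shows "(\<integral>\<^sup>+\<omega>. f (\<omega> t) \<partial>R) = (\<integral>\<^sup>+x. f x \<partial>std_gaussian)"
proof -
  have m0[measurable]: "(\<lambda>\<omega>. \<omega> 0) \<in> borel_measurable R"
    unfolding borel_measurable_R by (rule measurable_path_eval) simp
  have 0: "(\<integral>\<^sup>+\<omega>. g (\<omega> 0) \<partial>R) = (\<integral>\<^sup>+x. g x \<partial>std_gaussian)" if [measurable]: "g \<in> borel_measurable borel" for g
    unfolding distr_0[symmetric] by (subst nn_integral_distr) auto
  interpret \<gamma>: prob_space std_gaussian by (rule prob_space_std_gaussian)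
  show ?thesis
  proof (cases "t = 0")
    case False
    then have t: "0 < t" "t \<le> 1" using assms by auto
    let ?r = "exp (0 - t)" and ?\<sigma> = "sqrt (1 - exp (2 * (0 - t)))"
    have [measurable]: "(\<lambda>p. p 0) \<in> borel_measurable (PiM {0..0::real} (\<lambda>_. borel :: real measure))"
      by (rule measurable_component_singleton) simp
    have "(\<integral>\<^sup>+\<omega>. f (\<omega> t) \<partial>R) = (\<integral>\<^sup>+\<omega>. (\<lambda>(p, z). f (?r * p 0 + ?\<sigma> * z)) (restrict \<omega> {0..0}, OU_noise 0 t \<omega>) \<partial>R)"
      using OU_noise_eq[OF t(1)] by (intro nn_integral_cong) simp
    also have "\<dots> = (\<integral>\<^sup>+\<omega>. \<integral>\<^sup>+z. (\<lambda>(p, z). f (?r * p 0 + ?\<sigma> * z)) (restrict \<omega> {0..0}, z) \<partial>std_gaussian \<partial>R)"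
      using t by (intro nn_integral_noise) auto
    also have "\<dots> = (\<integral>\<^sup>+\<omega>. (\<lambda>x. \<integral>\<^sup>+z. f (?r * x + ?\<sigma> * z) \<partial>std_gaussian) (\<omega> 0) \<partial>R)"
      by simp
    also have "\<dots> = (\<integral>\<^sup>+x. \<integral>\<^sup>+z. f (?r * x + ?\<sigma> * z) \<partial>std_gaussian \<partial>std_gaussian)"
      by (rule 0) measurable
    also have "\<dots> = (\<integral>\<^sup>+x. f (1 * x) \<partial>std_gaussian)"
      using t by (intro nn_integral_std_gaussian_rotation) (auto simp: exp_double[symmetric])
    finally show ?thesis by simp
  qed (simp add: 0)
qed

text \<open>The construction starts from \<open>R\<close> itself, at a positive time: at time 0 the
  correlation would be 1, and X_0 would have no part orthogonal to X_s.\<close>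

lemma tilt_const:
  assumes s: "0 < s" "s \<le> 1"
  shows "tilt s (exp (- s)) (\<lambda>_. 1)"
  unfolding tilt_def
proof (intro conjI allI impI)
  show "\<exists>C T. 0 \<le> C \<and> finite T \<and> T \<subseteq> {0..s} \<and> (\<forall>\<omega>. \<bar>ln (1 :: real)\<bar> \<le> C * (1 + (\<Sum>t\<in>T. (\<omega> t)\<^sup>2)))"
    by (intro exI[of _ 0] exI[of _ "{}"]) simp
  fix f :: "real \<Rightarrow> ennreal" and t assume "t \<in> {0..s}" "f \<in> borel_measurable borel"
  then show "(\<integral>\<^sup>+\<omega>. ennreal 1 * f (\<omega> t) \<partial>R) = (\<integral>\<^sup>+x. f x \<partial>std_gaussian)"
    using nn_integral_eval[of t f] s by simp
next
  fix F :: "real \<times> real \<Rightarrow> ennreal" assume [measurable]: "F \<in> borel_measurable (borel \<Otimes>\<^sub>M borel)"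
  interpret \<gamma>: prob_space std_gaussian by (rule prob_space_std_gaussian)
  let ?r = "exp (0 - s)" and ?\<sigma> = "sqrt (1 - exp (2 * (0 - s)))"
  have [measurable]: "(\<lambda>p. p 0) \<in> borel_measurable (PiM {0..0::real} (\<lambda>_. borel :: real measure))"
    by (rule measurable_component_singleton) simp
  have "(\<integral>\<^sup>+\<omega>. F (\<omega> 0, \<omega> s) \<partial>R) = (\<integral>\<^sup>+\<omega>. (\<lambda>(p, z). F (p 0, ?r * p 0 + ?\<sigma> * z)) (restrict \<omega> {0..0}, OU_noise 0 s \<omega>) \<partial>R)"
    using OU_noise_eq[OF s(1)] by (intro nn_integral_cong) simp
  also have "\<dots> = (\<integral>\<^sup>+\<omega>. \<integral>\<^sup>+z. (\<lambda>(p, z). F (p 0, ?r * p 0 + ?\<sigma> * z)) (restrict \<omega> {0..0}, z) \<partial>std_gaussian \<partial>R)"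
    using s by (intro nn_integral_noise) auto
  also have "\<dots> = (\<integral>\<^sup>+\<omega>. (\<lambda>x. \<integral>\<^sup>+z. F (x, ?r * x + ?\<sigma> * z) \<partial>std_gaussian) (\<omega> 0) \<partial>R)"
    by simp
  also have "\<dots> = (\<integral>\<^sup>+x. \<integral>\<^sup>+z. F (x, ?r * x + ?\<sigma> * z) \<partial>std_gaussian \<partial>std_gaussian)"
    by (rule nn_integral_eval) (simp, measurable)
  finally show "(\<integral>\<^sup>+\<omega>. ennreal 1 * F (\<omega> 0, \<omega> s) \<partial>R) =
      (\<integral>\<^sup>+x. \<integral>\<^sup>+y. F (x, exp (- s) * x + sqrt (1 - (exp (- s))\<^sup>2) * y) \<partial>std_gaussian \<partial>std_gaussian)"
    by (simp add: exp_double[symmetric])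
qed (use s in auto)

text \<open>The Mehler kernel integrates to 1 in either argument. For times up to \<open>s\<close>
  the noise is integrated out; for times strictly between \<open>s\<close> and \<open>s'\<close> it
  is the orthogonal part \<open>\<zeta>\<close>; at \<open>s'\<close> the marginal comes from the
  joint law with X_0.\<close>

lemma tilt_step:
  assumes G: "tilt s \<rho> G" and s': "s < s'" "s' \<le> 1" and k: "\<bar>k\<bar> < 1"
  defines "r \<equiv> exp (s - s')"
  shows "tilt s' (r * \<rho> + sqrt (1 - r\<^sup>2) * k * sqrt (1 - \<rho>\<^sup>2))
    (\<lambda>\<omega>. G \<omega> * gaussian_corr_density k ((\<omega> 0 - \<rho> * \<omega> s) / sqrt (1 - \<rho>\<^sup>2)) (OU_noise s s' \<omega>))"
proof -
  interpret \<gamma>: prob_space std_gaussian by (rule prob_space_std_gaussian)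
  interpret \<gamma>\<gamma>: pair_sigma_finite std_gaussian std_gaussian ..
  define \<sigma> where "\<sigma> = sqrt (1 - r\<^sup>2)"
  define \<eta> where "\<eta> = sqrt (1 - \<rho>\<^sup>2)"
  define \<theta> where "\<theta> = sqrt (1 - k\<^sup>2)"
  define \<rho>' where "\<rho>' = r * \<rho> + \<sigma> * k * \<eta>"
  define \<zeta> where "\<zeta> \<omega> = (\<omega> 0 - \<rho> * \<omega> s) / \<eta>" for \<omega> :: "real \<Rightarrow> real"
  let ?q = "gaussian_corr_density k"
  define G' where "G' \<omega> = G \<omega> * ?q (\<zeta> \<omega>) (OU_noise s s' \<omega>)" for \<omega>
  have s: "0 \<le> s" "s \<le> 1" and \<rho>: "\<bar>\<rho>\<bar> < 1" and Gm[measurable]: "G \<in> borel_measurable (PiM {0..s} (\<lambda>_. borel))"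
    and Gr: "\<And>\<omega>. G (restrict \<omega> {0..s}) = G \<omega>" and Gpos: "\<And>\<omega>. 0 < G \<omega>"
    and Gt: "\<And>t f. t \<in> {0..s} \<Longrightarrow> f \<in> borel_measurable borel \<Longrightarrow>
        (\<integral>\<^sup>+\<omega>. ennreal (G \<omega>) * f (\<omega> t) \<partial>R) = (\<integral>\<^sup>+x. f x \<partial>std_gaussian)"
    and GJ: "\<And>F. F \<in> borel_measurable (borel \<Otimes>\<^sub>M borel) \<Longrightarrow>
        (\<integral>\<^sup>+\<omega>. ennreal (G \<omega>) * F (\<omega> 0, \<omega> s) \<partial>R) =
        (\<integral>\<^sup>+x. \<integral>\<^sup>+y. F (x, \<rho> * x + \<eta> * y) \<partial>std_gaussian \<partial>std_gaussian)"
    using G unfolding tilt_def \<eta>_def by auto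
  have r: "0 < r" "r < 1" using s' by (auto simp: r_def)
  then have r2: "r\<^sup>2 < 1" by (simp add: power_less_one_iff)
  have \<rho>2: "\<rho>\<^sup>2 < 1" using \<rho> by (simp add: abs_square_less_1)
  have k2: "k\<^sup>2 < 1" using k by (simp add: abs_square_less_1)
  have pos: "0 < \<sigma>" "0 < \<eta>" "0 < \<theta>" using r2 \<rho>2 k2 by (auto simp: \<sigma>_def \<eta>_def \<theta>_def)
  have sq: "\<sigma>\<^sup>2 = 1 - r\<^sup>2" "\<eta>\<^sup>2 = 1 - \<rho>\<^sup>2" "\<theta>\<^sup>2 = 1 - k\<^sup>2"
    using r2 \<rho>2 k2 by (auto simp: \<sigma>_def \<eta>_def \<theta>_def)
  \<comment> \<open>Under the tilted law X_s' = \<rho>' X_0 + \<alpha> w + \<sigma> \<theta> b,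
    where w = \<eta> X_s - \<rho> \<zeta> is orthogonal to X_0 and b is fresh noise. So
    \<open>var\<close> computes the variance that X_0 leaves unexplained.\<close>
  define \<alpha> where "\<alpha> = r * \<eta> - \<sigma> * k * \<rho>"
  have var: "\<alpha>\<^sup>2 + (\<sigma> * \<theta>)\<^sup>2 = 1 - \<rho>'\<^sup>2"
  proof -
    have "\<alpha>\<^sup>2 + \<rho>'\<^sup>2 = r\<^sup>2 * (\<rho>\<^sup>2 + \<eta>\<^sup>2) + \<sigma>\<^sup>2 * k\<^sup>2 * (\<rho>\<^sup>2 + \<eta>\<^sup>2)"
      unfolding \<alpha>_def \<rho>'_def by (simp add: power2_eq_square algebra_simps)
    also have "\<dots> = r\<^sup>2 + \<sigma>\<^sup>2 * k\<^sup>2" by (simp add: sq)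
    also have "\<dots> = 1 - (\<sigma> * \<theta>)\<^sup>2" unfolding power_mult_distrib sq(3) by (simp add: sq algebra_simps)
    finally show ?thesis by linarith
  qed
  have "0 < (\<sigma> * \<theta>)\<^sup>2" using pos by simp
  then have \<rho>'2: "\<rho>'\<^sup>2 < 1" using var zero_le_power2[of \<alpha>] by linarith
  then have \<rho>': "\<bar>\<rho>'\<bar> < 1" by (simp add: abs_square_less_1)
  have \<sigma>_noise: "sqrt (1 - exp (2 * (s - s'))) = \<sigma>" by (simp only: \<sigma>_def r_def exp_double)
  have Xs': "\<omega> s' = r * \<omega> s + \<sigma> * OU_noise s s' \<omega>" for \<omega>
    using OU_noise_eq[OF s'(1), of \<omega>] by (simp only: \<sigma>_noise r_def)
  have eval: "(\<lambda>p. p u) \<in> borel_measurable (PiM {0..v} (\<lambda>_. borel :: real measure))" if "u \<in> {0..v}" for u v :: real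
    using that by (rule measurable_component_singleton)
  have ev: "(\<lambda>p. p 0) \<in> borel_measurable (PiM {0..s} (\<lambda>_. borel :: real measure))"
    "(\<lambda>p. p s) \<in> borel_measurable (PiM {0..s} (\<lambda>_. borel :: real measure))" using s by (auto intro!: eval)
  have \<zeta>m[measurable]: "\<zeta> \<in> borel_measurable (PiM {0..s} (\<lambda>_. borel))" unfolding \<zeta>_def
    by (intro borel_measurable_divide borel_measurable_diff borel_measurable_times borel_measurable_const ev)
  have \<zeta>r: "\<zeta> (restrict \<omega> {0..v}) = \<zeta> \<omega>" if "s \<le> v" for \<omega> v using s that by (simp add: \<zeta>_def)

  \<comment> \<open>Under \<open>G \<cdot> R\<close> the variables \<open>\<zeta>\<close> and \<open>\<omega> s\<close> are independent standard Gaussians.\<close>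
  have K: "(\<integral>\<^sup>+\<omega>. ennreal (G \<omega>) * f (\<zeta> \<omega>, \<omega> s) \<partial>R) =
      (\<integral>\<^sup>+x. \<integral>\<^sup>+a. f (a, x) \<partial>std_gaussian \<partial>std_gaussian)"
    if [measurable]: "f \<in> borel_measurable (borel \<Otimes>\<^sub>M borel)" for f :: "real \<times> real \<Rightarrow> ennreal"
  proof -
    have "(\<integral>\<^sup>+\<omega>. ennreal (G \<omega>) * f (\<zeta> \<omega>, \<omega> s) \<partial>R) =
        (\<integral>\<^sup>+\<omega>. ennreal (G \<omega>) * (\<lambda>(u, v). f ((u - \<rho> * v) / \<eta>, v)) (\<omega> 0, \<omega> s) \<partial>R)"
      by (simp add: \<zeta>_def)
    also have "\<dots> = (\<integral>\<^sup>+x. \<integral>\<^sup>+y. (\<lambda>(u, v). f ((u - \<rho> * v) / \<eta>, v)) (x, \<rho> * x + \<eta> * y) \<partial>std_gaussian \<partial>std_gaussian)"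
      by (rule GJ) measurable
    also have "\<dots> = (\<integral>\<^sup>+x. \<integral>\<^sup>+y. (\<lambda>(u, v). f (v, u)) (\<rho> * x + \<eta> * y, \<eta> * x - \<rho> * y) \<partial>std_gaussian \<partial>std_gaussian)"
    proof -
      have "(x - \<rho> * (\<rho> * x + \<eta> * y)) / \<eta> = \<eta> * x - \<rho> * y" for x y
      proof -
        have "x - \<rho> * (\<rho> * x + \<eta> * y) = (1 - \<rho>\<^sup>2) * x - \<eta> * (\<rho> * y)" by (simp add: power2_eq_square algebra_simps)
        also have "1 - \<rho>\<^sup>2 = \<eta>\<^sup>2" using sq by simp
        finally show ?thesis using pos by (simp add: power2_eq_square diff_divide_distrib)
      qed
      then show ?thesis by simp
    qed
    also have "\<dots> = (\<integral>\<^sup>+x. \<integral>\<^sup>+y. (\<lambda>(u, v). f (v, u)) (x, y) \<partial>std_gaussian \<partial>std_gaussian)"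
      using pos sq by (intro nn_integral_std_gaussian_reflection) auto
    finally show ?thesis by simp
  qed
  have q1: "(\<integral>\<^sup>+z. ennreal (?q a z) \<partial>std_gaussian) = 1" "(\<integral>\<^sup>+z. ennreal (?q z a) \<partial>std_gaussian) = 1" for a
    using nn_integral_gaussian_corr_density_eq_1[OF k] by auto
  have q1c: "(\<integral>\<^sup>+z. g * ennreal (?q a z) \<partial>std_gaussian) = g" for a g
    by (subst nn_integral_cmult) (auto simp: q1)
  have qpos: "0 \<le> ?q a b" for a b using gaussian_corr_density_pos[OF k] by (simp add: less_imp_le)
  have G'e: "ennreal (G' \<omega>) = ennreal (G \<omega>) * ennreal (?q (\<zeta> \<omega>) (OU_noise s s' \<omega>))" for \<omega>
    using Gpos[of \<omega>] qpos by (simp add: G'_def ennreal_mult less_imp_le)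

  have joint: "(\<integral>\<^sup>+\<omega>. ennreal (G' \<omega>) * F (\<omega> 0, \<omega> s') \<partial>R) =
      (\<integral>\<^sup>+x. \<integral>\<^sup>+y. F (x, \<rho>' * x + sqrt (1 - \<rho>'\<^sup>2) * y) \<partial>std_gaussian \<partial>std_gaussian)"
    if F[measurable]: "F \<in> borel_measurable (borel \<Otimes>\<^sub>M borel)" for F :: "real \<times> real \<Rightarrow> ennreal"
  proof -
    have X0: "\<omega> 0 = \<rho> * \<omega> s + \<eta> * \<zeta> \<omega>" for \<omega> using pos by (simp add: \<zeta>_def)
    \<comment> \<open>The average over the fresh noise, given X_0 = u and its orthogonal partner w.
      The pair (u, w) is the reflection of (X_s, \<zeta>) with coefficients \<rho> and
      \<eta>.\<close>
    define \<Phi> where "\<Phi> = (\<lambda>(u, w). \<integral>\<^sup>+b. F (u, \<rho>' * u + (\<alpha> * w + \<sigma> * \<theta> * b)) \<partial>std_gaussian)"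
    have [measurable]: "\<Phi> \<in> borel_measurable (borel \<Otimes>\<^sub>M borel)" unfolding \<Phi>_def by measurable
    have "(\<integral>\<^sup>+\<omega>. ennreal (G' \<omega>) * F (\<omega> 0, \<omega> s') \<partial>R) =
       (\<integral>\<^sup>+\<omega>. (\<lambda>(p, z). ennreal (G p) * (ennreal (?q (\<zeta> p) z) * F (p 0, r * p s + \<sigma> * z))) (restrict \<omega> {0..s}, OU_noise s s' \<omega>) \<partial>R)"
      using s by (intro nn_integral_cong) (simp add: G'e Xs' Gr \<zeta>r mult.assoc)
    also have "\<dots> = (\<integral>\<^sup>+\<omega>. \<integral>\<^sup>+z. (\<lambda>(p, z). ennreal (G p) * (ennreal (?q (\<zeta> p) z) * F (p 0, r * p s + \<sigma> * z))) (restrict \<omega> {0..s}, z) \<partial>std_gaussian \<partial>R)"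
    proof -
      note ev[measurable]
      show ?thesis using s s' by (intro nn_integral_noise) auto
    qed
    also have "\<dots> = (\<integral>\<^sup>+\<omega>. ennreal (G \<omega>) * (\<integral>\<^sup>+z. ennreal (?q (\<zeta> \<omega>) z) * F (\<omega> 0, r * \<omega> s + \<sigma> * z) \<partial>std_gaussian) \<partial>R)"
    proof -
      have "(\<integral>\<^sup>+z. g * (ennreal (?q a z) * F (x, y + \<sigma> * z)) \<partial>std_gaussian) =
          g * (\<integral>\<^sup>+z. ennreal (?q a z) * F (x, y + \<sigma> * z) \<partial>std_gaussian)" for g a x y
        by (rule nn_integral_cmult) measurable
      then show ?thesis using s by (simp add: Gr \<zeta>r)
    qed
    also have "\<dots> = (\<integral>\<^sup>+\<omega>. ennreal (G \<omega>) * (\<lambda>(a, x). \<Phi> (\<rho> * x + \<eta> * a, \<eta> * x - \<rho> * a)) (\<zeta> \<omega>, \<omega> s) \<partial>R)"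
    proof (intro nn_integral_cong arg_cong2[where f="(*)"] refl)
      fix \<omega> :: "real \<Rightarrow> real"
      have "(\<integral>\<^sup>+z. ennreal (?q (\<zeta> \<omega>) z) * F (\<omega> 0, r * \<omega> s + \<sigma> * z) \<partial>std_gaussian) =
          (\<integral>\<^sup>+b. F (\<omega> 0, r * \<omega> s + \<sigma> * (k * \<zeta> \<omega> + \<theta> * b)) \<partial>std_gaussian)"
      proof -
        have [measurable]: "(\<lambda>z. F (x, y + \<sigma> * z)) \<in> borel_measurable borel" for x y by measurable
        show ?thesis unfolding \<theta>_def
          by (rule nn_integral_gaussian_corr_density[OF _ k, of "\<lambda>z. F (\<omega> 0, r * \<omega> s + \<sigma> * z)"]) fact
      qed
      also have "\<dots> = \<Phi> (\<rho> * \<omega> s + \<eta> * \<zeta> \<omega>, \<eta> * \<omega> s - \<rho> * \<zeta> \<omega>)"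
      proof -
        have "\<rho>' * (\<rho> * x + \<eta> * a) + \<alpha> * (\<eta> * x - \<rho> * a) = r * x * (\<rho>\<^sup>2 + \<eta>\<^sup>2) + \<sigma> * k * a * (\<rho>\<^sup>2 + \<eta>\<^sup>2)" for x a
          unfolding \<rho>'_def \<alpha>_def by (simp add: power2_eq_square algebra_simps)
        moreover have "\<rho>\<^sup>2 + \<eta>\<^sup>2 = 1" using sq by simp
        ultimately have "\<rho>' * (\<rho> * x + \<eta> * a) + \<alpha> * (\<eta> * x - \<rho> * a) = r * x + \<sigma> * k * a" for x a
          by simp
        then have "\<rho>' * (\<rho> * x + \<eta> * a) + (\<alpha> * (\<eta> * x - \<rho> * a) + \<sigma> * \<theta> * b) = r * x + \<sigma> * k * a + \<sigma> * \<theta> * b" for x a b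
          by (simp only: add.assoc[symmetric])
        then have "\<rho>' * (\<rho> * x + \<eta> * a) + (\<alpha> * (\<eta> * x - \<rho> * a) + \<sigma> * \<theta> * b) = r * x + \<sigma> * (k * a + \<theta> * b)" for x a b
          by (simp only: distrib_left mult.assoc add.assoc)
        note eq = this
        show ?thesis unfolding \<Phi>_def prod.case eq by (simp only: X0[symmetric])
      qed
      finally show "(\<integral>\<^sup>+z. ennreal (?q (\<zeta> \<omega>) z) * F (\<omega> 0, r * \<omega> s + \<sigma> * z) \<partial>std_gaussian) =
        (\<lambda>(a, x). \<Phi> (\<rho> * x + \<eta> * a, \<eta> * x - \<rho> * a)) (\<zeta> \<omega>, \<omega> s)" by simp
    qed
    also have "\<dots> = (\<integral>\<^sup>+x. \<integral>\<^sup>+a. (\<lambda>(a, x). \<Phi> (\<rho> * x + \<eta> * a, \<eta> * x - \<rho> * a)) (a, x) \<partial>std_gaussian \<partial>std_gaussian)"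
      by (rule K) measurable
    also have "\<dots> = (\<integral>\<^sup>+u. \<integral>\<^sup>+w. \<Phi> (u, w) \<partial>std_gaussian \<partial>std_gaussian)"
      using pos sq nn_integral_std_gaussian_reflection[of \<Phi> \<rho> \<eta>] by simp
    also have "\<dots> = (\<integral>\<^sup>+u. \<integral>\<^sup>+y. F (u, \<rho>' * u + sqrt (1 - \<rho>'\<^sup>2) * y) \<partial>std_gaussian \<partial>std_gaussian)"
    proof (rule nn_integral_cong)
      fix u
      show "(\<integral>\<^sup>+w. \<Phi> (u, w) \<partial>std_gaussian) = (\<integral>\<^sup>+y. F (u, \<rho>' * u + sqrt (1 - \<rho>'\<^sup>2) * y) \<partial>std_gaussian)"
        unfolding \<Phi>_def prod.case using pos var \<rho>'2
        by (intro nn_integral_std_gaussian_rotation[of "\<lambda>v. F (u, \<rho>' * u + v)"]) auto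
    qed
    finally show ?thesis .
  qed

  have marg: "(\<integral>\<^sup>+\<omega>. ennreal (G' \<omega>) * f (\<omega> t) \<partial>R) = (\<integral>\<^sup>+x. f x \<partial>std_gaussian)"
    if t: "t \<in> {0..s'}" and f[measurable]: "f \<in> borel_measurable borel" for t and f :: "real \<Rightarrow> ennreal"
  proof -
    consider "t \<in> {0..s}" | "s < t" "t < s'" | "t = s'" using t by fastforce
    then show ?thesis
    proof cases
      case 1
      then have ev1: "(\<lambda>p. p t) \<in> borel_measurable (PiM {0..s} (\<lambda>_. borel :: real measure))" by (rule eval)
      have "(\<integral>\<^sup>+\<omega>. ennreal (G' \<omega>) * f (\<omega> t) \<partial>R) =
         (\<integral>\<^sup>+\<omega>. (\<lambda>(p, z). ennreal (G p) * f (p t) * ennreal (?q (\<zeta> p) z)) (restrict \<omega> {0..s}, OU_noise s s' \<omega>) \<partial>R)"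
        using 1 by (intro nn_integral_cong) (simp add: G'e Gr \<zeta>r mult_ac)
      also have "\<dots> = (\<integral>\<^sup>+\<omega>. \<integral>\<^sup>+z. (\<lambda>(p, z). ennreal (G p) * f (p t) * ennreal (?q (\<zeta> p) z)) (restrict \<omega> {0..s}, z) \<partial>std_gaussian \<partial>R)"
      proof -
        note ev1[measurable]
        show ?thesis using s s' by (intro nn_integral_noise) auto
      qed
      also have "\<dots> = (\<integral>\<^sup>+\<omega>. ennreal (G \<omega>) * f (\<omega> t) \<partial>R)"
        using 1 by (simp add: Gr \<zeta>r q1c)
      finally show ?thesis using Gt[OF 1 f] by simp
    next
      case 2
      define r1 where "r1 = exp (s - t)"
      define r2 where "r2 = exp (t - s')"
      define \<sigma>1 where "\<sigma>1 = sqrt (1 - exp (2 * (s - t)))"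
      define \<sigma>2 where "\<sigma>2 = sqrt (1 - exp (2 * (t - s')))"
      \<comment> \<open>The noise from \<open>s\<close> to \<open>s'\<close> is a combination
        \<open>l\<close> of the innovations before and after \<open>t\<close>. They are integrated
        separately because X_t involves only the former.\<close>
      define l where "l z1 z2 = (r2 * \<sigma>1 * z1 + \<sigma>2 * z2) / \<sigma>" for z1 z2
      have Xt: "\<omega> t = r1 * \<omega> s + \<sigma>1 * OU_noise s t \<omega>" for \<omega>
        using OU_noise_eq[OF 2(1), of \<omega>] by (simp only: r1_def \<sigma>1_def)
      have Xs'2: "\<omega> s' = r2 * \<omega> t + \<sigma>2 * OU_noise t s' \<omega>" for \<omega>
        using OU_noise_eq[OF 2(2), of \<omega>] by (simp only: r2_def \<sigma>2_def)
      have r12: "r1 * r2 = r" by (simp add: r1_def r2_def r_def exp_add[symmetric])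
      have noise: "OU_noise s s' \<omega> = l (OU_noise s t \<omega>) (OU_noise t s' \<omega>)" for \<omega>
      proof -
        have "\<sigma> * OU_noise s s' \<omega> = \<omega> s' - r * \<omega> s" using Xs'[of \<omega>] by simp
        also have "\<dots> = r2 * \<sigma>1 * OU_noise s t \<omega> + \<sigma>2 * OU_noise t s' \<omega>"
          unfolding Xs'2[of \<omega>] Xt[of \<omega>] r12[symmetric] by (simp add: algebra_simps)
        finally show ?thesis using pos by (simp add: l_def field_simps)
      qed
      have [measurable]: "(\<lambda>x. l (f x) (g x)) \<in> borel_measurable N"
        if [measurable]: "f \<in> borel_measurable N" "g \<in> borel_measurable N" for f g and N :: "'z measure"
        unfolding l_def by measurable
      have [measurable]: "(\<lambda>p. restrict p {0..s}) \<in> measurable (PiM {0..t} (\<lambda>_. borel)) (PiM {0..s} (\<lambda>_. borel :: real measure))"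
        using 2 by (intro measurable_restrict_subset) auto
      have [measurable]: "OU_noise s t \<in> borel_measurable (PiM {0..t} (\<lambda>_. borel :: real measure))"
        unfolding OU_noise_def[abs_def] using s 2
        by (intro borel_measurable_divide borel_measurable_diff borel_measurable_times borel_measurable_const eval) auto
      have nr: "OU_noise s t (restrict \<omega> {0..t}) = OU_noise s t \<omega>" for \<omega>
        using s 2 by (simp add: OU_noise_def)
      have rr: "restrict (restrict \<omega> {0..t}) {0..s} = restrict \<omega> {0..s}" for \<omega> :: "real \<Rightarrow> real"
        using 2 by (auto simp: restrict_def fun_eq_iff)
      \<comment> \<open>As a function of the path up to \<open>s\<close> and of two numbers, the
        integrand allows two uses of \<open>nn_integral_noise\<close>: with the past up to
        \<open>t\<close>, and then with the past up to \<open>s\<close>.\<close>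
      define H where "H p z1 z2 = ennreal (G p) * (ennreal (?q (\<zeta> p) (l z1 z2)) * f (r1 * p s + \<sigma>1 * z1))" for p z1 z2
      have Hr: "H (restrict \<omega> {0..s}) = H \<omega>" for \<omega>
        using s by (intro ext) (simp add: H_def Gr \<zeta>r)
      have Hm: "(\<lambda>x. H (fst (fst x)) (snd (fst x)) (snd x)) \<in>
          borel_measurable ((PiM {0..s} (\<lambda>_. borel) \<Otimes>\<^sub>M borel) \<Otimes>\<^sub>M borel)"
      proof -
        note ev[measurable]
        show ?thesis unfolding H_def by measurable
      qed
      have Hm2: "(\<lambda>(p, z2). H (restrict p {0..s}) (OU_noise s t p) z2) \<in> borel_measurable (PiM {0..t} (\<lambda>_. borel) \<Otimes>\<^sub>M borel)"
        using measurable_compose[OF _ Hm, of "\<lambda>x. ((restrict (fst x) {0..s}, OU_noise s t (fst x)), snd x)" "PiM {0..t} (\<lambda>_. borel) \<Otimes>\<^sub>M borel"]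
        by (simp add: split_beta')
      have Hm3: "(\<lambda>(p, z1). \<integral>\<^sup>+z2. H p z1 z2 \<partial>std_gaussian) \<in> borel_measurable (PiM {0..s} (\<lambda>_. borel) \<Otimes>\<^sub>M borel)"
      proof -
        have "(\<lambda>(x, z2). H (fst x) (snd x) z2) \<in> borel_measurable ((PiM {0..s} (\<lambda>_. borel) \<Otimes>\<^sub>M borel) \<Otimes>\<^sub>M std_gaussian)"
          using Hm measurable_cong_sets[OF sets_pair_measure_cong[OF refl sets_std_gaussian] refl] by (simp add: split_beta')
        from \<gamma>.borel_measurable_nn_integral[OF this] show ?thesis by (simp add: split_beta')
      qed
      have cm: "(\<integral>\<^sup>+z1. \<integral>\<^sup>+z2. g * (ennreal (?q a (l z1 z2)) * f (r1 * x + \<sigma>1 * z1)) \<partial>std_gaussian \<partial>std_gaussian) =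
          g * (\<integral>\<^sup>+z1. \<integral>\<^sup>+z2. ennreal (?q a (l z1 z2)) * f (r1 * x + \<sigma>1 * z1) \<partial>std_gaussian \<partial>std_gaussian)" for g a x
        by (simp add: nn_integral_cmult)
      have "(\<integral>\<^sup>+\<omega>. ennreal (G' \<omega>) * f (\<omega> t) \<partial>R) =
         (\<integral>\<^sup>+\<omega>. (\<lambda>(p, z2). H (restrict p {0..s}) (OU_noise s t p) z2) (restrict \<omega> {0..t}, OU_noise t s' \<omega>) \<partial>R)"
      proof (intro nn_integral_cong)
        fix \<omega> :: "real \<Rightarrow> real"
        have "ennreal (G' \<omega>) * f (\<omega> t) = H \<omega> (OU_noise s t \<omega>) (OU_noise t s' \<omega>)"
          by (simp only: H_def G'e noise Xt[symmetric] mult.assoc)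
        then show "ennreal (G' \<omega>) * f (\<omega> t) =
           (\<lambda>(p, z2). H (restrict p {0..s}) (OU_noise s t p) z2) (restrict \<omega> {0..t}, OU_noise t s' \<omega>)"
          by (simp only: prod.case rr nr) (simp only: Hr)
      qed
      also have "\<dots> = (\<integral>\<^sup>+\<omega>. \<integral>\<^sup>+z2. (\<lambda>(p, z2). H (restrict p {0..s}) (OU_noise s t p) z2) (restrict \<omega> {0..t}, z2) \<partial>std_gaussian \<partial>R)"
        using s 2 s' by (intro nn_integral_noise Hm2) auto
      also have "\<dots> = (\<integral>\<^sup>+\<omega>. (\<lambda>(p, z1). \<integral>\<^sup>+z2. H p z1 z2 \<partial>std_gaussian) (restrict \<omega> {0..s}, OU_noise s t \<omega>) \<partial>R)"
        by (simp only: prod.case nr rr)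
      also have "\<dots> = (\<integral>\<^sup>+\<omega>. \<integral>\<^sup>+z1. (\<lambda>(p, z1). \<integral>\<^sup>+z2. H p z1 z2 \<partial>std_gaussian) (restrict \<omega> {0..s}, z1) \<partial>std_gaussian \<partial>R)"
        using s 2 s' by (intro nn_integral_noise Hm3) auto
      also have "\<dots> = (\<integral>\<^sup>+\<omega>. ennreal (G \<omega>) * (\<lambda>(a, x). \<integral>\<^sup>+z1. \<integral>\<^sup>+z2. ennreal (?q a (l z1 z2)) * f (r1 * x + \<sigma>1 * z1) \<partial>std_gaussian \<partial>std_gaussian) (\<zeta> \<omega>, \<omega> s) \<partial>R)"
        by (simp add: Hr) (simp add: H_def[abs_def] cm)
      also have "\<dots> = (\<integral>\<^sup>+x. \<integral>\<^sup>+a. (\<lambda>(a, x). \<integral>\<^sup>+z1. \<integral>\<^sup>+z2. ennreal (?q a (l z1 z2)) * f (r1 * x + \<sigma>1 * z1) \<partial>std_gaussian \<partial>std_gaussian) (a, x) \<partial>std_gaussian \<partial>std_gaussian)"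
        by (rule K) measurable
      also have "\<dots> = (\<integral>\<^sup>+x. \<integral>\<^sup>+z1. f (r1 * x + \<sigma>1 * z1) \<partial>std_gaussian \<partial>std_gaussian)"
      proof (rule nn_integral_cong)
        fix x
        \<comment> \<open>The variable of \<open>\<zeta>\<close> has to become the innermost one,
          where the kernel integrates to 1 whatever the value of \<open>l\<close>.\<close>
        have "(\<integral>\<^sup>+a. \<integral>\<^sup>+z1. \<integral>\<^sup>+z2. ennreal (?q a (l z1 z2)) * f (r1 * x + \<sigma>1 * z1) \<partial>std_gaussian \<partial>std_gaussian \<partial>std_gaussian) =
            (\<integral>\<^sup>+z1. \<integral>\<^sup>+a. \<integral>\<^sup>+z2. ennreal (?q a (l z1 z2)) * f (r1 * x + \<sigma>1 * z1) \<partial>std_gaussian \<partial>std_gaussian \<partial>std_gaussian)"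
          by (rule \<gamma>\<gamma>.Fubini') measurable
        also have "\<dots> = (\<integral>\<^sup>+z1. \<integral>\<^sup>+z2. \<integral>\<^sup>+a. ennreal (?q a (l z1 z2)) * f (r1 * x + \<sigma>1 * z1) \<partial>std_gaussian \<partial>std_gaussian \<partial>std_gaussian)"
          by (rule nn_integral_cong, rule \<gamma>\<gamma>.Fubini') measurable
        also have "\<dots> = (\<integral>\<^sup>+z1. f (r1 * x + \<sigma>1 * z1) \<partial>std_gaussian)"
          by (simp add: nn_integral_multc q1 \<gamma>.emeasure_space_1)
        finally show "(\<integral>\<^sup>+a. (\<lambda>(a, x). \<integral>\<^sup>+z1. \<integral>\<^sup>+z2. ennreal (?q a (l z1 z2)) * f (r1 * x + \<sigma>1 * z1) \<partial>std_gaussian \<partial>std_gaussian) (a, x) \<partial>std_gaussian) =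
          (\<integral>\<^sup>+z1. f (r1 * x + \<sigma>1 * z1) \<partial>std_gaussian)" by simp
      qed
      also have "\<dots> = (\<integral>\<^sup>+x. f (1 * x) \<partial>std_gaussian)"
        unfolding r1_def \<sigma>1_def using 2
        by (intro nn_integral_std_gaussian_rotation) (auto simp: exp_double[symmetric])
      finally show ?thesis by simp
    next
      case 3
      have "(\<integral>\<^sup>+\<omega>. ennreal (G' \<omega>) * f (\<omega> t) \<partial>R) = (\<integral>\<^sup>+x. \<integral>\<^sup>+y. f (\<rho>' * x + sqrt (1 - \<rho>'\<^sup>2) * y) \<partial>std_gaussian \<partial>std_gaussian)"
        using joint[of "\<lambda>p. f (snd p)"] 3 by simp
      also have "\<dots> = (\<integral>\<^sup>+x. f (1 * x) \<partial>std_gaussian)"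
        using \<rho>'2 by (intro nn_integral_std_gaussian_rotation) auto
      finally show ?thesis by simp
    qed
  qed

  have bound: "\<exists>C T. 0 \<le> C \<and> finite T \<and> T \<subseteq> {0..s'} \<and> (\<forall>\<omega>. \<bar>ln (G' \<omega>)\<bar> \<le> C * (1 + (\<Sum>t\<in>T. (\<omega> t)\<^sup>2)))"
  proof -
    obtain C T where C: "0 \<le> C" "finite T" "T \<subseteq> {0..s}" "\<And>\<omega>. \<bar>ln (G \<omega>)\<bar> \<le> C * (1 + (\<Sum>t\<in>T. (\<omega> t)\<^sup>2))"
      using G unfolding tilt_def by blast
    obtain D where D: "0 \<le> D" "\<And>x y. \<bar>ln (?q x y)\<bar> \<le> D * (1 + x\<^sup>2 + y\<^sup>2)"
      using abs_ln_gaussian_corr_density_le[OF k] by blast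
    let ?T = "T \<union> {0, s, s'}"
    \<comment> \<open>For |c| < 1 one has (a - c b)^2 <= 2 a^2 + 2 b^2 <= 4 S. So 4 / \<eta>^2 and 4
      / \<sigma>^2 serve the two arguments of the kernel, and 1 serves the constant term.\<close>
    define B where "B = 4 / \<eta>\<^sup>2 + 4 / \<sigma>\<^sup>2 + 1"
    have B: "0 \<le> B" by (simp add: B_def)
    have quad: "((a - c * b) / d)\<^sup>2 \<le> 4 / d\<^sup>2 * S" if "\<bar>c\<bar> < 1" "a\<^sup>2 \<le> S" "b\<^sup>2 \<le> S" for a b c d S :: real
    proof -
      have "c\<^sup>2 * b\<^sup>2 \<le> 1 * b\<^sup>2" using that(1) by (intro mult_right_mono) (auto simp: abs_square_le_1 less_imp_le)
      then have "(a - c * b)\<^sup>2 \<le> 4 * S"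
        using zero_le_power2[of "a + c * b"] that by (simp add: power2_diff power2_sum power_mult_distrib)
      then have "(a - c * b)\<^sup>2 / d\<^sup>2 \<le> 4 * S / d\<^sup>2" by (rule divide_right_mono) simp
      then show ?thesis by (simp add: power_divide)
    qed
    have "\<bar>ln (G' \<omega>)\<bar> \<le> (C + D * B) * (1 + (\<Sum>t\<in>?T. (\<omega> t)\<^sup>2))" for \<omega>
    proof -
      define S where "S = (\<Sum>t\<in>?T. (\<omega> t)\<^sup>2)"
      have mem: "(\<omega> u)\<^sup>2 \<le> S" if "u \<in> ?T" for u
        unfolding S_def using that C(2) by (intro member_le_sum) auto
      have S0: "0 \<le> S" by (simp add: S_def sum_nonneg)
      have z: "(\<zeta> \<omega>)\<^sup>2 \<le> 4 / \<eta>\<^sup>2 * S" unfolding \<zeta>_def by (intro quad mem \<rho>) auto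
      have n: "(OU_noise s s' \<omega>)\<^sup>2 \<le> 4 / \<sigma>\<^sup>2 * S"
        unfolding OU_noise_def \<sigma>_noise r_def[symmetric] using r by (intro quad mem) auto
      have "ln (G' \<omega>) = ln (G \<omega>) + ln (?q (\<zeta> \<omega>) (OU_noise s s' \<omega>))"
        unfolding G'_def by (rule ln_mult_pos[OF Gpos gaussian_corr_density_pos[OF k]])
      then have "\<bar>ln (G' \<omega>)\<bar> \<le> \<bar>ln (G \<omega>)\<bar> + \<bar>ln (?q (\<zeta> \<omega>) (OU_noise s s' \<omega>))\<bar>" by simp
      also have "\<dots> \<le> C * (1 + S) + D * (B * (1 + S))"
      proof (rule add_mono)
        have "(\<Sum>t\<in>T. (\<omega> t)\<^sup>2) \<le> S" unfolding S_def using C(2) by (intro sum_mono2) auto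
        then show "\<bar>ln (G \<omega>)\<bar> \<le> C * (1 + S)"
          using C(1) by (intro order_trans[OF C(4)] mult_left_mono) auto
        have "1 + (\<zeta> \<omega>)\<^sup>2 + (OU_noise s s' \<omega>)\<^sup>2 \<le> B * (1 + S)"
        proof -
          have "B * (1 + S) = B + 4 / \<eta>\<^sup>2 * S + 4 / \<sigma>\<^sup>2 * S + S"
            by (simp add: B_def distrib_left distrib_right)
          moreover have "1 \<le> B" by (simp add: B_def)
          ultimately show ?thesis using z n S0 by linarith
        qed
        then show "\<bar>ln (?q (\<zeta> \<omega>) (OU_noise s s' \<omega>))\<bar> \<le> D * (B * (1 + S))"
          using D(1) by (intro order_trans[OF D(2)] mult_left_mono)
      qed
      finally show ?thesis by (simp add: S_def algebra_simps)
    qed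
    moreover have "?T \<subseteq> {0..s'}" using C(3) s s' by auto
    moreover have "0 \<le> C + D * B" using C(1) D(1) B by simp
    ultimately show ?thesis using C(2) by (intro exI[of _ "C + D * B"] exI[of _ ?T]) auto
  qed

  have G'm: "G' \<in> borel_measurable (PiM {0..s'} (\<lambda>_. borel))"
  proof -
    have [measurable]: "(\<lambda>p. restrict p {0..s}) \<in> measurable (PiM {0..s'} (\<lambda>_. borel)) (PiM {0..s} (\<lambda>_. borel :: real measure))"
      using s' by (intro measurable_restrict_subset) auto
    have [measurable]: "OU_noise s s' \<in> borel_measurable (PiM {0..s'} (\<lambda>_. borel :: real measure))"
      unfolding OU_noise_def[abs_def] using s s'
      by (intro borel_measurable_divide borel_measurable_diff borel_measurable_times borel_measurable_const eval) auto
    have "(\<lambda>p. G (restrict p {0..s}) * ?q (\<zeta> (restrict p {0..s})) (OU_noise s s' p)) \<in> borel_measurable (PiM {0..s'} (\<lambda>_. borel))"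
      by measurable
    then show ?thesis by (simp add: Gr \<zeta>r G'_def[abs_def])
  qed
  have G'r: "G' (restrict \<omega> {0..s'}) = G' \<omega>" for \<omega>
  proof -
    have "G (restrict \<omega> {0..s'}) = G (restrict (restrict \<omega> {0..s'}) {0..s})" by (rule Gr[symmetric])
    also have "restrict (restrict \<omega> {0..s'}) {0..s} = restrict \<omega> {0..s}"
      using s' by (auto simp: restrict_def fun_eq_iff)
    also have "G (restrict \<omega> {0..s}) = G \<omega>" by (rule Gr)
    finally have "G (restrict \<omega> {0..s'}) = G \<omega>" .
    moreover have "\<zeta> (restrict \<omega> {0..s'}) = \<zeta> \<omega>" using s' by (intro \<zeta>r) simp
    moreover have "OU_noise s s' (restrict \<omega> {0..s'}) = OU_noise s s' \<omega>" using s s' by (simp add: OU_noise_def)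
    ultimately show ?thesis by (simp only: G'_def)
  qed
  have G'pos: "0 < G' \<omega>" for \<omega> using Gpos[of \<omega>] gaussian_corr_density_pos[OF k] by (simp add: G'_def)
  have "tilt s' \<rho>' G'"
    unfolding tilt_def using s s' \<rho>' G'm G'r G'pos bound marg joint by auto
  then show ?thesis
    by (simp add: \<rho>'_def G'_def[abs_def] \<zeta>_def \<sigma>_def \<eta>_def)
qed

end

section \<open>From tilts to admissible laws of finite entropy\<close>

lemma prob_space_gaussian_corr: "prob_space (gaussian_corr c)"
proof -
  interpret pair_prob_space std_gaussian std_gaussian
    by (intro pair_prob_space.intro pair_sigma_finite.intro prob_space_imp_sigma_finite prob_space_std_gaussian)
  have "(\<lambda>(x, y). (x, c * x + sqrt (1 - c\<^sup>2) * y)) \<in> measurable (std_gaussian \<Otimes>\<^sub>M std_gaussian) (borel :: (real \<times> real) measure)"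
    unfolding borel_prod[symmetric] by measurable
  then show ?thesis unfolding gaussian_corr_def by (rule prob_space_distr)
qed

lemma sets_gaussian_corr: "sets (gaussian_corr c) = sets borel"
  by (simp add: gaussian_corr_def)

lemma nn_integral_gaussian_corr:
  fixes F :: "real \<times> real \<Rightarrow> ennreal"
  assumes [measurable]: "F \<in> borel_measurable borel"
  shows "(\<integral>\<^sup>+p. F p \<partial>gaussian_corr c) =
    (\<integral>\<^sup>+x. \<integral>\<^sup>+y. F (x, c * x + sqrt (1 - c\<^sup>2) * y) \<partial>std_gaussian \<partial>std_gaussian)"
proof -
  interpret \<gamma>: prob_space std_gaussian by (rule prob_space_std_gaussian)
  have m[measurable]: "(\<lambda>(x, y). (x, c * x + sqrt (1 - c\<^sup>2) * y)) \<in> measurable (std_gaussian \<Otimes>\<^sub>M std_gaussian) (borel :: (real \<times> real) measure)"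
    unfolding borel_prod[symmetric] by measurable
  have "(\<integral>\<^sup>+p. F p \<partial>gaussian_corr c) =
      (\<integral>\<^sup>+p. F ((\<lambda>(x, y). (x, c * x + sqrt (1 - c\<^sup>2) * y)) p) \<partial>(std_gaussian \<Otimes>\<^sub>M std_gaussian))"
    unfolding gaussian_corr_def by (rule nn_integral_distr[OF m]) measurable
  also have "\<dots> = (\<integral>\<^sup>+x. \<integral>\<^sup>+y. F ((\<lambda>(x, y). (x, c * x + sqrt (1 - c\<^sup>2) * y)) (x, y)) \<partial>std_gaussian \<partial>std_gaussian)"
    by (rule \<gamma>.nn_integral_fst[symmetric]) measurable
  finally show ?thesis by simp
qed

text \<open>Puts a marginal constraint into the form of prescribed probabilities that
  \<open>ex1_entropy_minimiser\<close> accepts.\<close>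

lemma distr_eq_iff_measure:
  assumes P: "prob_space P" and N: "prob_space N" "sets N = sets L" and X: "X \<in> measurable P L"
  shows "distr P L X = N \<longleftrightarrow> (\<forall>A\<in>sets L. measure P (X -` A \<inter> space P) = measure N A)"
proof -
  interpret P: prob_space P by fact
  interpret N: prob_space N by fact
  interpret D: prob_space "distr P L X" by (rule P.prob_space_distr[OF X])
  show ?thesis
  proof
    assume "distr P L X = N"
    then show "\<forall>A\<in>sets L. measure P (X -` A \<inter> space P) = measure N A"
      using measure_distr[OF X] by auto
  next
    assume *: "\<forall>A\<in>sets L. measure P (X -` A \<inter> space P) = measure N A"
    show "distr P L X = N"
    proof (rule measure_eqI)
      fix A assume "A \<in> sets (distr P L X)"
      then have A: "A \<in> sets L" by simp
      then have "measure (distr P L X) A = measure N A" using * measure_distr[OF X A] by simp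
      then show "emeasure (distr P L X) A = emeasure N A"
        by (simp add: D.emeasure_eq_measure N.emeasure_eq_measure)
    qed (simp add: N)
  qed
qed

context OU_law
begin

text \<open>Integrated under the tilted law, the quadratic bound on |ln G| gives at most C (1 + card
  T), because every one-time marginal has second moment 1.\<close>

lemma tilt_admissible:
  assumes G: "tilt 1 c G"
  shows "density R G \<in> admissible (gaussian_corr c)" and "relative_entropy (density R G) R < \<infinity>"
proof -
  interpret \<gamma>: prob_space std_gaussian by (rule prob_space_std_gaussian)
  have Gm: "G \<in> borel_measurable (PiM {0..1} (\<lambda>_. borel))"
    and Gr: "\<And>\<omega>. G (restrict \<omega> {0..1}) = G \<omega>" and Gpos: "\<And>\<omega>. 0 < G \<omega>"
    and Gt: "\<And>t f. t \<in> {0..1} \<Longrightarrow> f \<in> borel_measurable borel \<Longrightarrow>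
        (\<integral>\<^sup>+\<omega>. ennreal (G \<omega>) * f (\<omega> t) \<partial>R) = (\<integral>\<^sup>+x. f x \<partial>std_gaussian)"
    and GJ: "\<And>F. F \<in> borel_measurable (borel \<Otimes>\<^sub>M borel) \<Longrightarrow>
        (\<integral>\<^sup>+\<omega>. ennreal (G \<omega>) * F (\<omega> 0, \<omega> 1) \<partial>R) =
        (\<integral>\<^sup>+x. \<integral>\<^sup>+y. F (x, c * x + sqrt (1 - c\<^sup>2) * y) \<partial>std_gaussian \<partial>std_gaussian)"
    using G unfolding tilt_def by auto
  obtain C T where C: "0 \<le> C" "finite T" "T \<subseteq> {0..1}" "\<And>\<omega>. \<bar>ln (G \<omega>)\<bar> \<le> C * (1 + (\<Sum>t\<in>T. (\<omega> t)\<^sup>2))"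
    using G unfolding tilt_def by blast
  have restR: "(\<lambda>\<omega>. restrict \<omega> {0..1}) \<in> measurable R (PiM {0..1} (\<lambda>_. borel))"
    using measurable_restrict_path_space[of 1] measurable_cong_sets[OF sets_R refl] by auto
  have GR[measurable]: "G \<in> borel_measurable R"
    using measurable_compose[OF restR Gm] by (simp add: Gr)
  have evalR: "(\<lambda>\<omega>. \<omega> u) \<in> borel_measurable R" if "u \<in> {0..1}" for u
    unfolding borel_measurable_R using that by (rule measurable_path_eval)
  let ?P = "density R G"
  have int1: "(\<integral>\<^sup>+\<omega>. ennreal (G \<omega>) \<partial>R) = 1"
    using Gt[of 0 "\<lambda>_. 1"] by (simp add: \<gamma>.emeasure_space_1)
  have "emeasure ?P (space ?P) = 1"
    using int1 by (simp add: emeasure_density cong: nn_integral_cong)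
  then have P: "prob_space ?P" by (rule prob_spaceI)
  have marg: "distr ?P borel (\<lambda>\<omega>. \<omega> t) = std_gaussian" if t: "t \<in> {0..1}" for t
  proof (rule measure_eqI)
    fix A assume "A \<in> sets (distr ?P borel (\<lambda>\<omega>. \<omega> t))"
    then have A[measurable]: "A \<in> sets borel" by simp
    have ev[measurable]: "(\<lambda>\<omega>. \<omega> t) \<in> borel_measurable R" using t by (rule evalR)
    have "emeasure (distr ?P borel (\<lambda>\<omega>. \<omega> t)) A = (\<integral>\<^sup>+x. indicator A x \<partial>distr ?P borel (\<lambda>\<omega>. \<omega> t))"
      by simp
    also have "\<dots> = (\<integral>\<^sup>+\<omega>. indicator A (\<omega> t) \<partial>?P)" by (rule nn_integral_distr) auto
    also have "\<dots> = (\<integral>\<^sup>+\<omega>. ennreal (G \<omega>) * indicator A (\<omega> t) \<partial>R)" by (rule nn_integral_density) auto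
    also have "\<dots> = (\<integral>\<^sup>+x. indicator A x \<partial>std_gaussian)" by (rule Gt[OF t]) auto
    also have "\<dots> = emeasure std_gaussian A" by (rule nn_integral_indicator) (simp add: sets_std_gaussian)
    finally show "emeasure (distr ?P borel (\<lambda>\<omega>. \<omega> t)) A = emeasure std_gaussian A" .
  qed (simp add: sets_std_gaussian)
  have pair: "(\<lambda>\<omega>. (\<omega> 0, \<omega> 1)) \<in> borel_measurable R"
    by (intro borel_measurable_Pair evalR) auto
  have joint: "distr ?P borel (\<lambda>\<omega>. (\<omega> 0, \<omega> 1)) = gaussian_corr c"
  proof (rule measure_eqI)
    fix A assume "A \<in> sets (distr ?P borel (\<lambda>\<omega>. (\<omega> 0, \<omega> 1)) :: (real \<times> real) measure)"
    then have A: "A \<in> sets borel" by simp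
    have ind: "(indicator A :: _ \<Rightarrow> ennreal) \<in> borel_measurable borel" using A by simp
    have "emeasure (distr ?P borel (\<lambda>\<omega>. (\<omega> 0, \<omega> 1))) A = (\<integral>\<^sup>+x. indicator A x \<partial>distr ?P borel (\<lambda>\<omega>. (\<omega> 0, \<omega> 1)))"
      using A by simp
    also have "\<dots> = (\<integral>\<^sup>+\<omega>. indicator A (\<omega> 0, \<omega> 1) \<partial>?P)"
      using pair ind by (intro nn_integral_distr) auto
    also have "\<dots> = (\<integral>\<^sup>+\<omega>. ennreal (G \<omega>) * indicator A (\<omega> 0, \<omega> 1) \<partial>R)"
      using measurable_compose[OF pair ind] by (intro nn_integral_density) auto
    also have "\<dots> = (\<integral>\<^sup>+x. \<integral>\<^sup>+y. indicator A (x, c * x + sqrt (1 - c\<^sup>2) * y) \<partial>std_gaussian \<partial>std_gaussian)"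
      using ind by (intro GJ) (simp add: borel_prod)
    also have "\<dots> = (\<integral>\<^sup>+p. indicator A p \<partial>gaussian_corr c)"
      by (rule nn_integral_gaussian_corr[OF ind, symmetric])
    also have "\<dots> = emeasure (gaussian_corr c) A" using A by (intro nn_integral_indicator) (simp add: sets_gaussian_corr)
    finally show "emeasure (distr ?P borel (\<lambda>\<omega>. (\<omega> 0, \<omega> 1))) A = emeasure (gaussian_corr c) A" .
  qed (simp add: sets_gaussian_corr)
  show "?P \<in> admissible (gaussian_corr c)"
    using P sets_R marg joint by (simp add: admissible_def)
  have sq: "(\<integral>\<^sup>+x. ennreal (x\<^sup>2) \<partial>std_gaussian) = 1"
    using has_bochner_integral_std_gaussian(3)
    by (subst nn_integral_eq_integral) (auto simp: has_bochner_integral_iff)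
  have "integrable R (\<lambda>\<omega>. G \<omega> * ln (G \<omega>))"
  proof (rule integrableI_bounded)
    have "(\<integral>\<^sup>+\<omega>. ennreal (norm (G \<omega> * ln (G \<omega>))) \<partial>R) \<le>
        (\<integral>\<^sup>+\<omega>. ennreal C * (ennreal (G \<omega>) + (\<Sum>t\<in>T. ennreal (G \<omega>) * ennreal ((\<omega> t)\<^sup>2))) \<partial>R)"
    proof (rule nn_integral_mono)
      fix \<omega> :: "real \<Rightarrow> real"
      have "norm (G \<omega> * ln (G \<omega>)) = G \<omega> * \<bar>ln (G \<omega>)\<bar>"
        using Gpos[of \<omega>] by (simp add: abs_mult)
      also have "\<dots> \<le> G \<omega> * (C * (1 + (\<Sum>t\<in>T. (\<omega> t)\<^sup>2)))"
        using Gpos[of \<omega>] C(4)[of \<omega>] by (intro mult_left_mono) auto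
      also have "\<dots> = C * (G \<omega> + (\<Sum>t\<in>T. G \<omega> * (\<omega> t)\<^sup>2))"
        by (simp add: distrib_left sum_distrib_left[symmetric])
      finally have "ennreal (norm (G \<omega> * ln (G \<omega>))) \<le> ennreal (C * (G \<omega> + (\<Sum>t\<in>T. G \<omega> * (\<omega> t)\<^sup>2)))"
        by (rule ennreal_leI)
      also have "\<dots> = ennreal C * (ennreal (G \<omega>) + ennreal (\<Sum>t\<in>T. G \<omega> * (\<omega> t)\<^sup>2))"
        using C(1) Gpos[of \<omega>] by (simp add: ennreal_mult ennreal_plus sum_nonneg less_imp_le)
      also have "ennreal (\<Sum>t\<in>T. G \<omega> * (\<omega> t)\<^sup>2) = (\<Sum>t\<in>T. ennreal (G \<omega> * (\<omega> t)\<^sup>2))"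
        using Gpos[of \<omega>] by (intro sum_ennreal[symmetric]) (simp add: less_imp_le)
      also have "\<dots> = (\<Sum>t\<in>T. ennreal (G \<omega>) * ennreal ((\<omega> t)\<^sup>2))"
        using Gpos[of \<omega>] by (intro sum.cong refl ennreal_mult) (simp_all add: less_imp_le)
      finally show "ennreal (norm (G \<omega> * ln (G \<omega>))) \<le>
        ennreal C * (ennreal (G \<omega>) + (\<Sum>t\<in>T. ennreal (G \<omega>) * ennreal ((\<omega> t)\<^sup>2)))" .
    qed
    also have "\<dots> = ennreal C * (1 + (\<Sum>t\<in>T. 1))"
    proof -
      have evT[measurable]: "(\<lambda>\<omega>. \<omega> t) \<in> borel_measurable R" if "t \<in> T" for t using that C(3) by (auto intro: evalR)
      have m2: "(\<lambda>\<omega>. ennreal (G \<omega>) * ennreal ((\<omega> t)\<^sup>2)) \<in> borel_measurable R" if "t \<in> T" for t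
        using evT[OF that] by measurable
      have "(\<integral>\<^sup>+\<omega>. ennreal (G \<omega>) * ennreal ((\<omega> t)\<^sup>2) \<partial>R) = 1" if "t \<in> T" for t
        using Gt[of t "\<lambda>x. ennreal (x\<^sup>2)"] that C(3) sq by auto
      then show ?thesis
        using m2 int1 by (simp add: nn_integral_cmult nn_integral_add nn_integral_sum borel_measurable_sum)
    qed
    also have "\<dots> < \<infinity>" by (simp add: ennreal_mult_less_top of_nat_less_top)
    finally show "(\<integral>\<^sup>+\<omega>. ennreal (norm (G \<omega> * ln (G \<omega>))) \<partial>R) < \<infinity>" .
  qed measurable
  then show "relative_entropy ?P R < \<infinity>"
    using relative_entropy_density[OF prob_space_axioms GR] Gpos by (simp add: less_imp_le)
qed

text \<open>Solves the formula of \<open>tilt_step\<close> for \<open>k\<close>; the hypothesis on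
  \<rho>' is k^2 < 1 with the denominator cleared.\<close>

lemma tilt_to:
  assumes G: "tilt s \<rho> G" and s': "s < s'" "s' \<le> 1"
    and \<rho>': "(\<rho>' - exp (s - s') * \<rho>)\<^sup>2 < (1 - (exp (s - s'))\<^sup>2) * (1 - \<rho>\<^sup>2)"
  shows "\<exists>G'. tilt s' \<rho>' G'"
proof -
  define r where "r = exp (s - s')"
  define d where "d = sqrt (1 - r\<^sup>2) * sqrt (1 - \<rho>\<^sup>2)"
  have "\<bar>\<rho>\<bar> < 1" using G by (simp add: tilt_def)
  then have \<rho>2: "\<rho>\<^sup>2 < 1" by (simp add: abs_square_less_1)
  have "0 < r" "r < 1" using s' by (auto simp: r_def)
  then have r2: "r\<^sup>2 < 1" by (simp add: power_less_one_iff)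
  have d: "0 < d" using \<rho>2 r2 by (simp add: d_def)
  have d2: "d\<^sup>2 = (1 - r\<^sup>2) * (1 - \<rho>\<^sup>2)" using \<rho>2 r2 by (simp add: d_def power_mult_distrib)
  define k where "k = (\<rho>' - r * \<rho>) / d"
  have "k\<^sup>2 < 1" using \<rho>' d by (simp add: k_def power_divide r_def[symmetric] d2[symmetric])
  then have k: "\<bar>k\<bar> < 1" by (simp add: abs_square_less_1)
  have "r * \<rho> + sqrt (1 - r\<^sup>2) * k * sqrt (1 - \<rho>\<^sup>2) = r * \<rho> + d * k" by (simp add: d_def)
  also have "\<dots> = \<rho>'" using d by (simp add: k_def)
  finally show ?thesis using tilt_step[OF G s' k] unfolding r_def by auto
qed

text \<open>The correlation starts at r = exp (-1/4) at time 1/4 and has three steps left to reach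
  \<open>c\<close>. With explicit stops, the step conditions follow from rational bounds on
  r.\<close>

lemma tilt_exists:
  assumes c: "4 * exp (- 1) - 3 * exp (- 1 / 3) \<le> c" "c < 1"
  shows "\<exists>G. tilt 1 c G"
proof -
  define r :: real where "r = exp (- 1 / 4)"
  \<comment> \<open>From 1 + x + x^2 / 2 <= exp x <= 1 + x + x^2 at x = 1/4.\<close>
  have r: "16 / 21 \<le> r" "r \<le> 32 / 41"
  proof -
    have r': "r = 1 / exp (1 / 4)" by (simp add: r_def exp_minus field_simps)
    have "exp (1 / 4 :: real) \<le> 1 + 1 / 4 + (1 / 4)\<^sup>2" by (rule exp_bound) auto
    then have "exp (1 / 4 :: real) \<le> 21 / 16" by (simp add: power2_eq_square)
    then show "16 / 21 \<le> r" unfolding r' by (simp add: field_simps)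
    have "1 + 1 / 4 + (1 / 4)\<^sup>2 / 2 \<le> exp (1 / 4 :: real)" by (rule exp_lower_Taylor_quadratic) simp
    then have "41 / 32 \<le> exp (1 / 4 :: real)" by (simp add: power2_eq_square)
    then show "r \<le> 32 / 41" unfolding r' by (simp add: field_simps)
  qed
  \<comment> \<open>A coarse rational replacement for the given bound, which is about -0.68. It can
    afford to be coarse: steps of length 1/4 reach down to cos (4 a) with cos a = r, which is about
    -0.91.\<close>
  have clow: "- 13 / 16 \<le> c"
  proof -
    have "r ^ 4 = exp (- 1)" unfolding r_def by (subst exp_of_nat_mult[symmetric]) simp
    moreover have "(16 / 21) ^ 4 \<le> r ^ 4" using r by (intro power_mono) auto
    ultimately have 1: "(16 / 21) ^ 4 \<le> exp (- 1 :: real)" by simp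
    have "1 + 1 / 3 + (1 / 3)\<^sup>2 / 2 \<le> exp (1 / 3 :: real)" by (rule exp_lower_Taylor_quadratic) simp
    then have "25 / 18 \<le> exp (1 / 3 :: real)" by (simp add: power2_eq_square)
    then have "exp (- 1 / 3 :: real) \<le> 18 / 25" by (simp add: exp_minus field_simps)
    with 1 c(1) show ?thesis by (simp add: power4_eq_xxxx)
  qed
  have r2: "(16 / 21)\<^sup>2 \<le> r\<^sup>2" "r\<^sup>2 \<le> (32 / 41)\<^sup>2" using r by (auto intro!: power_mono)
  then have r2': "58 / 100 \<le> r\<^sup>2" "r\<^sup>2 \<le> 6092 / 10000" by (auto simp: power2_eq_square)
  have rs: "exp (1 / 4 - 1 / 2) = r" "exp (1 / 2 - 3 / 4) = r" "exp (3 / 4 - 1) = r" by (auto simp: r_def)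
  have sqless: "x\<^sup>2 < y\<^sup>2" if "- y < x" "x < y" for x y :: real
    using mult_pos_pos[of "y - x" "y + x"] that by (simp add: power2_eq_square algebra_simps)
  obtain G1 where G1: "tilt (1 / 4) r G1" using tilt_const[of "1 / 4"] by (auto simp: r_def)
  \<comment> \<open>For c > 1/4 the correlation is brought back to r at time 3/4, by way of 1/2;
    from r the last step reaches all of (2 r^2 - 1, 1), and 2 r^2 - 1 < 1/4. Otherwise it passes
    from 3/10 to -3/10, and the last step reaches everything at distance less than 59/100 from -3 r
    / 10, which covers [-13/16, 1/4].\<close>
  obtain \<rho>1 \<rho>2 where \<rho>: "(\<rho>1 - r * r)\<^sup>2 < (1 - r\<^sup>2) * (1 - r\<^sup>2)"
    "(\<rho>2 - r * \<rho>1)\<^sup>2 < (1 - r\<^sup>2) * (1 - \<rho>1\<^sup>2)" "(c - r * \<rho>2)\<^sup>2 < (1 - r\<^sup>2) * (1 - \<rho>2\<^sup>2)"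
  proof (cases "1 / 4 < c")
    case True
    have "(1 / 2 - r\<^sup>2)\<^sup>2 < (1 - r\<^sup>2)\<^sup>2" using r2' by (intro sqless) auto
    moreover have "(r - r * (1 / 2))\<^sup>2 < (1 - r\<^sup>2) * (1 - (1 / 2)\<^sup>2)"
      using r2' by (simp add: power2_eq_square)
    moreover have "(c - r\<^sup>2)\<^sup>2 < (1 - r\<^sup>2)\<^sup>2" using r2' True c by (intro sqless) auto
    ultimately show ?thesis by (intro that[of "1 / 2" r]) (auto simp: power2_eq_square)
  next
    case False
    have "(3 / 10 - r\<^sup>2)\<^sup>2 < (1 - r\<^sup>2)\<^sup>2" using r2' by (intro sqless) auto
    moreover have "(- 3 / 10 - r * (3 / 10))\<^sup>2 < (1 - r\<^sup>2) * (1 - (3 / 10)\<^sup>2)"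
    proof -
      have "(- 3 / 10 - r * (3 / 10))\<^sup>2 = 9 / 100 + 18 / 100 * r + 9 / 100 * r\<^sup>2" by (simp add: power2_eq_square algebra_simps)
      also have "\<dots> < 91 / 100 - 91 / 100 * r\<^sup>2" using r r2' by linarith
      finally show ?thesis by (simp add: power2_eq_square)
    qed
    moreover have "(c - r * (- 3 / 10))\<^sup>2 < (1 - r\<^sup>2) * (1 - (- 3 / 10)\<^sup>2)"
    proof -
      have "(c - r * (- 3 / 10))\<^sup>2 < (59 / 100)\<^sup>2" using clow False r by (intro sqless) auto
      also have "\<dots> \<le> (1 - r\<^sup>2) * (1 - (- 3 / 10)\<^sup>2)" using r2' by (simp add: power2_eq_square)
      finally show ?thesis .
    qed
    ultimately show ?thesis by (intro that[of "3 / 10" "- 3 / 10"]) (auto simp: power2_eq_square)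
  qed
  obtain G2 where G2: "tilt (1 / 2) \<rho>1 G2" using tilt_to[OF G1, of "1 / 2" \<rho>1] \<rho>(1) rs by auto
  obtain G3 where G3: "tilt (3 / 4) \<rho>2 G3" using tilt_to[OF G2, of "3 / 4" \<rho>2] \<rho>(2) rs by auto
  show ?thesis using tilt_to[OF G3, of 1 c] \<rho>(3) rs by auto
qed

end

theorem proposition4p2:
  fixes M :: "'a measure"
    and W :: "real \<Rightarrow> 'a \<Rightarrow> real"
    and X :: "'a \<Rightarrow> real \<Rightarrow> real"
    and R :: "(real \<Rightarrow> real) measure"
    and \<pi> :: "(real \<times> real) measure"
    and c :: real
  assumes "stationary_OU M W X"
    and "R = distr M path_space X"
    and "4 * exp (- 1) - 3 * exp (- 1 / 3) \<le> c" and "c < 1"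
    and "\<pi> = gaussian_corr c"
  shows "\<exists>!P. is_solution R \<pi> P"
proof -
  interpret OU_law R unfolding assms(2) by (rule OU_law_distr[OF assms(1)])
  have \<pi>: "prob_space \<pi>" "sets \<pi> = sets borel"
    by (auto simp: assms(5) prob_space_gaussian_corr sets_gaussian_corr)
  \<comment> \<open>The constraints as pairs of an event and its prescribed probability: one pair
    for every time and Borel set of the line, and one for every Borel set of the plane.\<close>
  define C where "C = (\<lambda>(t, A). ((\<lambda>\<omega>. \<omega> t) -` A \<inter> space R, measure std_gaussian A)) ` ({0..1} \<times> sets borel) \<union>
    (\<lambda>A. ((\<lambda>\<omega>. (\<omega> 0, \<omega> 1)) -` A \<inter> space R, measure \<pi> A)) ` sets borel"
  have evalR: "(\<lambda>\<omega>. \<omega> u) \<in> borel_measurable R" if "u \<in> {0..1}" for u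
    unfolding borel_measurable_R using that by (rule measurable_path_eval)
  have pairR: "(\<lambda>\<omega>. (\<omega> 0, \<omega> 1)) \<in> borel_measurable R"
    by (intro borel_measurable_Pair evalR) auto
  have adm: "admissible \<pi> = {P. prob_space P \<and> sets P = sets R \<and> (\<forall>(A, p)\<in>C. measure P A = p)}"
  proof (rule set_eqI)
    fix P :: "(real \<Rightarrow> real) measure"
    have "((\<forall>t\<in>{0..1}. distr P borel (\<lambda>\<omega>. \<omega> t) = std_gaussian) \<and> distr P borel (\<lambda>\<omega>. (\<omega> 0, \<omega> 1)) = \<pi>) \<longleftrightarrow>
        (\<forall>(A, p)\<in>C. measure P A = p)" if P: "prob_space P" "sets P = sets R"
    proof -
      have sp: "space P = space R" using P(2) by (rule sets_eq_imp_space_eq)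
      have m: "(\<lambda>\<omega>. \<omega> t) \<in> borel_measurable P" if "t \<in> {0..1}" for t
        using evalR[OF that] measurable_cong_sets[OF P(2) refl] by blast
      have m2: "(\<lambda>\<omega>. (\<omega> 0, \<omega> 1)) \<in> borel_measurable P"
        using pairR measurable_cong_sets[OF P(2) refl] by blast
      have 1: "distr P borel (\<lambda>\<omega>. \<omega> t) = std_gaussian \<longleftrightarrow>
          (\<forall>A\<in>sets borel. measure P ((\<lambda>\<omega>. \<omega> t) -` A \<inter> space R) = measure std_gaussian A)" if "t \<in> {0..1}" for t
        unfolding sp[symmetric] by (rule distr_eq_iff_measure[OF P(1) prob_space_std_gaussian sets_std_gaussian m[OF that]])
      have 2: "distr P borel (\<lambda>\<omega>. (\<omega> 0, \<omega> 1)) = \<pi> \<longleftrightarrow>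
          (\<forall>A\<in>sets borel. measure P ((\<lambda>\<omega>. (\<omega> 0, \<omega> 1)) -` A \<inter> space R) = measure \<pi> A)"
        unfolding sp[symmetric] by (rule distr_eq_iff_measure[OF P(1) \<pi> m2])
      have "(\<forall>(A, p)\<in>C. measure P A = p) \<longleftrightarrow>
          (\<forall>t\<in>{0..1}. \<forall>A\<in>sets borel. measure P ((\<lambda>\<omega>. \<omega> t) -` A \<inter> space R) = measure std_gaussian A) \<and>
          (\<forall>A\<in>sets borel. measure P ((\<lambda>\<omega>. (\<omega> 0, \<omega> 1)) -` A \<inter> space R) = measure \<pi> A)"
        by (auto simp: C_def ball_Un)
      then show ?thesis unfolding 2 using 1 by simp
    qed
    then show "P \<in> admissible \<pi> \<longleftrightarrow> P \<in> {P. prob_space P \<and> sets P = sets R \<and> (\<forall>(A, p)\<in>C. measure P A = p)}"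
      by (auto simp: admissible_def sets_R)
  qed
  obtain G where "tilt 1 c G" using tilt_exists assms by blast
  from tilt_admissible[OF this] have ex: "\<exists>P\<in>admissible \<pi>. relative_entropy P R < \<infinity>"
    using assms(5) by blast
  have Csets: "A \<in> sets R" if "(A, p) \<in> C" for A p
    using that measurable_sets[OF evalR] measurable_sets[OF pairR] by (auto simp: C_def)
  show ?thesis
    unfolding is_solution_def adm
    by (rule ex1_entropy_minimiser[OF prob_space_axioms Csets ex[unfolded adm]])
qed

end
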